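(* Let $m\in\mathbb N^+$ and let $V\in C^\infty(\mathbb T^2;\mathbb R)$ be resonantly unstable with respect to $m$, i.e. $\langle V\rangle_m$ has at least one zero and every zero $x_0$ of $\langle V\rangle_m$ satisfies $\langle V\rangle_m'(x_0)\neq 0$. Then there exist $\epsilon(V)>0$ and $\delta_1,\delta_2>0$ such that for every $0<\epsilon<\epsilon(V)$ and every $s>1$ there exists $u_0\in\mathcal H^s(\mathbb T)$, $u_0\neq 0$, such that the solution $u$ of $$\partial_t u=(m+\epsilon V(t,x))\partial_x u+\tfrac{\epsilon}{2}\partial_x V(t,x)\,u,\qquad u(0,\cdot)=u_0,$$ satisfies $$\|u(t)\|_s\ge \delta_1 e^{\epsilon\delta_2 t}\|u_0\|_s\qquad\text{for all } t>0.$$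
   Context: $\mathbb T:=\mathbb R/2\pi\mathbb Z$. For $s\in\mathbb R$, $\mathcal H^s(\mathbb T)$ is the space of $u$ with $\|u\|_s^2:=\sum_{k\in\mathbb Z}\langle k\rangle^{2s}|u_k|^2<\infty$, where $\langle k\rangle=(1+k^2)^{1/2}$ and $u_k$ are the Fourier coefficients of $u$. For $V\in C^\infty(\mathbb T^2;\mathbb C)$ with Fourier expansion $V(t,x)=\sum_{k,\ell\in\mathbb Z}v_{k,\ell}e^{i(kx+\ell t)}$, the resonant average of $V$ with respect to $m\in\mathbb N^+$ is $\langle V\rangle_m(x):=\sum_{k\in\mathbb Z}v_{k,mk}e^{ikx}$. *)

theory Defs
  imports "HOL-Analysis.Analysis"
begin

text \<open>Functions on the torus are represented as 2pi-periodic functions on the reals.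
  Points of the 2-torus are pairs (t, x).\<close>

fun Ck2 :: "nat \<Rightarrow> (real \<times> real \<Rightarrow> real) \<Rightarrow> bool" where
  "Ck2 0 f = continuous_on UNIV f"
| "Ck2 (Suc n) f = (\<exists>ft fx. (\<forall>p. (f has_derivative (\<lambda>h. ft p * fst h + fx p * snd h)) (at p))
                      \<and> Ck2 n ft \<and> Ck2 n fx)"

definition smooth2 :: "(real \<times> real \<Rightarrow> real) \<Rightarrow> bool" where
  "smooth2 f \<longleftrightarrow> (\<forall>n. Ck2 n f)"

definition periodic2 :: "(real \<times> real \<Rightarrow> real) \<Rightarrow> bool" where
  "periodic2 V \<longleftrightarrow> (\<forall>t x. V (t + 2*pi, x) = V (t, x) \<and> V (t, x + 2*pi) = V (t, x))"

definition vcoef :: "(real \<times> real \<Rightarrow> real) \<Rightarrow> int \<Rightarrow> int \<Rightarrow> complex" where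
  "vcoef V k l = (LINT p:{0..2*pi} \<times> {0..2*pi}|lborel.
      complex_of_real (V p) * exp (- \<i> * (of_int k * of_real (snd p) + of_int l * of_real (fst p))))
      / (4 * pi\<^sup>2)"

definition res_avg :: "nat \<Rightarrow> (real \<times> real \<Rightarrow> real) \<Rightarrow> real \<Rightarrow> complex" where
  "res_avg m V x = (\<Sum>\<^sub>\<infinity>k::int. vcoef V k (int m * k) * exp (\<i> * of_int k * of_real x))"

definition resonantly_unstable :: "nat \<Rightarrow> (real \<times> real \<Rightarrow> real) \<Rightarrow> bool" where
  "resonantly_unstable m V \<longleftrightarrow>
     (\<exists>x0. res_avg m V x0 = 0) \<and>
     (\<forall>x0. res_avg m V x0 = 0 \<longrightarrow> vector_derivative (res_avg m V) (at x0) \<noteq> 0)"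

definition fcoef :: "(real \<Rightarrow> complex) \<Rightarrow> int \<Rightarrow> complex" where
  "fcoef u k = (LINT x:{0..2*pi}|lborel. u x * exp (- \<i> * of_int k * of_real x)) / (2 * pi)"

definition japan :: "int \<Rightarrow> real" where
  "japan k = sqrt (1 + (real_of_int k)\<^sup>2)"

definition in_Hs :: "real \<Rightarrow> (real \<Rightarrow> complex) \<Rightarrow> bool" where
  "in_Hs s u \<longleftrightarrow> (\<forall>x. u (x + 2*pi) = u x) \<and> u \<in> borel_measurable lborel \<and>
     set_integrable lborel {0..2*pi} (\<lambda>x. (cmod (u x))\<^sup>2) \<and>
     ((\<lambda>k. (japan k powr (2 * s)) * (cmod (fcoef u k))\<^sup>2) summable_on UNIV)"

definition sob_norm :: "real \<Rightarrow> (real \<Rightarrow> complex) \<Rightarrow> real" where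
  "sob_norm s u = sqrt (\<Sum>\<^sub>\<infinity>k::int. (japan k powr (2 * s)) * (cmod (fcoef u k))\<^sup>2)"

text \<open>Solution of  d_t u = (m + eps V) d_x u + (eps/2) (d_x V) u,  u(0) = u0, for t >= 0,
  in the class C([0,inf), H^s), the equation holding weakly: for every Fourier mode
  phi(x) = e^{ikx}, the pairing t |-> int_0^{2pi} u(t,x) phi(x) dx is differentiable with
  derivative int u (- d_x((m + eps V) phi) + (eps/2) (d_x V) phi) dx (integration by parts).\<close>
definition is_solution ::
  "nat \<Rightarrow> real \<Rightarrow> (real \<times> real \<Rightarrow> real) \<Rightarrow> real \<Rightarrow> (real \<Rightarrow> complex) \<Rightarrow> (real \<Rightarrow> real \<Rightarrow> complex) \<Rightarrow> bool"
  where
  "is_solution m \<epsilon> V s u0 u \<longleftrightarrow>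
     u 0 = u0 \<and>
     (\<forall>t\<ge>0. in_Hs s (u t)) \<and>
     (\<forall>t0\<ge>0. ((\<lambda>t. sob_norm s (\<lambda>x. u t x - u t0 x)) \<longlongrightarrow> 0) (at t0 within {0..})) \<and>
     (\<forall>k::int. \<forall>t\<ge>0.
        ((\<lambda>\<tau>. LINT x:{0..2*pi}|lborel. u \<tau> x * exp (\<i> * of_int k * of_real x))
          has_vector_derivative
          (LINT x:{0..2*pi}|lborel. u t x *
              ( - complex_of_real (real m + \<epsilon> * V (t, x)) * (\<i> * of_int k * exp (\<i> * of_int k * of_real x))
                - complex_of_real (\<epsilon> * deriv (\<lambda>y. V (t, y)) x) * exp (\<i> * of_int k * of_real x)
                + complex_of_real (\<epsilon> / 2 * deriv (\<lambda>y. V (t, y)) x) * exp (\<i> * of_int k * of_real x))))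
        (at t within {0..}))"

end

theory Submission
  imports Defs
begin

text \<open>
  The growing solution starts from \<open>u0 = 1\<close>. Put \<open>a = m + \<epsilon> V\<close> and let \<open>\<Phi>\<close> be the flow of
  \<open>x' = - a (t, x)\<close>, so that \<open>\<Phi>\<^sub>z = exp (- E)\<close> with \<open>E (t, z) = \<integral>\<^sub>0\<^sup>t \<epsilon> V\<^sub>x (\<tau>, \<Phi> (\<tau>, z)) d\<tau>\<close>. The solution is
  \<open>u (t, \<Phi> (t, z)) = exp (E (t, z) / 2)\<close>, and its Fourier coefficients are the oscillatory integrals
  of \<open>exp (- E / 2) e\<^sup>i\<^sup>k\<^sup>\<Phi>\<close>, which can be differentiated in \<open>t\<close> and decay rapidly in \<open>k\<close> without
  any reference to the inverse flow.

  In the frame moving with speed \<open>m\<close> the characteristics obey a slow periodic equation whose average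
  is \<open>y' = - \<epsilon> \<langle>V\<rangle>\<^sub>m (y)\<close>. A zero \<open>y0\<close> of \<open>\<langle>V\<rangle>\<^sub>m\<close> with positive derivative \<open>\<rho>\<close> attracts, so for small \<open>\<epsilon>\<close> the
  characteristic from \<open>y0\<close> stays close to \<open>y0\<close> and \<open>E\<close> grows at least like \<open>\<epsilon> \<rho> t / 4\<close> along it. Hence
  the supremum of \<open>|u (t)|\<close> grows exponentially; for \<open>s > 1\<close> it is bounded by the Sobolev norm with a
  constant independent of \<open>s\<close>, while the constant function \<open>1\<close> has norm \<open>1\<close> for every \<open>s\<close>.

  Every weak solution has the same Fourier coefficients as this one: in Fourier space the equation is
  given by a skew-Hermitian matrix, and the energy of the difference of two solutions, truncated to
  the frequencies \<open>|k| \<le> n\<close>, has a time derivative that tends to \<open>0\<close> as \<open>n \<rightarrow> \<infinity>\<close>, because \<open>s > 1\<close>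
  makes \<open>\<Sum> \<langle>k\<rangle>\<^sup>1\<^sup>/\<^sup>2 |u\<^sub>k|\<close> finite.
\<close>

section \<open>Smooth functions of two variables\<close>

text \<open>The explicit solution conserves the L2 norm: with x = \<Phi> (t, z) the square of the
  weight exp (E / 2) cancels the Jacobian exp (- E), so |u|^2 dx = dz. Growth has to come from
  concentration, which happens where characteristics contract; this is why an attracting zero is
  sought, and the minus sign in the characteristic equation makes attraction correspond to a
  positive derivative of the average.

  Two features of the claim shape the rest. It concerns every weak solution, known only through its
  pairings with the exponentials, so an arbitrary solution is not followed along characteristics but
  compared with the explicit one coefficient by coefficient. And the constants are chosen before
  \<epsilon> and s, so trapping must hold for all times with a loss bounded uniformly in \<epsilon>;
  this is achieved by a periodic, hence bounded, corrector of first-order averaging.\<close>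

definition has_partials :: "(real \<times> real \<Rightarrow> real) \<Rightarrow> (real \<times> real \<Rightarrow> real) \<Rightarrow> (real \<times> real \<Rightarrow> real) \<Rightarrow> bool" where
  "has_partials f ft fx \<longleftrightarrow> (\<forall>p. (f has_derivative (\<lambda>h. ft p * fst h + fx p * snd h)) (at p))"

lemma has_partialsD: "has_partials f ft fx \<Longrightarrow> (f has_derivative (\<lambda>h. ft p * fst h + fx p * snd h)) (at p)"
  unfolding has_partials_def by blast

lemma has_partials_continuous: "has_partials f ft fx \<Longrightarrow> continuous_on UNIV f"
  by (meson continuous_at_imp_continuous_on has_derivative_continuous has_partialsD)

lemma Ck2_Suc_iff: "Ck2 (Suc n) f \<longleftrightarrow> (\<exists>ft fx. has_partials f ft fx \<and> Ck2 n ft \<and> Ck2 n fx)"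
  by (simp add: has_partials_def)

declare Ck2.simps(2)[simp del]

lemma Ck2_SucI: "has_partials f ft fx \<Longrightarrow> Ck2 n ft \<Longrightarrow> Ck2 n fx \<Longrightarrow> Ck2 (Suc n) f"
  by (auto simp: Ck2_Suc_iff)

lemma Ck2_continuous: "Ck2 n f \<Longrightarrow> continuous_on UNIV f"
  by (cases n) (auto simp: Ck2_Suc_iff has_partials_continuous)

text \<open>Derivatives of products, compositions and exponentials still contain the
  undifferentiated functions, so the inductions below need these one order lower than they are
  given.\<close>

lemma Ck2_SucD: "Ck2 (Suc n) f \<Longrightarrow> Ck2 n f"
proof (induction n arbitrary: f)
  case 0 then show ?case using Ck2_continuous by simp
next
  case (Suc n) then show ?case by (metis Ck2_Suc_iff)
qed

lemma Ck2_const [intro]: "Ck2 n (\<lambda>p. c)"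
proof (induction n arbitrary: c)
  case (Suc n)
  show ?case by (rule Ck2_SucI[of _ "\<lambda>_. 0" "\<lambda>_. 0"]) (auto simp: has_partials_def Suc)
qed simp

lemma Ck2_fst [intro]: "Ck2 n fst"
proof (cases n)
  case (Suc k)
  have "has_partials fst (\<lambda>_. 1) (\<lambda>_. 0)"
    by (auto simp: has_partials_def intro!: derivative_eq_intros)
  then show ?thesis unfolding Suc by (rule Ck2_SucI) auto
qed (auto intro: continuous_intros)

lemma Ck2_snd [intro]: "Ck2 n snd"
proof (cases n)
  case (Suc k)
  have "has_partials snd (\<lambda>_. 0) (\<lambda>_. 1)"
    by (auto simp: has_partials_def intro!: derivative_eq_intros)
  then show ?thesis unfolding Suc by (rule Ck2_SucI) auto
qed (auto intro: continuous_intros)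

lemma has_partials_add:
  assumes "has_partials f ft fx" "has_partials g gt gx"
  shows "has_partials (\<lambda>p. f p + g p) (\<lambda>p. ft p + gt p) (\<lambda>p. fx p + gx p)"
  unfolding has_partials_def
  by (auto intro!: derivative_eq_intros has_partialsD[OF assms(1)] has_partialsD[OF assms(2)] simp: algebra_simps)

lemma has_partials_mult:
  assumes "has_partials f ft fx" "has_partials g gt gx"
  shows "has_partials (\<lambda>p. f p * g p) (\<lambda>p. f p * gt p + ft p * g p) (\<lambda>p. f p * gx p + fx p * g p)"
  unfolding has_partials_def
  by (auto intro!: derivative_eq_intros has_partialsD[OF assms(1)] has_partialsD[OF assms(2)] simp: algebra_simps)

lemma has_partials_compose:
  assumes "has_partials f ft fx" "has_partials g gt gx" "has_partials h ht hx"
  shows "has_partials (\<lambda>p. f (g p, h p)) (\<lambda>p. ft (g p, h p) * gt p + fx (g p, h p) * ht p)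
     (\<lambda>p. ft (g p, h p) * gx p + fx (g p, h p) * hx p)"
  unfolding has_partials_def
proof
  fix p
  have "((\<lambda>p. (g p, h p)) has_derivative (\<lambda>k. (gt p * fst k + gx p * snd k, ht p * fst k + hx p * snd k))) (at p)"
    by (intro has_derivative_Pair has_partialsD[OF assms(2)] has_partialsD[OF assms(3)])
  from has_derivative_compose[OF this has_partialsD[OF assms(1), of "(g p, h p)"]]
  show "((\<lambda>p. f (g p, h p)) has_derivative
      (\<lambda>k. (ft (g p, h p) * gt p + fx (g p, h p) * ht p) * fst k +
           (ft (g p, h p) * gx p + fx (g p, h p) * hx p) * snd k)) (at p)"
    by (rule has_derivative_eq_rhs) (auto simp: algebra_simps)
qed

lemma Ck2_add [intro]: "Ck2 n f \<Longrightarrow> Ck2 n g \<Longrightarrow> Ck2 n (\<lambda>p. f p + g p)"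
proof (induction n arbitrary: f g)
  case (Suc n)
  then show ?case unfolding Ck2_Suc_iff by (blast intro: has_partials_add)
qed (auto intro: continuous_intros)

lemma Ck2_mult [intro]: "Ck2 n f \<Longrightarrow> Ck2 n g \<Longrightarrow> Ck2 n (\<lambda>p. f p * g p)"
proof (induction n arbitrary: f g)
  case (Suc n)
  have fg: "Ck2 n f" "Ck2 n g" using Suc.prems by (auto intro: Ck2_SucD)
  obtain ft fx gt gx where *: "has_partials f ft fx" "has_partials g gt gx"
    and c: "Ck2 n ft" "Ck2 n fx" "Ck2 n gt" "Ck2 n gx"
    using Suc.prems by (auto simp: Ck2_Suc_iff)
  show ?case
    by (rule Ck2_SucI[OF has_partials_mult[OF *]]) (intro Ck2_add Suc.IH c fg)+
qed (auto intro: continuous_intros)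

lemma Ck2_compose:
  "Ck2 n f \<Longrightarrow> Ck2 n g \<Longrightarrow> Ck2 n h \<Longrightarrow> Ck2 n (\<lambda>p. f (g p, h p))"
proof (induction n arbitrary: f g h)
  case 0
  then show ?case
    by (auto intro!: continuous_on_compose2[of UNIV f] continuous_intros)
next
  case (Suc n)
  have gh: "Ck2 n g" "Ck2 n h" using Suc.prems by (auto intro: Ck2_SucD)
  obtain ft fx gt gx ht hx where *: "has_partials f ft fx" "has_partials g gt gx" "has_partials h ht hx"
    and c: "Ck2 n ft" "Ck2 n fx" "Ck2 n gt" "Ck2 n gx" "Ck2 n ht" "Ck2 n hx"
    using Suc.prems by (auto simp: Ck2_Suc_iff)
  show ?case
    by (rule Ck2_SucI[OF has_partials_compose[OF *]]) (intro Ck2_add Ck2_mult Suc.IH c gh)+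
qed

lemma Ck2_exp [intro]: "Ck2 n f \<Longrightarrow> Ck2 n (\<lambda>p. exp (f p))"
proof (induction n arbitrary: f)
  case 0
  then show ?case by (auto intro!: continuous_intros)
next
  case (Suc n)
  then obtain ft fx where *: "has_partials f ft fx" "Ck2 n ft" "Ck2 n fx" by (auto simp: Ck2_Suc_iff)
  have "has_partials (\<lambda>p. exp (f p)) (\<lambda>p. exp (f p) * ft p) (\<lambda>p. exp (f p) * fx p)"
    unfolding has_partials_def
    by (auto intro!: derivative_eq_intros has_partialsD[OF *(1)] simp: algebra_simps)
  then show ?case
    by (rule Ck2_SucI) (intro Ck2_mult Suc.IH[OF Ck2_SucD[OF Suc.prems]] *)+
qed

text \<open>Separate partial derivatives do not yield a total derivative; joint continuity of the
  x-derivative closes the gap. Primitives and flows get their two partials by unrelated arguments,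
  which are combined here.\<close>

lemma has_partialsI:
  assumes t: "\<And>t x. ((\<lambda>t. f (t, x)) has_real_derivative ft (t, x)) (at t)"
    and x: "\<And>t x. ((\<lambda>x. f (t, x)) has_real_derivative fx (t, x)) (at x)"
    and c: "continuous_on UNIV fx"
  shows "has_partials f ft fx"
  unfolding has_partials_def
proof
  fix p :: "real \<times> real"
  obtain t x where p: "p = (t, x)" by (cases p)
  have "((\<lambda>(t, x). f (t, x)) has_derivative (\<lambda>(tx, ty). ft (t, x) * tx + blinfun_mult_right (fx (t, x)) ty)) (at (t, x) within UNIV \<times> UNIV)"
  proof (rule has_derivative_partialsI)
    show "((\<lambda>t. f (t, x)) has_derivative (*) (ft (t, x))) (at t)"
      using t by (simp add: has_field_derivative_def)
    show "((\<lambda>y. f (t, y)) has_derivative blinfun_apply (blinfun_mult_right (fx (t, y)))) (at y)" for t y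
      using x by (simp add: has_field_derivative_def)
    show "continuous (at (t, x) within UNIV \<times> UNIV) (\<lambda>(x, y). blinfun_mult_right (fx (x, y)))"
    proof -
      have "continuous_on UNIV (\<lambda>p. blinfun_mult_right (fx p))"
        by (intro continuous_intros c)
      then have "isCont (\<lambda>p. blinfun_mult_right (fx p)) (t, x)"
        unfolding continuous_on_eq_continuous_at[OF open_UNIV] by blast
      then show ?thesis by (simp add: split_def)
    qed
  qed auto
  then show "(f has_derivative (\<lambda>h. ft p * fst h + fx p * snd h)) (at p)"
    by (simp add: p split_beta')
qed

lemma has_partials_fst:
  "has_partials f ft fx \<Longrightarrow> ((\<lambda>t. f (t, x)) has_real_derivative ft (t, x)) (at t within S)"
  unfolding has_field_derivative_def
  by (rule has_derivative_at_withinI, rule has_derivative_eq_rhs, rule has_derivative_compose[of "\<lambda>t. (t, x)" "\<lambda>h. (h, 0)"],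
      auto intro!: derivative_eq_intros has_partialsD)

lemma has_partials_snd:
  "has_partials f ft fx \<Longrightarrow> ((\<lambda>x. f (t, x)) has_real_derivative fx (t, x)) (at x within S)"
  unfolding has_field_derivative_def
  by (rule has_derivative_at_withinI, rule has_derivative_eq_rhs, rule has_derivative_compose[of "\<lambda>x. (t, x)" "\<lambda>h. (0, h)"],
      auto intro!: derivative_eq_intros has_partialsD)

lemma has_partials_curve:
  assumes "has_partials f ft fx" "(y has_real_derivative y') (at t)"
  shows "((\<lambda>t. f (t, y t)) has_real_derivative ft (t, y t) + fx (t, y t) * y') (at t)"
proof -
  have "((\<lambda>t. (t, y t)) has_derivative (\<lambda>h. (h, y' * h))) (at t)"
    using assms(2) by (auto intro!: derivative_eq_intros simp: has_field_derivative_def)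
  from has_derivative_compose[OF this has_partialsD[OF assms(1)]]
  show ?thesis unfolding has_field_derivative_def
    by (rule has_derivative_eq_rhs) (auto simp: algebra_simps)
qed

text \<open>A primitive in \<open>t\<close>, rescaled to a fixed interval of integration so that no case distinction
  on the sign of \<open>t\<close> is needed.\<close>

definition prim :: "(real \<times> real \<Rightarrow> real) \<Rightarrow> real \<times> real \<Rightarrow> real" where
  "prim b p = fst p * integral {0..1} (\<lambda>\<sigma>. b (\<sigma> * fst p, snd p))"

lemma prim_0 [simp]: "prim b (0, x) = 0"
  by (simp add: prim_def)

lemma continuous_on_UNIV_compose:
  "continuous_on UNIV f \<Longrightarrow> continuous_on S g \<Longrightarrow> continuous_on S (\<lambda>x. f (g x))"
  by (rule continuous_on_compose2) auto

text \<open>The fundamental theorem after the substitution \<open>\<sigma> * t\<close>, which also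
  covers negative \<open>t\<close>. With \<open>t\<close> replaced by an increment it gives the
  quotient formula for \<open>slope\<close>.\<close>

lemma rescaled_integral_eq:
  fixes F q :: "real \<Rightarrow> real"
  assumes "\<And>t. (F has_real_derivative q t) (at t)"
  shows "t * integral {0..1} (\<lambda>\<sigma>. q (\<sigma> * t)) = F t - F 0"
proof -
  have "((\<lambda>\<sigma>. t * q (\<sigma> * t)) has_integral F (1 * t) - F (0 * t)) {0..1}"
  proof (rule fundamental_theorem_of_calculus)
    fix x :: real
    have "((\<lambda>\<sigma>. F (\<sigma> * t)) has_real_derivative q (x * t) * t) (at x within {0..1})"
      by (rule DERIV_chain2[OF assms]) (auto intro!: derivative_eq_intros)
    then show "((\<lambda>\<sigma>. F (\<sigma> * t)) has_vector_derivative t * q (x * t)) (at x within {0..1})"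
      by (simp add: has_real_derivative_iff_has_vector_derivative mult.commute)
  qed simp
  then show ?thesis by (simp add: integral_unique flip: integral_mult_right)
qed

lemma prim_DERIV_fst:
  assumes "continuous_on UNIV b"
  shows "((\<lambda>t. prim b (t, x)) has_real_derivative b (t, x)) (at t)"
proof -
  have "\<exists>F. \<forall>t. -\<infinity> < ereal t \<longrightarrow> ereal t < \<infinity> \<longrightarrow> (F has_vector_derivative b (t, x)) (at t)"
    by (rule einterval_antiderivative)
      (auto intro!: continuous_on_interior[of UNIV] continuous_on_UNIV_compose[OF assms] continuous_intros)
  then obtain F where F: "\<And>t. (F has_real_derivative b (t, x)) (at t)"
    by (auto simp: has_real_derivative_iff_has_vector_derivative)
  have "prim b (t, x) = F t - F 0" for t
    using rescaled_integral_eq[OF F, of t] by (simp add: prim_def)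
  then show ?thesis using F by (auto intro!: derivative_eq_intros)
qed

lemma continuous_on_rescaled:
  fixes b :: "real \<times> real \<Rightarrow> real"
  assumes "continuous_on UNIV b"
  shows "continuous_on UNIV (\<lambda>p :: real \<times> real. integral {0..1::real} (\<lambda>\<sigma>. b (\<sigma> * fst p, snd p)))"
proof -
  have "continuous_on UNIV (\<lambda>p :: real \<times> real. integral (cbox 0 1) (\<lambda>\<sigma>::real. b (\<sigma> * fst p, snd p)))"
    by (rule integral_continuous_on_param[where f="\<lambda>p \<sigma>. b (\<sigma> * fst p, snd p)"])
      (auto simp: split_beta intro!: continuous_on_UNIV_compose[OF assms] continuous_intros)
  then show ?thesis by simp
qed

lemma continuous_on_prim:
  assumes "continuous_on UNIV b"
  shows "continuous_on UNIV (prim b)"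
  unfolding prim_def[abs_def]
  by (intro continuous_intros continuous_on_rescaled assms)

lemma prim_DERIV_snd:
  assumes b: "continuous_on UNIV b" and x: "\<And>t x. ((\<lambda>x. b (t, x)) has_real_derivative bx (t, x)) (at x)"
    and c: "continuous_on UNIV bx"
  shows "((\<lambda>x. prim b (t, x)) has_real_derivative prim bx (t, x)) (at x)"
proof -
  have "((\<lambda>x. integral (cbox 0 1) (\<lambda>\<sigma>. b (\<sigma> * t, x))) has_real_derivative
      integral (cbox 0 1) (\<lambda>\<sigma>. bx (\<sigma> * t, x))) (at x within UNIV)"
  proof (rule leibniz_rule_field_derivative)
    show "(\<lambda>\<sigma>. b (\<sigma> * t, y)) integrable_on cbox 0 1" for y
      by (intro integrable_continuous continuous_on_UNIV_compose[OF b] continuous_intros)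
    show "continuous_on (UNIV \<times> cbox 0 1) (\<lambda>(x, \<sigma>). bx (\<sigma> * t, x))"
      by (auto simp: split_beta intro!: continuous_on_UNIV_compose[OF c] continuous_intros)
  qed (auto intro: x)
  then show ?thesis
    by (auto simp: prim_def cbox_interval intro!: derivative_eq_intros)
qed

lemma has_partials_prim:
  assumes "has_partials b bt bx" "continuous_on UNIV bx"
  shows "has_partials (prim b) b (prim bx)"
  by (intro has_partialsI prim_DERIV_fst prim_DERIV_snd continuous_on_prim has_partials_snd[OF assms(1)]
      has_partials_continuous[OF assms(1)] assms)

text \<open>Integration in t gains an order in t but none in x, so the order is preserved and not
  raised: the t-derivative is \<open>b\<close> itself, the x-derivative is again a
  primitive.\<close>

lemma Ck2_prim [intro]: "Ck2 n b \<Longrightarrow> Ck2 n (prim b)"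
proof (induction n arbitrary: b)
  case (Suc n)
  then obtain bt bx where b: "has_partials b bt bx" "Ck2 n bt" "Ck2 n bx" by (auto simp: Ck2_Suc_iff)
  show ?case
    by (rule Ck2_SucI[OF has_partials_prim[OF b(1) Ck2_continuous[OF b(3)]]])
      (auto intro: Suc.IH b(3) Ck2_SucD Suc.prems)
qed (simp add: continuous_on_prim)

text \<open>Fixing the partials through the Frechet derivative replaces the existential witnesses of
  \<open>Ck2\<close>, which a priori depend on the order, by one choice valid for all
  orders.\<close>

definition dt2 :: "(real \<times> real \<Rightarrow> real) \<Rightarrow> real \<times> real \<Rightarrow> real" where
  "dt2 f p = frechet_derivative f (at p) (1, 0)"

definition dx2 :: "(real \<times> real \<Rightarrow> real) \<Rightarrow> real \<times> real \<Rightarrow> real" where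
  "dx2 f p = frechet_derivative f (at p) (0, 1)"

lemma has_partials_eq_dt2: "has_partials f ft fx \<Longrightarrow> ft = dt2 f"
  and has_partials_eq_dx2: "has_partials f ft fx \<Longrightarrow> fx = dx2 f"
  using frechet_derivative_at[OF has_partialsD, symmetric] by (auto simp: dt2_def dx2_def)

lemma smooth2_has_partials:
  assumes "smooth2 f"
  shows "has_partials f (dt2 f) (dx2 f)"
  using assms has_partials_eq_dt2 has_partials_eq_dx2 unfolding smooth2_def by (metis Ck2_Suc_iff)

lemma smooth2_dx2: "smooth2 f \<Longrightarrow> smooth2 (dx2 f)"
  using has_partials_eq_dx2 unfolding smooth2_def by (metis Ck2_Suc_iff)

lemma smooth2_continuous: "smooth2 f \<Longrightarrow> continuous_on UNIV f"
  by (auto simp: smooth2_def dest: Ck2_continuous)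

lemma smooth2_const: "smooth2 (\<lambda>p. c)"
  and smooth2_fst: "smooth2 fst"
  and smooth2_snd: "smooth2 snd"
  and smooth2_add: "smooth2 f \<Longrightarrow> smooth2 g \<Longrightarrow> smooth2 (\<lambda>p. f p + g p)"
  and smooth2_mult: "smooth2 f \<Longrightarrow> smooth2 g \<Longrightarrow> smooth2 (\<lambda>p. f p * g p)"
  and smooth2_exp: "smooth2 f \<Longrightarrow> smooth2 (\<lambda>p. exp (f p))"
  and smooth2_compose: "smooth2 f \<Longrightarrow> smooth2 g \<Longrightarrow> smooth2 h \<Longrightarrow> smooth2 (\<lambda>p. f (g p, h p))"
  and smooth2_prim: "smooth2 f \<Longrightarrow> smooth2 (prim f)"
  by (auto simp: smooth2_def intro: Ck2_compose)

lemmas smooth2_intros = smooth2_const smooth2_fst smooth2_snd smooth2_add smooth2_mult smooth2_exp smooth2_prim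

lemma smooth2_diff: "smooth2 f \<Longrightarrow> smooth2 g \<Longrightarrow> smooth2 (\<lambda>p. f p - g p)"
  using smooth2_add[OF _ smooth2_mult[OF smooth2_const[of "-1"]], of f g] by simp

lemma smooth2_DERIV_fst: "smooth2 f \<Longrightarrow> ((\<lambda>t. f (t, x)) has_real_derivative dt2 f (t, x)) (at t within S)"
  and smooth2_DERIV_snd: "smooth2 f \<Longrightarrow> ((\<lambda>x. f (t, x)) has_real_derivative dx2 f (t, x)) (at x within S)"
  by (blast intro: has_partials_fst has_partials_snd smooth2_has_partials)+

lemma dx2_eqI: "smooth2 f \<Longrightarrow> (\<And>t x. ((\<lambda>x. f (t, x)) has_real_derivative g (t, x)) (at x)) \<Longrightarrow> dx2 f = g"
  using DERIV_unique[OF smooth2_DERIV_snd] by fastforce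

section \<open>Flow of a periodic vector field\<close>

lemma periodic_int_shift:
  fixes f :: "real \<Rightarrow> 'a" and n :: int
  assumes "\<And>x. f (x + 2 * pi) = f x"
  shows "f (x + 2 * pi * of_int n) = f x"
proof -
  have nat: "f (x + 2 * pi * real k) = f x" for x k
  proof (induction k)
    case (Suc k)
    have "f (x + 2 * pi * real (Suc k)) = f ((x + 2 * pi * real k) + 2 * pi)"
      by (simp add: algebra_simps)
    then show ?case using assms Suc by simp
  qed simp
  show ?thesis
  proof (cases "n \<ge> 0")
    case True
    then show ?thesis using nat[of x "nat n"] by simp
  next
    case False
    then show ?thesis using nat[of "x + 2 * pi * of_int n" "nat (- n)"] by simp
  qed
qed

lemma period_representative:
  obtains n :: int where "x + 2 * pi * of_int n \<in> {0..2 * pi}"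
proof
  have "of_int \<lfloor>x / (2 * pi)\<rfloor> * (2 * pi) \<le> x" "x \<le> (of_int \<lfloor>x / (2 * pi)\<rfloor> + 1) * (2 * pi)"
    using floor_divide_lower[of "2 * pi" x] floor_divide_upper[of "2 * pi" x] by auto
  then show "x + 2 * pi * of_int (- \<lfloor>x / (2 * pi)\<rfloor>) \<in> {0..2 * pi}"
    by (auto simp: algebra_simps)
qed

lemma periodic2_bounded:
  assumes per: "periodic2 f" and c: "continuous_on UNIV f"
  obtains M where "M > 0" "\<And>p. \<bar>f p\<bar> \<le> M"
proof -
  have "compact (f ` ({0..2 * pi} \<times> {0..2 * pi}))"
    by (intro compact_continuous_image continuous_on_subset[OF c] compact_Times) auto
  then have "bounded (f ` ({0..2 * pi} \<times> {0..2 * pi}))" by (rule compact_imp_bounded)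
  then obtain M where M: "M > 0" "\<And>p. p \<in> {0..2 * pi} \<times> {0..2 * pi} \<Longrightarrow> \<bar>f p\<bar> \<le> M"
    unfolding bounded_pos by auto
  have "\<bar>f (t, x)\<bar> \<le> M" for t x
  proof -
    obtain n k where nk: "t + 2 * pi * of_int n \<in> {0..2 * pi}" "x + 2 * pi * of_int k \<in> {0..2 * pi}"
      using period_representative by metis
    have "f (t + 2 * pi * of_int n, x + 2 * pi * of_int k) = f (t + 2 * pi * of_int n, x)"
      using per by (intro periodic_int_shift[of "\<lambda>x. f (_, x)"]) (auto simp: periodic2_def)
    also have "\<dots> = f (t, x)"
      using per by (intro periodic_int_shift[of "\<lambda>t. f (t, _)"]) (auto simp: periodic2_def)
    finally show ?thesis using M(2) nk by (metis mem_Times_iff fst_conv snd_conv)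
  qed
  then show ?thesis using M(1) that by auto
qed

lemma periodic_deriv:
  fixes f f' :: "real \<Rightarrow> real"
  assumes "\<And>x. (f has_real_derivative f' x) (at x)" "\<And>x. f (x + c) = f x"
  shows "f' (x + c) = f' x"
proof -
  have "((\<lambda>x. f (x + c)) has_real_derivative f' (x + c)) (at x)"
    using assms(1)[of "x + c"] DERIV_shift[of f _ x c] by simp
  then have "(f has_real_derivative f' (x + c)) (at x)" by (simp add: assms(2))
  then show ?thesis using assms(1) DERIV_unique by blast
qed

lemma periodic2_dx2:
  assumes "smooth2 f" "periodic2 f"
  shows "periodic2 (dx2 f)"
  unfolding periodic2_def
proof (intro allI conjI)
  fix t x
  have "((\<lambda>x. f (t + 2 * pi, x)) has_real_derivative dx2 f (t + 2 * pi, x)) (at x)"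
    by (rule smooth2_DERIV_snd[OF assms(1)])
  then have "((\<lambda>x. f (t, x)) has_real_derivative dx2 f (t + 2 * pi, x)) (at x)"
    using assms(2) by (simp add: periodic2_def)
  then show "dx2 f (t + 2 * pi, x) = dx2 f (t, x)"
    using smooth2_DERIV_snd[OF assms(1)] DERIV_unique by blast
  show "dx2 f (t, x + 2 * pi) = dx2 f (t, x)"
    using assms(2) by (intro periodic_deriv[OF smooth2_DERIV_snd[OF assms(1)]]) (simp add: periodic2_def)
qed

section \<open>Comparison of two solutions of a scalar equation\<close>

lemma linear_ode_solution:
  fixes d :: "real \<Rightarrow> real"
  assumes b: "continuous_on UNIV b" and d: "\<And>t. (d has_real_derivative b (t, x) * d t) (at t)"
  shows "d t = d 0 * exp (prim b (t, x))"
proof -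
  have "((\<lambda>t. d t * exp (- prim b (t, x))) has_real_derivative 0) (at t)" for t
    by (rule derivative_eq_intros d prim_DERIV_fst[OF b] refl)+ (simp add: algebra_simps)
  then have "d t * exp (- prim b (t, x)) = d 0 * exp (- prim b (0, x))"
    by (meson DERIV_isconst_all)
  then show ?thesis by (simp add: exp_minus field_simps)
qed

text \<open>Hadamard's quotient: the difference quotient of \<open>F\<close> in its second argument,
  written so that it stays continuous across z = y.\<close>

definition slope :: "(real \<times> real \<Rightarrow> real) \<Rightarrow> real \<Rightarrow> real \<Rightarrow> real \<Rightarrow> real" where
  "slope F t y z = integral {0..1} (\<lambda>\<theta>. dx2 F (t, y + \<theta> * (z - y)))"

lemma slope_same [simp]: "slope F t y y = dx2 F (t, y)"
  by (simp add: slope_def)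

lemma slope_eq:
  assumes "smooth2 F"
  shows "F (t, z) - F (t, y) = slope F t y z * (z - y)"
proof -
  have "((\<lambda>s. F (t, y + s)) has_real_derivative dx2 F (t, y + s)) (at s)" for s
    using smooth2_DERIV_snd[OF assms, of t "y + s" UNIV] DERIV_shift[of "\<lambda>x. F (t, x)" _ s y]
    by (simp add: add.commute)
  from rescaled_integral_eq[OF this, of "z - y"] show ?thesis
    by (simp add: slope_def mult.commute)
qed

lemma continuous_on_slope:
  fixes y z :: "real \<times> real \<Rightarrow> real"
  assumes F: "smooth2 F" and "continuous_on UNIV y" "continuous_on UNIV z"
  shows "continuous_on UNIV (\<lambda>p. slope F (fst p) (y p) (z p))"
proof -
  have *: "continuous_on S (\<lambda>p. y (f p))" "continuous_on S (\<lambda>p. z (f p))" if "continuous_on S f"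
    for S :: "((real \<times> real) \<times> real) set" and f
    using that by (auto intro: continuous_on_UNIV_compose[OF assms(2)] continuous_on_UNIV_compose[OF assms(3)])
  have "continuous_on UNIV (\<lambda>p. integral (cbox 0 1) (\<lambda>\<theta>. dx2 F (fst p, y p + \<theta> * (z p - y p))))"
    by (rule integral_continuous_on_param[where f="\<lambda>p \<theta>. dx2 F (fst p, y p + \<theta> * (z p - y p))"])
      (auto simp: split_beta intro!: continuous_on_UNIV_compose[OF smooth2_continuous[OF smooth2_dx2[OF F]]] continuous_intros *)
  then show ?thesis by (simp add: slope_def)
qed

text \<open>The difference of two solutions solves a linear equation with coefficient
  \<open>slope\<close>, so it is known exactly. With equal initial values this is uniqueness; with
  varying initial values it is the difference quotient of the flow.\<close>

lemma solution_difference: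
  assumes F: "smooth2 F"
    and y: "\<And>t. (y has_real_derivative F (t, y t)) (at t)"
    and z: "\<And>t. (z has_real_derivative F (t, z t)) (at t)"
  shows "z t - y t = (z 0 - y 0) * exp (prim (\<lambda>p. slope F (fst p) (y (fst p)) (z (fst p))) (t, x))"
proof (rule linear_ode_solution[where d="\<lambda>t. z t - y t"])
  have yz: "continuous_on UNIV y" "continuous_on UNIV z"
    using y z by (meson DERIV_isCont continuous_at_imp_continuous_on)+
  show "continuous_on UNIV (\<lambda>p :: real \<times> real. slope F (fst p) (y (fst p)) (z (fst p)))"
    by (intro continuous_on_slope F continuous_on_UNIV_compose[OF yz(1)] continuous_on_UNIV_compose[OF yz(2)] continuous_intros)
  show "((\<lambda>t. z t - y t) has_real_derivative
      slope F (fst (t, x)) (y (fst (t, x))) (z (fst (t, x))) * (z t - y t)) (at t)" for t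
    by (rule derivative_eq_intros y z)+ (simp add: slope_eq[OF F])
qed

lemma prim_cong: "(\<And>t. b (t, x) = c (t, x)) \<Longrightarrow> prim b (t, x) = prim c (t, x)"
  by (simp add: prim_def)

text \<open>Banach's theorem in a sup norm with weight exp (2 L |t|) (Bielecki's norm): one
  contraction produces the solution for all times of both signs and all starting points at once,
  jointly continuous. The unknown f in \<Phi> = z + w f ranges over the bounded continuous functions
  on the plane.\<close>

lemma picard_fixpoint:
  fixes F :: "real \<times> real \<Rightarrow> real"
  assumes c: "continuous_on UNIV F" and M: "\<And>p. \<bar>F p\<bar> \<le> M" and "L > 0"
    and L: "\<And>t x y. \<bar>F (t, x) - F (t, y)\<bar> \<le> L * \<bar>x - y\<bar>"
  obtains \<Phi> where "continuous_on UNIV \<Phi>" "\<And>p. \<Phi> p = snd p + prim (\<lambda>p. F (fst p, \<Phi> p)) p"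
proof -
  define w where "w p = exp (2 * L * \<bar>fst p\<bar>)" for p :: "real \<times> real"
  define G where "G f p = F (fst p, snd p + w p * f p)" for f :: "real \<times> real \<Rightarrow> real" and p
  define T where "T f p = prim (G f) p / w p" for f p
  have w: "w p > 0" "continuous_on S w" for p S
    by (auto simp: w_def[abs_def] intro!: continuous_intros)
  have Gc: "continuous_on UNIV (G f)" if "continuous_on UNIV f" for f
    unfolding G_def[abs_def] by (intro continuous_on_UNIV_compose[OF c] continuous_intros w that)
  have Gi: "(\<lambda>\<sigma>. G f (\<sigma> * t, x)) integrable_on {0..1}" if "continuous_on UNIV f" for f t x
    by (intro integrable_continuous_interval continuous_on_UNIV_compose[OF Gc] continuous_intros that)
  have prim_bd: "\<bar>prim b (t, x) - prim b' (t, x)\<bar> \<le> \<bar>t\<bar> * integral {0..1} (\<lambda>\<sigma>. h (\<sigma> * \<bar>t\<bar>))"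
    if "\<And>\<sigma>. 0 \<le> \<sigma> \<Longrightarrow> \<bar>b (\<sigma> * t, x) - b' (\<sigma> * t, x)\<bar> \<le> h (\<sigma> * \<bar>t\<bar>)"
      "continuous_on UNIV h" "(\<lambda>\<sigma>. b (\<sigma> * t, x)) integrable_on {0..1}" "(\<lambda>\<sigma>. b' (\<sigma> * t, x)) integrable_on {0..1}"
    for b b' and h :: "real \<Rightarrow> real" and t x
  proof -
    have "(\<lambda>\<sigma>. h (\<sigma> * \<bar>t\<bar>)) integrable_on {0..1}"
      by (intro integrable_continuous_interval continuous_on_UNIV_compose[OF that(2)] continuous_intros)
    then have "norm (integral {0..1} (\<lambda>\<sigma>. b (\<sigma> * t, x) - b' (\<sigma> * t, x))) \<le> integral {0..1} (\<lambda>\<sigma>. h (\<sigma> * \<bar>t\<bar>))"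
      using that by (intro integral_norm_bound_integral integrable_diff) auto
    then have "\<bar>t\<bar> * \<bar>integral {0..1} (\<lambda>\<sigma>. b (\<sigma> * t, x) - b' (\<sigma> * t, x))\<bar> \<le> \<bar>t\<bar> * integral {0..1} (\<lambda>\<sigma>. h (\<sigma> * \<bar>t\<bar>))"
      by (intro mult_left_mono) auto
    then show ?thesis
      using that(3,4) by (simp add: prim_def integral_diff abs_mult[symmetric] right_diff_distrib)
  qed
  have Tb: "T f \<in> bcontfun" if "continuous_on UNIV f" for f
  proof (rule bcontfun_normI[where b="M / (2 * L)"])
    show "continuous_on UNIV (T f)"
      unfolding T_def[abs_def] by (intro continuous_intros continuous_on_prim Gc that w ballI less_imp_neq[OF w(1), symmetric])
    fix p :: "real \<times> real"
    obtain t x where p: "p = (t, x)" by (cases p)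
    have M0: "M \<ge> 0" using M[of 0] by linarith
    have "\<bar>prim (G f) (t, x) - prim (\<lambda>_. 0) (t, x)\<bar> \<le> \<bar>t\<bar> * integral {0..1} (\<lambda>\<sigma>::real. M)"
      by (rule prim_bd) (use M Gi[OF that] in \<open>auto simp: G_def\<close>)
    then have "\<bar>prim (G f) p\<bar> \<le> \<bar>t\<bar> * M" by (simp add: prim_def p)
    also have "\<dots> \<le> M / (2 * L) * w p"
    proof -
      have "2 * L * \<bar>t\<bar> \<le> w p"
        using exp_ge_add_one_self[of "2 * L * \<bar>t\<bar>"] unfolding w_def p fst_conv by linarith
      then have "\<bar>t\<bar> \<le> w p / (2 * L)" using \<open>L > 0\<close> by (simp add: field_simps)
      from mult_right_mono[OF this M0] show ?thesis by (simp add: mult.commute)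
    qed
    finally show "norm (T f p) \<le> M / (2 * L)" using w(1)[of p] by (simp add: T_def field_simps)
  qed
  define TT :: "(real \<times> real, real) bcontfun \<Rightarrow> (real \<times> real, real) bcontfun"
    where "TT f = Bcontfun (T (apply_bcontfun f))" for f
  have TT: "apply_bcontfun (TT f) = T (apply_bcontfun f)" for f
    unfolding TT_def by (rule Bcontfun_inverse, rule Tb) simp
  have "dist (TT f) (TT g) \<le> 1/2 * dist f g" for f g
  proof (rule dist_bound)
    fix p :: "real \<times> real"
    obtain t x where p: "p = (t, x)" by (cases p)
    define D where "D = dist f g"
    have fg: "\<bar>apply_bcontfun f q - apply_bcontfun g q\<bar> \<le> D" for q
      using dist_bounded[of f q g] by (simp add: D_def dist_real_def)
    have "\<bar>prim (G f) (t, x) - prim (G g) (t, x)\<bar> \<le> \<bar>t\<bar> * integral {0..1} (\<lambda>\<sigma>. L * exp (2 * L * (\<sigma> * \<bar>t\<bar>)) * D)"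
    proof (rule prim_bd)
      fix \<sigma> :: real assume s: "0 \<le> \<sigma>"
      define q where "q = (\<sigma> * t, x)"
      have wq: "w q = exp (2 * L * (\<sigma> * \<bar>t\<bar>))" using s by (simp add: w_def q_def abs_mult)
      have "\<bar>G f q - G g q\<bar> \<le> L * \<bar>(snd q + w q * f q) - (snd q + w q * g q)\<bar>"
        unfolding G_def by (rule L)
      also have "\<dots> = L * w q * \<bar>f q - g q\<bar>"
        using w(1)[of q] by (simp add: right_diff_distrib[symmetric] abs_mult)
      also have "\<dots> \<le> L * w q * D" using w(1)[of q] \<open>L > 0\<close> fg by (intro mult_left_mono) auto
      finally show "\<bar>G f (\<sigma> * t, x) - G g (\<sigma> * t, x)\<bar> \<le> L * exp (2 * L * (\<sigma> * \<bar>t\<bar>)) * D"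
        by (simp add: wq flip: q_def)
    qed (auto intro!: continuous_intros Gi)
    \<comment> \<open>Integrating L exp (2 L s) yields exp (2 L s) / 2: the factor 2 in the weight
      produces the contraction constant 1/2.\<close>
    also have "\<dots> = D * exp (2 * L * \<bar>t\<bar>) / 2 - D / 2"
    proof -
      have "((\<lambda>s. D * exp (2 * L * s) / 2) has_real_derivative L * exp (2 * L * s) * D) (at s)" for s
        by (auto intro!: derivative_eq_intros)
      from rescaled_integral_eq[OF this, of "\<bar>t\<bar>"] show ?thesis by simp
    qed
    also have "\<dots> \<le> D / 2 * w p"
      using fg[of p] by (simp add: w_def p)
    finally show "dist (TT f p) (TT g p) \<le> 1/2 * dist f g"
      using w(1)[of p] by (simp add: TT T_def dist_real_def D_def p flip: diff_divide_distrib) (simp add: field_simps)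
  qed
  then obtain f where f: "TT f = f"
    using banach_fix_type[of "1/2" TT] by auto
  define \<Phi> where "\<Phi> p = snd p + w p * apply_bcontfun f p" for p
  have "\<Phi> p = snd p + prim (\<lambda>p. F (fst p, \<Phi> p)) p" for p
  proof -
    have "apply_bcontfun f p = prim (G f) p / w p" using TT[of f] unfolding f by (metis T_def)
    then show ?thesis using w(1)[of p] by (simp add: \<Phi>_def G_def[abs_def] field_simps)
  qed
  moreover have "continuous_on UNIV \<Phi>"
    unfolding \<Phi>_def[abs_def] by (intro continuous_intros w) auto
  ultimately show ?thesis using that by blast
qed

lemma flow_exists:
  assumes F: "smooth2 F" and per: "periodic2 F"
  obtains \<Phi> where "smooth2 \<Phi>" "\<And>z. \<Phi> (0, z) = z" "\<And>t z. \<Phi> (t, z + 2 * pi) = \<Phi> (t, z) + 2 * pi"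
    "dt2 \<Phi> = (\<lambda>p. F (fst p, \<Phi> p))" "dx2 \<Phi> = (\<lambda>p. exp (prim (\<lambda>p. dx2 F (fst p, \<Phi> p)) p))"
proof -
  note Fc = smooth2_continuous[OF F]
  have Fxc: "continuous_on UNIV (dx2 F)" by (intro smooth2_continuous smooth2_dx2 F)
  obtain M where M: "\<And>p. \<bar>F p\<bar> \<le> M" using periodic2_bounded[OF per Fc] by blast
  obtain L where L: "L > 0" "\<And>p. \<bar>dx2 F p\<bar> \<le> L" using periodic2_bounded[OF periodic2_dx2[OF F per] Fxc] by blast
  have lip: "\<bar>F (t, x) - F (t, y)\<bar> \<le> L * \<bar>x - y\<bar>" for t x y
    using field_differentiable_bound[of UNIV "\<lambda>x. F (t, x)" "\<lambda>x. dx2 F (t, x)" L x y] L smooth2_DERIV_snd[OF F]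
    by auto
  obtain \<Phi> where \<Phi>c: "continuous_on UNIV \<Phi>" and \<Phi>: "\<And>p. \<Phi> p = snd p + prim (\<lambda>p. F (fst p, \<Phi> p)) p"
    using picard_fixpoint[OF Fc M L(1) lip] by blast
  have F\<Phi>: "continuous_on UNIV (\<lambda>p. F (fst p, \<Phi> p))"
    by (intro continuous_on_UNIV_compose[OF Fc] continuous_intros \<Phi>c)
  have 0: "\<Phi> (0, z) = z" for z using \<Phi>[of "(0, z)"] by simp
  have t: "((\<lambda>t. \<Phi> (t, z)) has_real_derivative F (t, \<Phi> (t, z))) (at t)" for t z
    by (subst \<Phi>) (auto intro!: derivative_eq_intros prim_DERIV_fst[OF F\<Phi>, simplified])
  define J where "J p = exp (prim (\<lambda>p. dx2 F (fst p, \<Phi> p)) p)" for p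
  have Jc: "continuous_on UNIV J"
    unfolding J_def by (intro continuous_intros continuous_on_prim continuous_on_UNIV_compose[OF Fxc] \<Phi>c)
  have x: "((\<lambda>z. \<Phi> (t, z)) has_real_derivative J (t, z)) (at z)" for t z
  proof -
    define b where "b = (\<lambda>p. slope F (fst p) (\<Phi> (fst p, z)) (\<Phi> p))"
    have bc: "continuous_on UNIV b"
      unfolding b_def by (intro continuous_on_slope F \<Phi>c continuous_on_UNIV_compose[OF \<Phi>c] continuous_intros)
    \<comment> \<open>The difference quotient in z is an exponential known exactly, so
      differentiability reduces to continuity of its exponent at z' = z.\<close>
    have diff: "\<Phi> (t, z') - \<Phi> (t, z) = (z' - z) * exp (prim b (t, z'))" for z'
      using solution_difference[OF F t[where z=z] t[where z=z'], of t z']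
      by (simp add: 0 b_def prim_def)
    have "isCont (\<lambda>z'. exp (prim b (t, z'))) z"
      by (intro continuous_on_interior[of UNIV] continuous_intros continuous_on_UNIV_compose[OF continuous_on_prim[OF bc]]) auto
    then have "(\<lambda>z'. exp (prim b (t, z'))) \<midarrow>z\<rightarrow> exp (prim b (t, z))"
      by (simp add: isCont_def)
    then have "(\<lambda>z'. (\<Phi> (t, z') - \<Phi> (t, z)) / (z' - z)) \<midarrow>z\<rightarrow> exp (prim b (t, z))"
      by (rule Lim_transform_eventually) (auto simp: diff eventually_at_filter)
    moreover have "exp (prim b (t, z)) = J (t, z)"
      by (auto simp: J_def b_def intro!: prim_cong)
    ultimately show ?thesis by (simp add: has_field_derivative_iff)
  qed
  have hp: "has_partials \<Phi> (\<lambda>p. F (fst p, \<Phi> p)) J"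
    using t x Jc by (intro has_partialsI) auto
  \<comment> \<open>Bootstrap: both partials are built from \<open>F\<close> and its x-derivative
    along \<open>\<Phi>\<close>, without derivatives of \<open>\<Phi>\<close>, so every order of
    smoothness yields the next.\<close>
  have "Ck2 n \<Phi>" for n
  proof (induction n)
    case (Suc n)
    have "Ck2 n F" "Ck2 n (dx2 F)" using F smooth2_dx2[OF F] by (auto simp: smooth2_def)
    then show ?case
      unfolding J_def by (intro Ck2_SucI[OF hp]) (auto simp: J_def[abs_def] intro!: Ck2_compose Suc)
  qed (simp add: \<Phi>c)
  then have sm: "smooth2 \<Phi>" by (simp add: smooth2_def)
  have "\<Phi> (t, z + 2 * pi) = \<Phi> (t, z) + 2 * pi" for t z
  proof -
    \<comment> \<open>Because \<open>F\<close> is periodic, shifting this orbit back by a period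
      gives a solution with initial value z.\<close>
    have s: "((\<lambda>t. \<Phi> (t, z + 2 * pi) - 2 * pi) has_real_derivative F (t, \<Phi> (t, z + 2 * pi) - 2 * pi)) (at t)" for t
    proof -
      have "F (t, \<Phi> (t, z + 2 * pi) - 2 * pi) = F (t, \<Phi> (t, z + 2 * pi))"
        using per unfolding periodic2_def by (metis diff_add_cancel)
      then show ?thesis by (auto intro!: derivative_eq_intros t)
    qed
    from solution_difference[OF F t[where z=z] s, of t 0] show ?thesis by (simp add: 0)
  qed
  then show ?thesis
    using that[OF sm 0] has_partials_eq_dt2[OF hp] has_partials_eq_dx2[OF hp] by (simp add: J_def[abs_def])
qed

section \<open>Fourier series and oscillatory integrals\<close>

definition ei :: "int \<Rightarrow> real \<Rightarrow> complex" where
  "ei k x = exp (\<i> * of_int k * of_real x)"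

lemma ei_0 [simp]: "ei 0 x = 1"
  by (simp add: ei_def)

lemma norm_ei [simp]: "cmod (ei k x) = 1"
  using norm_exp_i_times[of "of_int k * x"] by (simp add: ei_def mult.assoc)

lemma ei_nonzero [simp]: "ei k x \<noteq> 0"
  by (simp add: ei_def)

lemma ei_add: "ei (k + l) x = ei k x * ei l x"
  by (simp add: ei_def algebra_simps flip: exp_add)

lemma ei_add_right: "ei k (x + y) = ei k x * ei k y"
  by (simp add: ei_def algebra_simps flip: exp_add)

lemma ei_2pi [simp]: "ei k (2 * pi) = 1"
proof -
  have "ei k (2 * pi) = exp (of_int k * (of_real (2 * pi) * \<i>))"
    by (simp add: ei_def mult_ac)
  also have "\<dots> = exp (of_real (2 * pi) * \<i>) powi k"
    using exp_power_int[of "of_real (2 * pi) * \<i>" k] by simp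
  finally show ?thesis by simp
qed

lemma ei_periodic [simp]: "ei k (x + 2 * pi) = ei k x"
  by (simp add: ei_add_right)

lemma cnj_ei: "cnj (ei k x) = ei (- k) x"
  by (simp add: ei_def exp_cnj)

lemma continuous_on_ei [continuous_intros]:
  "continuous_on S f \<Longrightarrow> continuous_on S (\<lambda>x. ei k (f x))"
  unfolding ei_def by (intro continuous_intros)

lemma ei_chain:
  assumes "(\<phi> has_real_derivative d) (at x within S)"
  shows "((\<lambda>x. ei k (\<phi> x)) has_vector_derivative of_real d * (\<i> * of_int k * ei k (\<phi> x))) (at x within S)"
proof -
  have "((\<lambda>x. complex_of_real (\<phi> x)) has_vector_derivative of_real d) (at x within S)"
    using assms by (auto intro!: derivative_eq_intros simp: has_real_derivative_iff_has_vector_derivative)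
  moreover have "((\<lambda>z. exp (\<i> * of_int k * z)) has_field_derivative \<i> * of_int k * exp (\<i> * of_int k * z)) (at z within T)" for z T
    by (auto intro!: derivative_eq_intros)
  ultimately have "((\<lambda>z. exp (\<i> * of_int k * z)) \<circ> (\<lambda>x. complex_of_real (\<phi> x)) has_vector_derivative
      of_real d * (\<i> * of_int k * exp (\<i> * of_int k * of_real (\<phi> x)))) (at x within S)"
    by (rule field_vector_diff_chain_within)
  then show ?thesis by (simp add: ei_def o_def)
qed

section \<open>Integrals over one period and the Riemann-Lebesgue lemma\<close>

lemma antiderivative_exists:
  fixes f :: "real \<Rightarrow> 'a::euclidean_space"
  assumes "continuous_on UNIV f"
  obtains F where "\<And>x. (F has_vector_derivative f x) (at x)"
proof -
  have "\<exists>F. \<forall>t. -\<infinity> < ereal t \<longrightarrow> ereal t < \<infinity> \<longrightarrow> (F has_vector_derivative f t) (at t)"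
    by (rule einterval_antiderivative) (auto intro!: continuous_on_interior[of UNIV] assms)
  then show ?thesis using that by auto
qed

text \<open>The antiderivative of a periodic function changes by the same amount over every interval
  of length 2 pi, so only the endpoints of \<open>\<phi>\<close> matter. Used for rotations and for
  the flow at a fixed time.\<close>

lemma period_substitution:
  fixes f :: "real \<Rightarrow> 'a::euclidean_space"
  assumes f: "continuous_on UNIV f" "\<And>x. f (x + 2 * pi) = f x"
    and \<phi>: "\<And>x. (\<phi> has_real_derivative \<phi>' x) (at x)" "\<phi> (2 * pi) = \<phi> 0 + 2 * pi"
  shows "integral {0..2 * pi} (\<lambda>x. \<phi>' x *\<^sub>R f (\<phi> x)) = integral {0..2 * pi} f"
proof -
  obtain F where F: "\<And>x. (F has_vector_derivative f x) (at x)"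
    using antiderivative_exists[OF f(1)] by blast
  have "((\<lambda>x. F (x + 2 * pi) - F x) has_vector_derivative 0) (at x)" for x
  proof -
    have "((\<lambda>x. F (x + 2 * pi)) has_vector_derivative f x) (at x)"
      using vector_diff_chain_at[of "\<lambda>x. x + 2 * pi" 1 x F "f (x + 2 * pi)", OF _ F]
      by (simp add: o_def f(2) has_vector_derivative_add_const)
    from has_vector_derivative_diff[OF this F[of x]] show ?thesis by simp
  qed
  then have "F (x + 2 * pi) - F x = F (y + 2 * pi) - F y" for x y
    by (intro has_derivative_zero_unique[of UNIV "\<lambda>x. F (x + 2 * pi) - F x"])
      (auto simp: has_vector_derivative_def)
  from this[of "\<phi> 0" 0] have *: "F (\<phi> (2 * pi)) - F (\<phi> 0) = F (2 * pi) - F 0" by (simp add: \<phi>(2))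
  have "((\<lambda>x. \<phi>' x *\<^sub>R f (\<phi> x)) has_integral F (\<phi> (2 * pi)) - F (\<phi> 0)) {0..2 * pi}"
  proof (rule fundamental_theorem_of_calculus)
    fix x
    have "(F \<circ> \<phi> has_vector_derivative \<phi>' x *\<^sub>R f (\<phi> x)) (at x)"
      using \<phi>(1) F by (intro vector_diff_chain_at) (auto simp: has_real_derivative_iff_has_vector_derivative)
    then show "((\<lambda>x. F (\<phi> x)) has_vector_derivative \<phi>' x *\<^sub>R f (\<phi> x)) (at x within {0..2 * pi})"
      by (simp add: o_def has_vector_derivative_at_within)
  qed simp
  moreover have "(f has_integral F (2 * pi) - F 0) {0..2 * pi}"
    by (rule fundamental_theorem_of_calculus) (auto intro: has_vector_derivative_at_within F)
  ultimately show ?thesis using * by (metis integral_unique)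
qed

lemma period_shift:
  fixes f :: "real \<Rightarrow> 'a::euclidean_space"
  assumes "continuous_on UNIV f" "\<And>x. f (x + 2 * pi) = f x"
  shows "integral {0..2 * pi} (\<lambda>x. f (x + c)) = integral {0..2 * pi} f"
proof -
  have "((\<lambda>x. x + c) has_real_derivative 1) (at x)" for x
    by (auto intro!: derivative_eq_intros)
  from period_substitution[OF assms this] show ?thesis by simp
qed

lemma integral_deriv_periodic:
  fixes h :: "real \<Rightarrow> 'a::banach"
  assumes "\<And>x. (h has_vector_derivative h' x) (at x)" "h (2 * pi) = h 0"
  shows "integral {0..2 * pi} h' = 0"
proof -
  have "(h' has_integral h (2 * pi) - h 0) {0..2 * pi}"
    by (rule fundamental_theorem_of_calculus) (auto intro: has_vector_derivative_at_within assms)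
  then show ?thesis using assms(2) by (simp add: integral_unique)
qed

lemma integral_ei: "integral {0..2 * pi} (ei k) = (if k = 0 then of_real (2 * pi) else 0)"
proof (cases "k = 0")
  case True
  then have "ei k = (\<lambda>x. 1)" by auto
  then show ?thesis using True by (simp add: scaleR_conv_of_real)
next
  case False
  have "integral {0..2 * pi} (\<lambda>x. \<i> * of_int k * ei k x) = 0"
    using ei_chain[of "\<lambda>x. x" 1] ei_periodic[of k 0] by (intro integral_deriv_periodic[of "ei k"]) auto
  then show ?thesis using False by simp
qed

lemma LINT_eq_integral:
  fixes f :: "real \<Rightarrow> complex"
  assumes "continuous_on UNIV f"
  shows "(LINT x:{a..b}|lborel. f x) = integral {a..b} f"
  by (intro set_borel_integral_eq_integral borel_integrable_atLeastAtMost' continuous_on_subset[OF assms]) auto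

text \<open>The pairing of the weak formulation: relative to \<open>fcoef\<close> the frequency
  changes sign and the factor 1 / (2 pi) is missing.\<close>

definition mode :: "(real \<Rightarrow> complex) \<Rightarrow> int \<Rightarrow> complex" where
  "mode u k = (LINT x:{0..2*pi}|lborel. u x * ei k x)"

lemma fcoef_eq_mode: "fcoef u k = mode u (- k) / (2 * pi)"
  by (simp add: fcoef_def mode_def ei_def)

lemma mode_eq_integral:
  "continuous_on UNIV u \<Longrightarrow> mode u k = integral {0..2*pi} (\<lambda>x. u x * ei k x)"
  unfolding mode_def by (intro LINT_eq_integral continuous_intros)

text \<open>Shifting by r = pi / |k| flips the sign of \<open>ei k\<close>, so twice the mode is the
  integral of g x - g (x + r) against \<open>ei k\<close>, which uniform continuity makes
  small.\<close>

lemma riemann_lebesgue: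
  assumes g: "continuous_on UNIV g" "\<And>x. g (x + 2 * pi) = g x" and "e > 0"
  obtains K where "\<And>k. \<bar>k\<bar> \<ge> K \<Longrightarrow> cmod (mode g k) < e"
proof -
  \<comment> \<open>The interval extends to 3 pi to leave room for the shift, which is at most
    pi.\<close>
  have "uniformly_continuous_on {0..3 * pi} g"
    by (intro compact_uniformly_continuous continuous_on_subset[OF g(1)]) auto
  then obtain d where d: "d > 0" "\<And>x y. x \<in> {0..3 * pi} \<Longrightarrow> y \<in> {0..3 * pi} \<Longrightarrow> dist y x < d \<Longrightarrow> dist (g y) (g x) < e / (2 * pi)"
    using \<open>e > 0\<close> unfolding uniformly_continuous_on_def by (metis divide_pos_pos pi_gt_zero zero_less_mult_iff zero_less_numeral)
  define K where "K = \<lceil>pi / d\<rceil> + 1"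
  have half: "cmod (mode g k) < e" if k: "\<bar>k\<bar> \<ge> K" for k
  proof -
    define r where "r = pi / \<bar>of_int k\<bar>"
    have "pi / d < \<bar>of_int k\<bar>" "\<bar>k\<bar> \<ge> 1"
      using k d(1) unfolding K_def
      by (linarith, smt (verit, best) divide_pos_pos zero_less_ceiling pi_gt_zero)
    then have r: "0 < r" "r < d" "r \<le> pi" and k0: "k \<noteq> 0"
      using d(1) by (auto simp: r_def field_simps)
    have ei_r: "ei k r = -1"
    proof (cases "k > 0")
      case True
      then have "ei k r = exp (of_real pi * \<i>)" by (simp add: ei_def r_def mult_ac)
      then show ?thesis by simp
    next
      case False
      then have "ei k r = cnj (exp (of_real pi * \<i>))"
        unfolding exp_cnj using k0 by (simp add: ei_def r_def mult_ac)
      then show ?thesis by simp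
    qed
    have i: "(\<lambda>x. g x * ei k x) integrable_on {0..2*pi}" "(\<lambda>x. g (x + r) * ei k x) integrable_on {0..2*pi}"
      by (intro integrable_continuous_interval continuous_intros continuous_on_subset[OF g(1)]
        continuous_on_UNIV_compose[OF g(1)]; simp)+
    have "mode g k = integral {0..2*pi} (\<lambda>x. g (x + r) * ei k (x + r))"
      unfolding mode_eq_integral[OF g(1)]
      by (rule period_shift[symmetric]) (auto simp: g(2) intro!: continuous_intros g)
    also have "\<dots> = - integral {0..2*pi} (\<lambda>x. g (x + r) * ei k x)"
      by (simp add: ei_add_right ei_r)
    finally have "2 * mode g k = integral {0..2*pi} (\<lambda>x. g x * ei k x) - integral {0..2*pi} (\<lambda>x. g (x + r) * ei k x)"
      using mode_eq_integral[OF g(1), of k] by simp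
    also have "\<dots> = integral {0..2*pi} (\<lambda>x. g x * ei k x - g (x + r) * ei k x)"
      using i by (simp add: integral_diff)
    finally have "2 * cmod (mode g k) = cmod (integral {0..2*pi} (\<lambda>x. g x * ei k x - g (x + r) * ei k x))"
      by (metis norm_mult norm_numeral)
    also have "\<dots> \<le> integral {0..2*pi} (\<lambda>x. e / (2 * pi))"
    proof (rule integral_norm_bound_integral)
      fix x assume x: "x \<in> {0..2*pi}"
      have "dist (g x) (g (x + r)) < e / (2 * pi)"
        using x r by (intro d(2)) (auto simp: dist_real_def)
      then show "cmod (g x * ei k x - g (x + r) * ei k x) \<le> e / (2 * pi)"
        by (simp add: left_diff_distrib[symmetric] norm_mult dist_norm)
    qed (use i in \<open>auto intro!: integrable_diff\<close>)
    also have "\<dots> = e" by simp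
    finally show ?thesis using \<open>e > 0\<close> by linarith
  qed
  then show ?thesis using that by blast
qed

section \<open>Pointwise convergence of Fourier series and rapid decay of oscillatory
  integrals\<close>

lemma ei_1_eq_iff: "ei 1 x = ei 1 y \<longleftrightarrow> (\<exists>n::int. x = y + 2 * pi * of_int n)"
proof -
  have "ei 1 x = ei 1 y \<longleftrightarrow> (\<exists>n::int. \<i> * of_real x = \<i> * of_real y + (of_int (2 * n) * of_real pi) * \<i>)"
    by (simp add: ei_def exp_eq)
  also have "\<dots> \<longleftrightarrow> (\<exists>n::int. x = y + 2 * pi * of_int n)"
    by (simp add: complex_eq_iff mult_ac)
  finally show ?thesis .
qed

lemma vector_derivative_quotient:
  fixes f :: "real \<Rightarrow> complex"
  assumes "(f has_vector_derivative D) (at a)"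
  shows "((\<lambda>x. (f x - f a) / of_real (x - a)) \<longlongrightarrow> D) (at a)"
proof -
  have "((\<lambda>x. Re (f x)) has_real_derivative Re D) (at a)" "((\<lambda>x. Im (f x)) has_real_derivative Im D) (at a)"
    using assms by (auto simp: has_vector_derivative_complex_iff)
  then show ?thesis
    by (simp add: tendsto_complex_iff has_field_derivative_iff Re_divide_of_real Im_divide_of_real del: of_real_diff)
qed

text \<open>Dividing \<open>f - f a\<close> by \<open>e\<^sup>i\<^sup>x - e\<^sup>i\<^sup>a\<close> leaves a continuous function, so that the
  symmetric partial sums of the Fourier series at \<open>a\<close> telescope and the Riemann--Lebesgue lemma
  applies to the two remaining terms.\<close>

lemma fourier_inversion:
  assumes f: "continuous_on UNIV f" "\<And>x. f (x + 2 * pi) = f x" and D: "(f has_vector_derivative D) (at a)"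
  shows "(\<lambda>N. \<Sum>k\<in>{- int N..int N}. fcoef f k * ei k a) \<longlonglongrightarrow> f a"
proof -
  \<comment> \<open>At the zeros of the denominator the value is the limit of the quotient at
    \<open>a\<close>: \<open>\<i> * ei 1 a\<close> is the derivative of the denominator
    there.\<close>
  define g where "g x = (if ei 1 x = ei 1 a then D / (\<i> * ei 1 a) else (f x - f a) / (ei 1 x - ei 1 a))" for x
  have gper: "g (x + 2 * pi) = g x" for x by (simp add: g_def f(2))
  have fg: "f x = f a + (ei 1 x - ei 1 a) * g x" for x
  proof (cases "ei 1 x = ei 1 a")
    case True
    then obtain n :: int where "x = a + 2 * pi * of_int n" by (auto simp: ei_1_eq_iff)
    then have "f x = f a" using periodic_int_shift[of f, OF f(2)] by simp
    then show ?thesis using True by simp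
  qed (simp add: g_def)
  have ga: "isCont g a"
  proof -
    have "((\<lambda>x. ((f x - f a) / of_real (x - a)) / ((ei 1 x - ei 1 a) / of_real (x - a))) \<longlongrightarrow> D / (\<i> * ei 1 a)) (at a)"
      by (intro tendsto_divide vector_derivative_quotient D) (use ei_chain[of "\<lambda>x. x" 1 a UNIV 1] in auto)
    then have "(g \<longlongrightarrow> D / (\<i> * ei 1 a)) (at a)"
    proof (rule Lim_transform_eventually)
      have "\<forall>\<^sub>F x in at a. x \<in> ball a (2 * pi) - {a}"
        by (intro eventually_at_in_open) auto
      then show "\<forall>\<^sub>F x in at a. ((f x - f a) / of_real (x - a)) / ((ei 1 x - ei 1 a) / of_real (x - a)) = g x"
      proof eventually_elim
        case (elim x)
        have "ei 1 x \<noteq> ei 1 a"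
        proof
          assume "ei 1 x = ei 1 a"
          then obtain n :: int where n: "x = a + 2 * pi * of_int n" by (auto simp: ei_1_eq_iff)
          then have "\<bar>of_int n :: real\<bar> < 1" using elim by (auto simp: dist_real_def abs_mult)
          then have "n = 0" by linarith
          then show False using n elim by simp
        qed
        then show ?case using elim by (simp add: g_def)
      qed
    qed
    then show ?thesis by (simp add: isCont_def g_def)
  qed
  have gc: "continuous_on UNIV g"
  proof (intro continuous_at_imp_continuous_on ballI)
    fix x
    show "isCont g x"
    proof (cases "ei 1 x = ei 1 a")
      case True
      then obtain n :: int where n: "x = a + 2 * pi * of_int n" by (auto simp: ei_1_eq_iff)
      have "isCont (\<lambda>y. g (y + 2 * pi * of_int (- n))) x"
        using ga n by (intro continuous_at_compose[of x "\<lambda>y. y + 2 * pi * of_int (- n)" g, unfolded o_def] continuous_intros) auto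
      then show ?thesis by (simp only: periodic_int_shift[of g, OF gper])
    next
      case False
      have o: "open {y. ei 1 y \<noteq> ei 1 a}"
        by (intro open_Collect_neq continuous_intros)
      have "continuous_on {y. ei 1 y \<noteq> ei 1 a} (\<lambda>x. (f x - f a) / (ei 1 x - ei 1 a))"
        by (intro continuous_intros continuous_on_subset[OF f(1)]) auto
      then have "continuous_on {y. ei 1 y \<noteq> ei 1 a} g"
        by (rule continuous_on_eq) (auto simp: g_def)
      then show ?thesis using False o continuous_on_eq_continuous_at by blast
    qed
  qed
  have i: "(\<lambda>x. g x * ei k x) integrable_on {0..2*pi}" "ei k integrable_on {0..2*pi}" for k
    by (intro integrable_continuous_interval continuous_intros continuous_on_subset[OF gc]; simp)
       (intro integrable_continuous_interval continuous_intros)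
  have mf: "mode f k = (if k = 0 then of_real (2 * pi) * f a else 0) + mode g (k + 1) - ei 1 a * mode g k" for k
  proof -
    have "mode f k = integral {0..2*pi} (\<lambda>x. f a * ei k x + (g x * ei (k + 1) x - ei 1 a * (g x * ei k x)))"
      unfolding mode_eq_integral[OF f(1)] by (subst fg) (simp add: ei_add algebra_simps)
    also have "\<dots> = f a * integral {0..2*pi} (ei k) + (mode g (k + 1) - ei 1 a * mode g k)"
      unfolding mode_eq_integral[OF gc]
      by (subst integral_add integral_diff; (intro integrable_diff integrable_on_mult_right i)?)+ simp
    finally show ?thesis by (simp add: integral_ei)
  qed
  \<comment> \<open>The index is reflected because \<open>fcoef\<close> and \<open>mode\<close> use
    opposite signs of the frequency; the factor \<open>ei k a\<close> absorbs \<open>ei 1 a\<close>,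
    so that consecutive terms cancel.\<close>
  define T where "T k = mode g (1 - k) * ei k a" for k
  have summand: "fcoef f k * ei k a = (if k = 0 then f a else 0) + (T k - T (k + 1)) / (2 * pi)" for k
    by (auto simp: fcoef_eq_mode mf T_def ei_add field_simps)
  have tele: "(\<Sum>k\<in>{- int N..int N}. T k - T (k + 1)) = T (- int N) - T (int N + 1)" for N
  proof (induction N)
    case (Suc N)
    have "{- int (Suc N)..int (Suc N)} = insert (- int (Suc N)) (insert (int (Suc N)) {- int N..int N})" by auto
    then show ?case using Suc by (simp add: algebra_simps)
  qed simp
  have sum: "(\<Sum>k\<in>{- int N..int N}. fcoef f k * ei k a) = f a + (T (- int N) - T (int N + 1)) / (2 * pi)" for N
    by (simp add: summand sum.distrib tele flip: sum_divide_distrib)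
  have RL: "(\<lambda>N. mode g (\<kappa> N)) \<longlonglongrightarrow> 0" if "\<And>N. \<bar>\<kappa> N\<bar> \<ge> int N" for \<kappa>
    unfolding lim_sequentially dist_norm
  proof safe
    fix r :: real assume "r > 0"
    then obtain K where K: "\<And>k. \<bar>k\<bar> \<ge> K \<Longrightarrow> cmod (mode g k) < r"
      using riemann_lebesgue[OF gc gper] by blast
    have "cmod (mode g (\<kappa> N)) < r" if "N \<ge> nat K" for N
      using \<open>\<And>N. \<bar>\<kappa> N\<bar> \<ge> int N\<close>[of N] that by (intro K) linarith
    then show "\<exists>no. \<forall>n\<ge>no. cmod (mode g (\<kappa> n) - 0) < r" by auto
  qed
  have lim: "(\<lambda>N. cmod (mode g (1 + int N)) + cmod (mode g (- int N))) \<longlonglongrightarrow> 0 + 0"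
    by (intro tendsto_add tendsto_norm_zero RL) auto
  have le: "cmod (T (- int N) - T (int N + 1)) \<le> cmod (mode g (1 + int N)) + cmod (mode g (- int N))" for N
    using norm_triangle_ineq4[of "T (- int N)" "T (int N + 1)"] by (simp add: T_def norm_mult)
  have "(\<lambda>N. T (- int N) - T (int N + 1)) \<longlonglongrightarrow> 0"
    by (rule Lim_null_comparison[OF always_eventually lim[simplified]]) (use le in blast)
  then have "(\<lambda>N. f a + (T (- int N) - T (int N + 1)) / (2 * pi)) \<longlonglongrightarrow> f a + 0 / (2 * pi)"
    by (intro tendsto_intros) auto
  then show ?thesis unfolding sum by simp
qed

text \<open>Integration by parts: \<open>w\<close> is the reciprocal of the z-derivative of \<Phi>,
  so \<open>ei k\<close> along \<Phi> is w / (i k) times its own z-derivative. Each step gains 1 /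
  |k| and replaces the amplitude \<open>b\<close> by the z-derivative of b w, again smooth and
  periodic; hence the induction over all \<open>b\<close>. Boundary terms cancel since \<Phi>
  advances by exactly one period.\<close>

lemma oscillatory_decay:
  assumes \<Phi>: "smooth2 \<Phi>" "\<And>t z. \<Phi> (t, z + 2 * pi) = \<Phi> (t, z) + 2 * pi"
    and w: "smooth2 w" "\<And>t z. w (t, z + 2 * pi) = w (t, z)" "\<And>p. w p * dx2 \<Phi> p = 1"
    and b: "smooth2 b" "\<And>t z. b (t, z + 2 * pi) = b (t, z)"
  shows "\<exists>C. \<forall>t\<in>{0..T}. \<forall>k. \<bar>real_of_int k\<bar> ^ N * cmod (integral {0..2*pi} (\<lambda>z. of_real (b (t, z)) * ei k (\<Phi> (t, z)))) \<le> C"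
  using b
proof (induction N arbitrary: b)
  case 0
  have "bounded (b ` ({0..T} \<times> {0..2*pi}))"
    by (intro compact_imp_bounded compact_continuous_image continuous_on_subset[OF smooth2_continuous[OF 0(1)]] compact_Times) auto
  then obtain B where B: "\<And>p. p \<in> {0..T} \<times> {0..2*pi} \<Longrightarrow> \<bar>b p\<bar> \<le> B"
    unfolding bounded_iff by (auto simp del: split_paired_All)
  have "cmod (integral {0..2*pi} (\<lambda>z. of_real (b (t, z)) * ei k (\<Phi> (t, z)))) \<le> B * (2 * pi - 0)" if "t \<in> {0..T}" for t k
    using that B
    by (intro integral_bound continuous_intros continuous_on_UNIV_compose[OF smooth2_continuous[OF 0(1)]]
        continuous_on_UNIV_compose[OF smooth2_continuous[OF \<Phi>(1)]]) (auto simp: norm_mult)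
  then show ?case by (intro exI[of _ "B * (2 * pi - 0)"]) auto
next
  case (Suc N)
  define c where "c p = b p * w p" for p
  have c: "smooth2 c" "\<And>t z. c (t, z + 2 * pi) = c (t, z)"
    unfolding c_def by (auto intro: smooth2_mult Suc.prems w simp: Suc.prems(2) w(2))
  have dc: "smooth2 (dx2 c)" "\<And>t z. dx2 c (t, z + 2 * pi) = dx2 c (t, z)"
    using smooth2_dx2[OF c(1)] periodic_deriv[OF smooth2_DERIV_snd[OF c(1)] c(2)] by auto
  obtain C where C: "\<And>t k. t \<in> {0..T} \<Longrightarrow> \<bar>real_of_int k\<bar> ^ N * cmod (integral {0..2*pi} (\<lambda>z. of_real (dx2 c (t, z)) * ei k (\<Phi> (t, z)))) \<le> C"
    using Suc.IH[OF dc] by blast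
  have "\<bar>real_of_int k\<bar> * cmod (integral {0..2*pi} (\<lambda>z. of_real (b (t, z)) * ei k (\<Phi> (t, z)))) =
     cmod (integral {0..2*pi} (\<lambda>z. of_real (dx2 c (t, z)) * ei k (\<Phi> (t, z))))" (is "_ * cmod ?I = cmod ?J") for t k
  proof -
    have h: "((\<lambda>z. of_real (c (t, z)) * ei k (\<Phi> (t, z))) has_vector_derivative
       (\<i> * of_int k * (of_real (b (t, z)) * ei k (\<Phi> (t, z))) + of_real (dx2 c (t, z)) * ei k (\<Phi> (t, z)))) (at z)" for z
    proof -
      have 1: "((\<lambda>z. complex_of_real (c (t, z))) has_vector_derivative of_real (dx2 c (t, z))) (at z)"
        using smooth2_DERIV_snd[OF c(1), of t z UNIV]
        by (auto intro!: derivative_eq_intros simp: has_real_derivative_iff_has_vector_derivative)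
      have e: "complex_of_real (c (t, z)) * of_real (dx2 \<Phi> (t, z)) = of_real (b (t, z))"
        using w(3)[of "(t, z)"] by (simp add: c_def mult.assoc flip: of_real_mult)
      show ?thesis
        using has_vector_derivative_mult[OF 1 ei_chain[OF smooth2_DERIV_snd[OF \<Phi>(1), of t z UNIV], of k]]
        by (rule has_vector_derivative_eq_rhs) (simp add: e[symmetric] algebra_simps)
    qed
    have ci: "(\<lambda>z. of_real (d (t, z)) * ei k (\<Phi> (t, z))) integrable_on {0..2*pi}" if "smooth2 d" for d
      by (intro integrable_continuous_interval continuous_intros continuous_on_UNIV_compose[OF smooth2_continuous[OF that]]
          continuous_on_UNIV_compose[OF smooth2_continuous[OF \<Phi>(1)]])
    have "integral {0..2*pi} (\<lambda>z. \<i> * of_int k * (of_real (b (t, z)) * ei k (\<Phi> (t, z))) + of_real (dx2 c (t, z)) * ei k (\<Phi> (t, z))) = 0"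
      using c(2)[of t 0] \<Phi>(2)[of t 0] by (intro integral_deriv_periodic[OF h]) simp
    then have "\<i> * of_int k * ?I + ?J = 0"
      using ci[OF Suc.prems(1)] ci[OF dc(1)] by (subst (asm) integral_add) (auto intro!: integrable_on_mult_right)
    then have "?J = - (\<i> * of_int k * ?I)" by (simp add: eq_neg_iff_add_eq_0 add.commute)
    then show ?thesis by (simp add: norm_mult)
  qed
  then have "\<bar>real_of_int k\<bar> ^ Suc N * cmod (integral {0..2*pi} (\<lambda>z. of_real (b (t, z)) * ei k (\<Phi> (t, z)))) \<le> C" if "t \<in> {0..T}" for t k
    using C[OF that, of k] unfolding power_Suc by (metis mult.assoc mult.left_commute)
  then show ?case by blast
qed

section \<open>Solutions along characteristics\<close>

lemma japan_ge_1: "japan k \<ge> 1"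
  by (simp add: japan_def)

lemma japan_ge_abs: "japan k \<ge> \<bar>real_of_int k\<bar>"
  unfolding japan_def by (rule real_le_rsqrt) simp

lemma japan_pos [simp]: "japan k > 0"
  using japan_ge_1[of k] by linarith

lemma japan_nonneg [simp]: "japan k \<ge> 0"
  by (simp add: less_imp_le)

lemma japan_nonzero [simp]: "japan k \<noteq> 0"
  using japan_pos[of k] by linarith

lemma japan_minus [simp]: "japan (- k) = japan k"
  by (simp add: japan_def)

lemma japan_le: "k \<noteq> 0 \<Longrightarrow> japan k \<le> 2 * \<bar>real_of_int k\<bar>"
proof -
  assume "k \<noteq> 0"
  then have "1 \<le> \<bar>real_of_int k\<bar>" by linarith
  then have "1 \<le> (real_of_int k)\<^sup>2" using power_mono[of 1 "\<bar>real_of_int k\<bar>" 2] by simp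
  then show ?thesis unfolding japan_def by (intro real_le_lsqrt) (auto simp: power_mult_distrib)
qed

lemma summable_on_int:
  fixes f :: "int \<Rightarrow> real"
  assumes "\<And>k. f k \<ge> 0" "summable (\<lambda>n. f (int n))" "summable (\<lambda>n. f (- int n))"
  shows "f summable_on UNIV"
proof -
  have 1: "f summable_on range int"
    by (subst summable_on_reindex) (use assms in \<open>auto simp: o_def intro!: norm_summable_imp_summable_on\<close>)
  have 2: "f summable_on range (\<lambda>n. - int n)"
    by (subst summable_on_reindex) (use assms in \<open>auto simp: o_def inj_on_def intro!: norm_summable_imp_summable_on\<close>)
  have "f summable_on (range (\<lambda>n. - int n) - range int)"
    by (rule summable_on_subset_banach[OF 2]) auto
  then have "f summable_on (range int \<union> (range (\<lambda>n. - int n) - range int))"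
    by (intro summable_on_Un_disjoint 1) auto
  moreover have "range int \<union> (range (\<lambda>n. - int n) - range int) = UNIV"
  proof -
    have "k \<in> range int \<or> k \<in> range (\<lambda>n. - int n)" for k
      by (cases k rule: int_cases2) auto
    then show ?thesis by blast
  qed
  ultimately show ?thesis by simp
qed

lemma summable_on_japan:
  assumes "p > 1"
  shows "(\<lambda>k. japan k powr (- p)) summable_on UNIV"
proof (rule summable_on_int)
  have "summable (\<lambda>n. japan (int n) powr (- p))"
  proof (rule summable_comparison_test_ev)
    show "summable (\<lambda>n. real n powr (- p))" using assms by (simp add: summable_real_powr_iff)
    show "\<forall>\<^sub>F n in sequentially. norm (japan (int n) powr (- p)) \<le> real n powr (- p)"
      using eventually_gt_at_top[of 0]
    proof eventually_elim
      case (elim n)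
      then show ?case using assms japan_ge_abs[of "int n"] by (auto intro!: powr_mono2')
    qed
  qed
  then show "summable (\<lambda>n. japan (int n) powr (- p))" "summable (\<lambda>n. japan (- int n) powr (- p))" by auto
qed auto

lemma summable_on_tail:
  fixes g :: "'a \<Rightarrow> real"
  assumes "g summable_on UNIV" "e > 0"
  obtains F where "finite F" "infsum g (- F) < e"
proof -
  have "(sum g \<longlongrightarrow> infsum g UNIV) (finite_subsets_at_top UNIV)"
    using assms(1) has_sum_def has_sum_infsum by blast
  from tendstoD[OF this assms(2)] have "\<forall>\<^sub>F F in finite_subsets_at_top UNIV. finite F \<and> dist (sum g F) (infsum g UNIV) < e"
    using eventually_finite_subsets_at_top_weakI[of UNIV finite] by (auto intro: eventually_conj)
  then obtain F where F: "finite F" "dist (sum g F) (infsum g UNIV) < e"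
    using eventually_happens'[OF finite_subsets_at_top_neq_bot] by blast
  have "infsum g (- F) = infsum g UNIV - infsum g F"
    unfolding Compl_eq_Diff_UNIV using F(1) by (intro infsum_Diff assms) auto
  then show ?thesis using that[OF F(1)] F by (auto simp: dist_real_def)
qed

text \<open>Tannery's theorem: off a finite set the tail of \<open>g\<close> bounds every sum, and
  on it the limit is taken termwise.\<close>

lemma infsum_dominated_tendsto_0:
  fixes f :: "'b \<Rightarrow> 'a \<Rightarrow> real"
  assumes g: "g summable_on UNIV" and b: "\<forall>\<^sub>F t in A. \<forall>k. 0 \<le> f t k \<and> f t k \<le> g k"
    and lim: "\<And>k. ((\<lambda>t. f t k) \<longlongrightarrow> 0) A"
  shows "((\<lambda>t. infsum (f t) UNIV) \<longlongrightarrow> 0) A"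
proof (rule tendstoI)
  fix e :: real assume "e > 0"
  then obtain F where F: "finite F" "infsum g (- F) < e / 2"
    using summable_on_tail[OF g, of "e / 2"] by auto
  have "((\<lambda>t. \<Sum>k\<in>F. f t k) \<longlongrightarrow> (\<Sum>k\<in>F. 0)) A" by (intro tendsto_sum lim)
  then have "\<forall>\<^sub>F t in A. dist (\<Sum>k\<in>F. f t k) (\<Sum>k\<in>F. 0) < e / 2"
    using \<open>e > 0\<close> by (intro tendstoD) auto
  with b show "\<forall>\<^sub>F t in A. dist (infsum (f t) UNIV) 0 < e"
  proof eventually_elim
    case (elim t)
    have ft: "f t summable_on UNIV"
      by (rule summable_on_comparison_test[OF g]) (use elim in auto)
    have gF: "g summable_on (- F)" "f t summable_on (- F)"
      by (auto intro: summable_on_subset_banach g ft)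
    have "infsum (f t) UNIV = infsum (f t) F + infsum (f t) (- F)"
      using infsum_Un_disjoint[of "f t" F "- F"] F(1) gF by auto
    also have "infsum (f t) (- F) \<le> infsum g (- F)"
      using elim by (intro infsum_mono gF) auto
    finally have "infsum (f t) UNIV < e" using elim F by (simp add: dist_real_def)
    moreover have "infsum (f t) UNIV \<ge> 0" using elim by (intro infsum_nonneg) auto
    ultimately show ?case by simp
  qed
qed

lemma mode_diff:
  assumes "set_integrable lborel {0..2*pi} u" "set_integrable lborel {0..2*pi} v"
  shows "mode (\<lambda>x. u x - v x) k = mode u k - mode v k"
proof -
  have *: "set_integrable lborel {0..2*pi} (\<lambda>x. w x * ei k x)" if w: "set_integrable lborel {0..2*pi} w" for w
  proof -
    have "integrable lborel (\<lambda>x. (indicator {0..2*pi} x *\<^sub>R w x) * ei k x)"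
    proof (rule Bochner_Integration.integrable_bound[OF w[unfolded set_integrable_def]])
      have "continuous_on UNIV (ei k)" by (intro continuous_intros)
      then have "ei k \<in> borel_measurable lborel" using borel_measurable_continuous_onI by simp
      then show "(\<lambda>x. (indicator {0..2*pi} x *\<^sub>R w x) * ei k x) \<in> borel_measurable lborel"
        using w[unfolded set_integrable_def] by measurable
    qed (simp add: norm_mult)
    then show ?thesis by (simp add: set_integrable_def)
  qed
  show ?thesis
    unfolding mode_def left_diff_distrib by (rule set_integral_diff[OF *[OF assms(1)] *[OF assms(2)]])
qed

lemma oscillatory_decay_japan:
  assumes \<Phi>: "smooth2 \<Phi>" "\<And>t z. \<Phi> (t, z + 2 * pi) = \<Phi> (t, z) + 2 * pi"
    and w: "smooth2 w" "\<And>t z. w (t, z + 2 * pi) = w (t, z)" "\<And>p. w p * dx2 \<Phi> p = 1"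
    and b: "smooth2 b" "\<And>t z. b (t, z + 2 * pi) = b (t, z)"
  obtains C where "C \<ge> 0"
    "\<And>t k. t \<in> {0..T} \<Longrightarrow> japan k ^ N * cmod (integral {0..2*pi} (\<lambda>z. of_real (b (t, z)) * ei k (\<Phi> (t, z)))) \<le> C"
proof -
  define M where "M t k = integral {0..2*pi} (\<lambda>z. of_real (b (t, z)) * ei k (\<Phi> (t, z)))" for t k
  have *: "\<exists>C. \<forall>t\<in>{0..T}. \<forall>k. \<bar>real_of_int k\<bar> ^ N * cmod (M t k) \<le> C" for N
    unfolding M_def by (rule oscillatory_decay[OF assms])
  obtain C where C: "\<And>t k. t \<in> {0..T} \<Longrightarrow> \<bar>real_of_int k\<bar> ^ N * cmod (M t k) \<le> C" using *[of N] by blast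
  \<comment> \<open>For N > 0 the factor |k|^N erases all information at k = 0, so that frequency is
    controlled by the bound of order zero.\<close>
  obtain C0 where C0: "\<And>t k. t \<in> {0..T} \<Longrightarrow> cmod (M t k) \<le> C0" using *[of 0] by fastforce
  have "japan k ^ N * cmod (M t k) \<le> max 0 (max C0 (2 ^ N * C))" if t: "t \<in> {0..T}" for t k
  proof (cases "k = 0")
    case True
    then show ?thesis using C0[OF t, of 0] by (simp add: japan_def)
  next
    case False
    then have "japan k ^ N \<le> (2 * \<bar>real_of_int k\<bar>) ^ N"
      using japan_ge_1[of k] by (intro power_mono japan_le) auto
    then have "japan k ^ N * cmod (M t k) \<le> 2 ^ N * (\<bar>real_of_int k\<bar> ^ N * cmod (M t k))"
      by (simp add: power_mult_distrib mult_right_mono flip: mult.assoc)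
    also have "\<dots> \<le> 2 ^ N * C" using C[OF t, of k] by simp
    finally show ?thesis by simp
  qed
  then show ?thesis using that[of "max 0 (max C0 (2 ^ N * C))"] by (simp add: M_def)
qed

section \<open>The flow of the characteristics and the growing solution\<close>

locale characteristics =
  fixes m :: nat and \<epsilon> :: real and V \<Phi> E :: "real \<times> real \<Rightarrow> real"
  assumes V: "smooth2 V" "periodic2 V"
    and \<Phi>: "smooth2 \<Phi>" "\<And>z. \<Phi> (0, z) = z" "\<And>t z. \<Phi> (t, z + 2 * pi) = \<Phi> (t, z) + 2 * pi"
    and \<Phi>t: "\<And>t z. ((\<lambda>t. \<Phi> (t, z)) has_real_derivative - (m + \<epsilon> * V (t, \<Phi> (t, z)))) (at t)"
    and \<Phi>x: "\<And>t z. ((\<lambda>z. \<Phi> (t, z)) has_real_derivative exp (- E (t, z))) (at z)"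
    and E: "smooth2 E" "\<And>z. E (0, z) = 0"
    and Et: "\<And>t z. ((\<lambda>t. E (t, z)) has_real_derivative \<epsilon> * dx2 V (t, \<Phi> (t, z))) (at t)"
begin

lemma E_periodic: "E (t, z + 2 * pi) = E (t, z)"
proof -
  have "exp (- E (t, z + 2 * pi)) = exp (- E (t, z))"
  proof (rule DERIV_unique)
    show "((\<lambda>z. \<Phi> (t, z)) has_real_derivative exp (- E (t, z))) (at z)" by (rule \<Phi>x)
    have "((\<lambda>z. \<Phi> (t, z + 2 * pi)) has_real_derivative exp (- E (t, z + 2 * pi))) (at z)"
      using \<Phi>x[of t "z + 2 * pi"] DERIV_shift[of "\<lambda>z. \<Phi> (t, z)" _ z "2 * pi"] by simp
    then have "((\<lambda>z. \<Phi> (t, z) + 2 * pi) has_real_derivative exp (- E (t, z + 2 * pi))) (at z)"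
      by (simp add: \<Phi>(3))
    from DERIV_diff[OF this DERIV_const[of "2 * pi"]]
    show "((\<lambda>z. \<Phi> (t, z)) has_real_derivative exp (- E (t, z + 2 * pi))) (at z)" by simp
  qed
  then show ?thesis by simp
qed

lemma \<Phi>_strict_mono: "y < z \<Longrightarrow> \<Phi> (t, y) < \<Phi> (t, z)"
  by (rule DERIV_pos_imp_increasing[of y z "\<lambda>z. \<Phi> (t, z)"]) (auto intro!: exI \<Phi>x)

lemma \<Phi>_inj: "\<Phi> (t, y) = \<Phi> (t, z) \<longleftrightarrow> y = z"
  using \<Phi>_strict_mono by (metis less_irrefl linorder_less_linear)

lemma \<Phi>_int_shift: "\<Phi> (t, z + 2 * pi * of_int n) = \<Phi> (t, z) + 2 * pi * of_int n"
  using periodic_int_shift[of "\<lambda>z. \<Phi> (t, z) - z" z n] by (simp add: \<Phi>(3))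

lemma \<Phi>_surj: "\<exists>z. \<Phi> (t, z) = x"
proof -
  define c where "c = \<Phi> (t, 0)"
  obtain n :: int where n: "(x - c) + 2 * pi * of_int n \<in> {0..2*pi}"
    using period_representative by blast
  have 0: "\<Phi> (t, 0 + 2 * pi * of_int k) = c + 2 * pi * of_int k" for k
    unfolding \<Phi>_int_shift c_def ..
  have "\<exists>z\<ge>0 + 2 * pi * of_int (- n). z \<le> 0 + 2 * pi * of_int (1 - n) \<and> \<Phi> (t, z) = x"
  proof (rule IVT)
    show "\<Phi> (t, 0 + 2 * pi * of_int (- n)) \<le> x" "x \<le> \<Phi> (t, 0 + 2 * pi * of_int (1 - n))"
      unfolding 0 using n by (auto simp: algebra_simps)
    show "0 + 2 * pi * of_int (- n) \<le> 0 + 2 * pi * of_int (1 - n)" by (simp add: algebra_simps)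
  qed (auto intro!: DERIV_isCont \<Phi>x)
  then show ?thesis by blast
qed

text \<open>The inverse flow turns the solution into a function of x. It is differentiated in x but
  never in t.\<close>

definition Z :: "real \<Rightarrow> real \<Rightarrow> real" where "Z t x = (THE z. \<Phi> (t, z) = x)"

lemma \<Phi>_Z [simp]: "\<Phi> (t, Z t x) = x"
proof -
  have "\<exists>!z. \<Phi> (t, z) = x" using \<Phi>_surj \<Phi>_inj by metis
  then show ?thesis unfolding Z_def by (rule theI')
qed

lemma Z_\<Phi> [simp]: "Z t (\<Phi> (t, z)) = z"
  using \<Phi>_inj \<Phi>_Z by blast

lemma Z_0 [simp]: "Z 0 x = x"
  using Z_\<Phi>[of 0 x] by (simp add: \<Phi>(2))

lemma Z_periodic: "Z t (x + 2 * pi) = Z t x + 2 * pi"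
  by (metis \<Phi>(3) \<Phi>_Z Z_\<Phi>)

lemma Z_DERIV: "(Z t has_real_derivative exp (E (t, Z t x))) (at x)"
proof -
  have "isCont (Z t) (\<Phi> (t, Z t x))"
    by (rule isCont_inverse_function[where d=1 and f="\<lambda>z. \<Phi> (t, z)"]) (auto intro!: DERIV_isCont \<Phi>x)
  then have c: "isCont (Z t) x" by simp
  have "(Z t has_real_derivative inverse (exp (- E (t, Z t x)))) (at x)"
    by (rule DERIV_inverse_function[where f="\<lambda>z. \<Phi> (t, z)" and a="x - 1" and b="x + 1"]) (auto intro!: \<Phi>x c)
  then show ?thesis by (simp add: exp_minus)
qed

definition u :: "real \<Rightarrow> real \<Rightarrow> complex" where
  "u t x = of_real (exp (E (t, Z t x) / 2))"

lemma u_0: "u 0 = (\<lambda>x. 1)"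
  by (simp add: u_def fun_eq_iff E(2))

lemma u_\<Phi>: "u t (\<Phi> (t, z)) = of_real (exp (E (t, z) / 2))"
  by (simp add: u_def)

lemma u_periodic: "u t (x + 2 * pi) = u t x"
  by (simp add: u_def Z_periodic E_periodic)

lemma u_differentiable: "\<exists>D. (u t has_vector_derivative D) (at x)"
proof -
  have "((\<lambda>x. exp (E (t, Z t x) / 2)) has_real_derivative
     exp (E (t, Z t x) / 2) * (dx2 E (t, Z t x) * exp (E (t, Z t x)) / 2)) (at x)"
    by (auto intro!: derivative_eq_intros DERIV_chain2[OF smooth2_DERIV_snd[OF E(1)] Z_DERIV])
  then show ?thesis
    unfolding u_def[abs_def] by (intro exI) (rule has_vector_derivative_of_real)
qed

lemma continuous_on_u: "continuous_on S (u t)"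
  using u_differentiable by (meson continuous_at_imp_continuous_on has_vector_derivative_continuous)

lemma integral_\<Phi>:
  fixes h :: "real \<Rightarrow> complex"
  assumes "continuous_on UNIV h" "\<And>x. h (x + 2 * pi) = h x"
  shows "integral {0..2*pi} h = integral {0..2*pi} (\<lambda>z. of_real (exp (- E (t, z))) * h (\<Phi> (t, z)))"
  using period_substitution[OF assms \<Phi>x[of t]] \<Phi>(3)[of t 0] by (simp add: scaleR_conv_of_real)

lemma exp_half: "exp (- r) * exp (r / 2) = exp (- r / 2 :: real)"
  by (simp flip: exp_add)

lemma mode_u: "mode (u t) k = integral {0..2*pi} (\<lambda>z. of_real (exp (- E (t, z) / 2)) * ei k (\<Phi> (t, z)))"
proof -
  have "mode (u t) k = integral {0..2*pi} (\<lambda>z. of_real (exp (- E (t, z))) * (u t (\<Phi> (t, z)) * ei k (\<Phi> (t, z))))"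
    unfolding mode_eq_integral[OF continuous_on_u]
    by (rule integral_\<Phi>) (auto intro!: continuous_intros continuous_on_u simp: u_periodic)
  also have "\<dots> = integral {0..2*pi} (\<lambda>z. of_real (exp (- E (t, z) / 2)) * ei k (\<Phi> (t, z)))"
    unfolding u_\<Phi> by (simp only: mult.assoc[symmetric] of_real_mult[symmetric] exp_half)
  finally show ?thesis .
qed

lemma mode_u_decay:
  obtains C where "C \<ge> 0" "\<And>t k. t \<in> {0..T} \<Longrightarrow> japan k ^ N * cmod (mode (u t) k) \<le> C"
proof -
  have w: "exp (E p) * dx2 \<Phi> p = 1" for p
  proof -
    have "dx2 \<Phi> (t, z) = exp (- E (t, z))" for t z
      using smooth2_DERIV_snd[OF \<Phi>(1)] \<Phi>x DERIV_unique by blast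
    then show ?thesis by (cases p) (simp flip: exp_add)
  qed
  have "smooth2 (\<lambda>p. exp ((- 1 / 2) * E p))" by (intro smooth2_intros E)
  then have b: "smooth2 (\<lambda>p. exp (- E p / 2))" by simp
  show ?thesis
    by (rule oscillatory_decay_japan[OF \<Phi>(1,3) _ _ w b, of T N])
      (auto intro!: smooth2_intros E that simp: E_periodic mode_u)
qed

text \<open>Taking N \<ge> s + 1 leaves two spare powers after squaring, hence a summable majorant
  uniform in t on bounded intervals. It serves both membership in H^s and continuity in
  time.\<close>

lemma coef_u_bound:
  obtains C where "\<And>t k. t \<in> {0..T} \<Longrightarrow> japan k powr (2 * s) * (cmod (fcoef (u t) k))\<^sup>2 \<le> C * japan k powr (- 2)"
proof -
  define N where "N = nat \<lceil>s + 1\<rceil>"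
  have N: "real N \<ge> s + 1" unfolding N_def by linarith
  obtain C where C: "C \<ge> 0" "\<And>t k. t \<in> {0..T} \<Longrightarrow> japan k ^ N * cmod (mode (u t) k) \<le> C" using mode_u_decay[where T=T and N=N] by blast
  have "japan k powr (2 * s) * (cmod (fcoef (u t) k))\<^sup>2 \<le> C\<^sup>2 * japan k powr (- 2)" if t: "t \<in> {0..T}" for t k
  proof -
    have le: "cmod (fcoef (u t) k) \<le> cmod (mode (u t) (- k))"
    proof -
      have "cmod (mode (u t) (- k)) / (2 * pi) \<le> cmod (mode (u t) (- k)) / 1"
        using pi_gt3 by (intro divide_left_mono) auto
      then show ?thesis by (simp add: fcoef_eq_mode norm_divide norm_mult)
    qed
    have "japan k powr (2 * s) \<le> japan k powr (2 * real N - 2)"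
      using japan_ge_1[of k] N by (intro powr_mono) auto
    also have "\<dots> = japan k powr real (N * 2) * japan k powr (- 2)"
      by (simp add: mult.commute flip: powr_add)
    also have "\<dots> = (japan k ^ N)\<^sup>2 * japan k powr (- 2)"
      by (simp only: powr_realpow[OF japan_pos] power_mult)
    finally have "japan k powr (2 * s) * (cmod (fcoef (u t) k))\<^sup>2 \<le> (japan k ^ N)\<^sup>2 * japan k powr (- 2) * (cmod (mode (u t) (- k)))\<^sup>2"
      using le by (intro mult_mono power_mono) auto
    also have "\<dots> = (japan k ^ N * cmod (mode (u t) (- k)))\<^sup>2 * japan k powr (- 2)"
      by (simp add: power_mult_distrib)
    also have "\<dots> \<le> C\<^sup>2 * japan k powr (- 2)"
      using C(2)[OF t, of "- k"] by (intro mult_right_mono power_mono) (auto simp: less_imp_le)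
    finally show ?thesis .
  qed
  then show ?thesis using that by blast
qed

lemma u_in_Hs:
  assumes "t \<ge> 0"
  shows "in_Hs s (u t)"
  unfolding in_Hs_def
proof (intro conjI)
  show "\<forall>x. u t (x + 2 * pi) = u t x" by (simp add: u_periodic)
  show "u t \<in> borel_measurable lborel"
    using borel_measurable_continuous_onI[OF continuous_on_u] by simp
  show "set_integrable lborel {0..2 * pi} (\<lambda>x. (cmod (u t x))\<^sup>2)"
    by (intro borel_integrable_atLeastAtMost' continuous_intros continuous_on_u)
  obtain C where C: "\<And>k. japan k powr (2 * s) * (cmod (fcoef (u t) k))\<^sup>2 \<le> C * japan k powr (- 2)"
    using coef_u_bound[where T=t and s=s] assms by (metis atLeastAtMost_iff order_refl)
  show "(\<lambda>k. japan k powr (2 * s) * (cmod (fcoef (u t) k))\<^sup>2) summable_on UNIV"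
    by (rule summable_on_comparison_test[OF summable_on_cmult_right[OF summable_on_japan[of 2]]]) (use C in auto)
qed

text \<open>In the coordinate z the integrand is smooth over a fixed interval, so one may
  differentiate under the integral. The phase contributes - a i k and the amplitude - \<epsilon> V_x
  / 2, the net effect of the terms - a_x and a_x / 2 in the weak formulation.\<close>

lemma mode_u_has_derivative:
  "((\<lambda>t. mode (u t) k) has_vector_derivative
     integral {0..2*pi} (\<lambda>x. u t x * (- of_real (m + \<epsilon> * V (t, x)) * (\<i> * of_int k * ei k x)
        - of_real (\<epsilon> / 2 * dx2 V (t, x)) * ei k x))) (at t within S)"
proof -
  note [continuous_intros] = continuous_on_UNIV_compose[OF smooth2_continuous[OF \<Phi>(1)]]
     continuous_on_UNIV_compose[OF smooth2_continuous[OF E(1)]]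
     continuous_on_UNIV_compose[OF smooth2_continuous[OF V(1)]]
     continuous_on_UNIV_compose[OF smooth2_continuous[OF smooth2_dx2[OF V(1)]]]
  define q where "q t z = of_real (exp (- E (t, z) / 2)) * ei k (\<Phi> (t, z))" for t z
  define h where "h t x = - of_real (m + \<epsilon> * V (t, x)) * (\<i> * of_int k * ei k x) - of_real (\<epsilon> / 2 * dx2 V (t, x)) * ei k x" for t x
  define q' where "q' t z = of_real (exp (- E (t, z) / 2)) * h t (\<Phi> (t, z))" for t z
  have 1: "((\<lambda>t. q t z) has_vector_derivative q' t z) (at t)" for t z
  proof -
    have "((\<lambda>t. exp (- E (t, z) / 2)) has_real_derivative exp (- E (t, z) / 2) * (- (\<epsilon> / 2 * dx2 V (t, \<Phi> (t, z))))) (at t)"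
      by (auto intro!: derivative_eq_intros Et)
    then have "((\<lambda>t. complex_of_real (exp (- E (t, z) / 2))) has_vector_derivative
         of_real (exp (- E (t, z) / 2) * (- (\<epsilon> / 2 * dx2 V (t, \<Phi> (t, z)))))) (at t)"
      by (rule has_vector_derivative_of_real)
    from has_vector_derivative_mult[OF this ei_chain[OF \<Phi>t, of k]] show ?thesis
      unfolding q_def by (rule has_vector_derivative_eq_rhs) (simp add: q'_def h_def algebra_simps)
  qed
  have "((\<lambda>t. integral (cbox 0 (2*pi)) (q t)) has_vector_derivative integral (cbox 0 (2*pi)) (q' t)) (at t within UNIV)"
  proof (rule leibniz_rule_vector_derivative)
    show "q t integrable_on cbox 0 (2 * pi)" for t
      unfolding q_def by (intro integrable_continuous continuous_intros) simp
    show "continuous_on (UNIV \<times> cbox 0 (2 * pi)) (\<lambda>(t, z). q' t z)"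
      unfolding q'_def h_def split_beta by (intro continuous_intros; simp)
  qed (auto intro: 1)
  moreover have "integral (cbox 0 (2*pi)) (q' t) = integral {0..2*pi} (\<lambda>x. u t x * h t x)"
  proof -
    have "integral {0..2*pi} (\<lambda>x. u t x * h t x) = integral {0..2*pi} (\<lambda>z. of_real (exp (- E (t, z))) * (u t (\<Phi> (t, z)) * h t (\<Phi> (t, z))))"
      using V(2) periodic2_dx2[OF V]
      by (intro integral_\<Phi>) (auto simp: u_periodic h_def periodic2_def intro!: continuous_intros continuous_on_u)
    also have "\<dots> = integral {0..2*pi} (q' t)"
      unfolding u_\<Phi> q'_def by (simp only: mult.assoc[symmetric] of_real_mult[symmetric] exp_half)
    finally show ?thesis by simp
  qed
  ultimately have "((\<lambda>t. mode (u t) k) has_vector_derivative integral {0..2*pi} (\<lambda>x. u t x * h t x)) (at t)"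
    unfolding mode_u q_def by simp
  then show ?thesis unfolding h_def by (rule has_vector_derivative_at_within)
qed

lemma deriv_V: "deriv (\<lambda>y. V (t, y)) x = dx2 V (t, x)"
  by (rule DERIV_imp_deriv) (rule smooth2_DERIV_snd[OF V(1)])

lemma fcoef_u_diff: "fcoef (\<lambda>x. u t x - u t' x) k = fcoef (u t) k - fcoef (u t') k"
  unfolding fcoef_eq_mode
  by (subst mode_diff) (auto intro!: borel_integrable_atLeastAtMost' continuous_on_u simp: diff_divide_distrib)

text \<open>Each coefficient is continuous because it is differentiable, and a common majorant,
  valid up to time t0 + 1 and so for all t near t0, permits the limit inside the series.\<close>

lemma u_continuous_in_Hs:
  assumes "t0 \<ge> 0"
  shows "((\<lambda>t. sob_norm s (\<lambda>x. u t x - u t0 x)) \<longlongrightarrow> 0) (at t0 within {0..})"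
proof -
  obtain C where C: "\<And>t k. t \<in> {0..t0 + 1} \<Longrightarrow> japan k powr (2 * s) * (cmod (fcoef (u t) k))\<^sup>2 \<le> C * japan k powr (- 2)"
    using coef_u_bound[where T="t0 + 1" and s=s] by blast
  have "((\<lambda>t. infsum (\<lambda>k. japan k powr (2 * s) * (cmod (fcoef (\<lambda>x. u t x - u t0 x) k))\<^sup>2) UNIV) \<longlongrightarrow> 0) (at t0 within {0..})"
  proof (rule infsum_dominated_tendsto_0)
    show "(\<lambda>k. 4 * C * japan k powr (- 2)) summable_on UNIV"
      by (intro summable_on_cmult_right summable_on_japan) simp
    have "\<forall>\<^sub>F t in at t0 within {0..}. t \<in> {0..} \<and> t \<in> ball t0 1"
      by (auto simp: eventually_at_filter intro!: eventually_mono[OF eventually_nhds_in_open[of "ball t0 1"]])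
    then show "\<forall>\<^sub>F t in at t0 within {0..}. \<forall>k. 0 \<le> japan k powr (2 * s) * (cmod (fcoef (\<lambda>x. u t x - u t0 x) k))\<^sup>2
       \<and> japan k powr (2 * s) * (cmod (fcoef (\<lambda>x. u t x - u t0 x) k))\<^sup>2 \<le> 4 * C * japan k powr (- 2)"
    proof eventually_elim
      case (elim t)
      then have t: "t \<in> {0..t0 + 1}" "t0 \<in> {0..t0 + 1}" using assms by (auto simp: dist_real_def)
      show ?case
      proof (intro allI conjI)
        fix k
        have "cmod (fcoef (u t) k - fcoef (u t0) k) \<le> cmod (fcoef (u t) k) + cmod (fcoef (u t0) k)"
          by (rule norm_triangle_ineq4)
        then have "(cmod (fcoef (u t) k - fcoef (u t0) k))\<^sup>2 \<le> (cmod (fcoef (u t) k) + cmod (fcoef (u t0) k))\<^sup>2"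
          by (intro power_mono) auto
        also have "\<dots> \<le> 2 * (cmod (fcoef (u t) k))\<^sup>2 + 2 * (cmod (fcoef (u t0) k))\<^sup>2"
          using sum_squares_bound[of "cmod (fcoef (u t) k)" "cmod (fcoef (u t0) k)"] by (simp add: power2_sum)
        finally have "japan k powr (2 * s) * (cmod (fcoef (\<lambda>x. u t x - u t0 x) k))\<^sup>2 \<le>
            japan k powr (2 * s) * (2 * (cmod (fcoef (u t) k))\<^sup>2 + 2 * (cmod (fcoef (u t0) k))\<^sup>2)"
          unfolding fcoef_u_diff by (intro mult_left_mono) auto
        also have "\<dots> \<le> 4 * C * japan k powr (- 2)"
          using C[OF t(1), of k] C[OF t(2), of k] by (simp add: algebra_simps)
        finally show "japan k powr (2 * s) * (cmod (fcoef (\<lambda>x. u t x - u t0 x) k))\<^sup>2 \<le> 4 * C * japan k powr (- 2)" .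
      qed auto
    qed
    fix k
    have "((\<lambda>t. mode (u t) (- k)) \<longlongrightarrow> mode (u t0) (- k)) (at t0 within {0..})"
      using has_vector_derivative_continuous[OF mode_u_has_derivative] by (simp add: continuous_within)
    then have "((\<lambda>t. japan k powr (2 * s) * (cmod (fcoef (u t) k - fcoef (u t0) k))\<^sup>2) \<longlongrightarrow>
        japan k powr (2 * s) * (cmod (fcoef (u t0) k - fcoef (u t0) k))\<^sup>2) (at t0 within {0..})"
      unfolding fcoef_eq_mode by (intro tendsto_intros) auto
    then show "((\<lambda>t. japan k powr (2 * s) * (cmod (fcoef (\<lambda>x. u t x - u t0 x) k))\<^sup>2) \<longlongrightarrow> 0) (at t0 within {0..})"
      unfolding fcoef_u_diff by simp
  qed
  from tendsto_real_sqrt[OF this] show ?thesis by (simp add: sob_norm_def)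
qed

lemma u_is_solution: "is_solution m \<epsilon> V s (\<lambda>x. 1) u"
  unfolding is_solution_def
proof (intro conjI allI impI)
  fix k :: int and t :: real
  have c: "continuous_on UNIV (\<lambda>x. u t x * (- of_real (m + \<epsilon> * V (t, x)) * (\<i> * of_int k * ei k x)
        - of_real (\<epsilon> / 2 * dx2 V (t, x)) * ei k x))"
    by (intro continuous_intros continuous_on_u continuous_on_UNIV_compose[OF smooth2_continuous[OF V(1)]]
      continuous_on_UNIV_compose[OF smooth2_continuous[OF smooth2_dx2[OF V(1)]]])
  have "(LINT x:{0..2*pi}|lborel. u t x *
              ( - complex_of_real (real m + \<epsilon> * V (t, x)) * (\<i> * of_int k * exp (\<i> * of_int k * of_real x))
                - complex_of_real (\<epsilon> * deriv (\<lambda>y. V (t, y)) x) * exp (\<i> * of_int k * of_real x)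
                + complex_of_real (\<epsilon> / 2 * deriv (\<lambda>y. V (t, y)) x) * exp (\<i> * of_int k * of_real x)))
     = integral {0..2*pi} (\<lambda>x. u t x * (- of_real (m + \<epsilon> * V (t, x)) * (\<i> * of_int k * ei k x)
        - of_real (\<epsilon> / 2 * dx2 V (t, x)) * ei k x))"
    unfolding deriv_V LINT_eq_integral[OF c, symmetric]
    by (simp add: ei_def algebra_simps)
  then show "((\<lambda>\<tau>. LINT x:{0..2*pi}|lborel. u \<tau> x * exp (\<i> * of_int k * of_real x))
          has_vector_derivative
          (LINT x:{0..2*pi}|lborel. u t x *
              ( - complex_of_real (real m + \<epsilon> * V (t, x)) * (\<i> * of_int k * exp (\<i> * of_int k * of_real x))
                - complex_of_real (\<epsilon> * deriv (\<lambda>y. V (t, y)) x) * exp (\<i> * of_int k * of_real x)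
                + complex_of_real (\<epsilon> / 2 * deriv (\<lambda>y. V (t, y)) x) * exp (\<i> * of_int k * of_real x))))
        (at t within {0..})"
    using mode_u_has_derivative[where k=k and t=t and S="{0..}"] by (simp add: mode_def ei_def)
qed (auto simp: u_0 u_in_Hs u_continuous_in_Hs)

end

lemma characteristics_exist:
  assumes V: "smooth2 V" "periodic2 V"
  obtains \<Phi> E where "characteristics m \<epsilon> V \<Phi> E"
proof -
  define F where "F p = (- real m) + (- \<epsilon>) * V p" for p
  have F: "smooth2 F" "periodic2 F"
    unfolding F_def[abs_def] using V(2) by (intro smooth2_intros V, simp add: periodic2_def)
  have dF: "dx2 F = (\<lambda>p. - \<epsilon> * dx2 V p)"
    by (rule dx2_eqI[OF F(1)]) (auto simp: F_def intro!: derivative_eq_intros smooth2_DERIV_snd[OF V(1)])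
  obtain \<Phi> where \<Phi>: "smooth2 \<Phi>" "\<And>z. \<Phi> (0, z) = z" "\<And>t z. \<Phi> (t, z + 2 * pi) = \<Phi> (t, z) + 2 * pi"
    "dt2 \<Phi> = (\<lambda>p. F (fst p, \<Phi> p))" "dx2 \<Phi> = (\<lambda>p. exp (prim (\<lambda>p. dx2 F (fst p, \<Phi> p)) p))"
    using flow_exists[OF F] by blast
  define b where "b p = \<epsilon> * dx2 V (fst p, \<Phi> p)" for p
  have b: "smooth2 b"
    unfolding b_def[abs_def] by (intro smooth2_mult smooth2_const smooth2_compose[OF smooth2_dx2] smooth2_fst V \<Phi>)
  have "prim (\<lambda>p. dx2 F (fst p, \<Phi> p)) p = - prim b p" for p
    by (simp add: prim_def b_def dF)
  then have dx: "dx2 \<Phi> = (\<lambda>p. exp (- prim b p))" using \<Phi>(5) by simp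
  have "characteristics m \<epsilon> V \<Phi> (prim b)"
  proof
    show "((\<lambda>t. \<Phi> (t, z)) has_real_derivative - (m + \<epsilon> * V (t, \<Phi> (t, z)))) (at t)" for t z
      using smooth2_DERIV_fst[OF \<Phi>(1), of z t UNIV] by (simp add: \<Phi>(4) F_def)
    show "((\<lambda>z. \<Phi> (t, z)) has_real_derivative exp (- prim b (t, z))) (at z)" for t z
      using smooth2_DERIV_snd[OF \<Phi>(1), of t z UNIV] by (simp add: dx)
    show "((\<lambda>t. prim b (t, z)) has_real_derivative \<epsilon> * dx2 V (t, \<Phi> (t, z))) (at t)" for t z
      using prim_DERIV_fst[OF smooth2_continuous[OF b], of z t] by (simp add: b_def)
  qed (auto intro: V \<Phi> smooth2_prim b)
  then show ?thesis using that by blast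
qed

section \<open>The equation in Fourier space\<close>

lemma japan_peetre: "japan a \<le> 2 * japan b * japan (a - b)"
proof -
  define x y where "x = real_of_int b" and "y = real_of_int (a - b)"
  have a: "real_of_int a = x + y" by (simp add: x_def y_def)
  have "(x + y)\<^sup>2 \<le> 2 * x\<^sup>2 + 2 * y\<^sup>2"
    using sum_squares_bound[of x y] by (simp add: power2_sum)
  then have "1 + (x + y)\<^sup>2 \<le> 4 * ((1 + x\<^sup>2) * (1 + y\<^sup>2))"
    by (simp add: algebra_simps) (smt (verit) zero_le_power2 mult_nonneg_nonneg)
  then have "sqrt (1 + (x + y)\<^sup>2) \<le> sqrt (4 * ((1 + x\<^sup>2) * (1 + y\<^sup>2)))" by (rule real_sqrt_le_mono)
  then show ?thesis by (simp add: japan_def a real_sqrt_mult flip: x_def y_def)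
qed

text \<open>The symbol (k + j) / 2 of a first-order operator is shared between the two indices, half
  a derivative each. The price, one power of \<open>japan (j - k)\<close>, is paid later by the
  decay of the Fourier coefficients.\<close>

lemma half_sum_le_japan:
  "\<bar>real_of_int k + real_of_int j\<bar> / 2 \<le> 2 * sqrt (japan k) * sqrt (japan j) * japan (j - k)"
proof -
  have *: "\<bar>real_of_int a\<bar> \<le> 2 * sqrt (japan a) * sqrt (japan b) * japan (a - b)" for a b
  proof -
    have "japan a * japan a \<le> japan a * (2 * japan b * japan (a - b))"
      by (intro mult_left_mono japan_peetre) (simp add: less_imp_le)
    also have "\<dots> \<le> 4 * (japan a * japan b * (japan (a - b))\<^sup>2)"
    proof -
      have "2 * japan (a - b) \<le> 4 * (japan (a - b))\<^sup>2"
        using self_le_power[OF japan_ge_1[of "a - b"], of 2] japan_ge_1[of "a - b"] by simp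
      from mult_left_mono[OF this, of "japan a * japan b"] show ?thesis
        by (simp add: less_imp_le mult_ac)
    qed
    also have "\<dots> = (2 * sqrt (japan a) * sqrt (japan b) * japan (a - b))\<^sup>2"
      by (simp add: power_mult_distrib less_imp_le)
    finally have "(japan a)\<^sup>2 \<le> (2 * sqrt (japan a) * sqrt (japan b) * japan (a - b))\<^sup>2"
      by (simp add: power2_eq_square)
    then have "japan a \<le> 2 * sqrt (japan a) * sqrt (japan b) * japan (a - b)"
      by (rule power2_le_imp_le) (simp add: less_imp_le)
    then show ?thesis using japan_ge_abs[of a] by linarith
  qed
  have "japan (k - j) = japan (j - k)" using japan_minus[of "j - k"] by simp
  then show ?thesis using *[of k j] *[of j k] by (simp add: mult_ac)
qed

text \<open>Instantiated with A = m + \<epsilon> V for the equation, and with the averaged potential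
  to get the decay of its Fourier coefficients.\<close>

locale real_symbol =
  fixes A :: "real \<times> real \<Rightarrow> real"
  assumes A: "smooth2 A" "periodic2 A"
begin

definition \<alpha> :: "real \<Rightarrow> int \<Rightarrow> complex" where
  "\<alpha> t l = fcoef (\<lambda>x. of_real (A (t, x))) l"

lemma continuous_on_A [continuous_intros]:
  "continuous_on S f \<Longrightarrow> continuous_on S (\<lambda>x. A (f x))"
  "continuous_on S f \<Longrightarrow> continuous_on S (\<lambda>x. dx2 A (f x))"
  using continuous_on_UNIV_compose[OF smooth2_continuous[OF A(1)]]
    continuous_on_UNIV_compose[OF smooth2_continuous[OF smooth2_dx2[OF A(1)]]] by auto

lemma cnj_\<alpha>: "cnj (\<alpha> t l) = \<alpha> t (- l)"
proof -
  have c: "continuous_on UNIV (\<lambda>x. complex_of_real (A (t, x)))" by (intro continuous_intros)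
  have "cnj (mode (\<lambda>x. complex_of_real (A (t, x))) k) = mode (\<lambda>x. complex_of_real (A (t, x))) (- k)" for k
    unfolding mode_eq_integral[OF c] integral_cnj by (simp add: cnj_ei)
  then show ?thesis by (simp add: \<alpha>_def fcoef_eq_mode)
qed

text \<open>Ordinary Fourier coefficients are oscillatory integrals for the trivial flow
  \<open>snd\<close>, so the integration by parts above applies with w = 1.\<close>

lemma \<alpha>_decay:
  obtains C where "C \<ge> 0" "\<And>t l. t \<in> {0..T} \<Longrightarrow> japan l ^ N * cmod (\<alpha> t l) \<le> C"
proof -
  have dsnd: "dx2 snd = (\<lambda>_. 1)"
    by (rule dx2_eqI) (auto intro: smooth2_intros)
  obtain C where C: "C \<ge> 0" "\<And>t k. t \<in> {0..T} \<Longrightarrow> japan k ^ N * cmod (integral {0..2*pi} (\<lambda>z. of_real (A (t, z)) * ei k (snd (t, z)))) \<le> C"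
    by (rule oscillatory_decay_japan[of snd "\<lambda>_. 1" A T N])
      (use A in \<open>auto simp: dsnd periodic2_def intro: smooth2_intros\<close>)
  have c: "continuous_on UNIV (\<lambda>x. complex_of_real (A (t, x)))" for t by (intro continuous_intros)
  have "japan l ^ N * cmod (\<alpha> t l) \<le> C" if "t \<in> {0..T}" for t l
  proof -
    have "japan l ^ N * cmod (\<alpha> t l) = japan (- l) ^ N * cmod (mode (\<lambda>x. of_real (A (t, x))) (- l)) / (2 * pi)"
      by (simp add: \<alpha>_def fcoef_eq_mode norm_divide norm_mult)
    also have "\<dots> \<le> C / (2 * pi)"
      using C(2)[OF that, of "- l"] unfolding mode_eq_integral[OF c] by (intro divide_right_mono) auto
    also have "\<dots> \<le> C / 1" using C(1) pi_gt3 by (intro divide_left_mono) auto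
    finally show ?thesis by simp
  qed
  then show ?thesis using that C(1) by blast
qed

lemma fcoef_dx2: "fcoef (\<lambda>x. of_real (dx2 A (t, x))) l = \<i> * of_int l * \<alpha> t l"
proof -
  have c: "continuous_on UNIV (\<lambda>x. complex_of_real (A (t, x)))" "continuous_on UNIV (\<lambda>x. complex_of_real (dx2 A (t, x)))"
    by (intro continuous_intros)+
  have h: "((\<lambda>x. of_real (A (t, x)) * ei k x) has_vector_derivative
      (\<i> * of_int k * (of_real (A (t, x)) * ei k x) + of_real (dx2 A (t, x)) * ei k x)) (at x)" for k x
    using has_vector_derivative_mult[OF has_vector_derivative_of_real[OF smooth2_DERIV_snd[OF A(1), of t x UNIV]]
        ei_chain[of "\<lambda>x. x" 1 x UNIV k]]
    by (auto intro!: has_vector_derivative_eq_rhs simp: algebra_simps)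
  have "integral {0..2*pi} (\<lambda>x. \<i> * of_int k * (of_real (A (t, x)) * ei k x) + of_real (dx2 A (t, x)) * ei k x) = 0" for k
    using A(2) ei_periodic[of k 0] unfolding periodic2_def
    by (intro integral_deriv_periodic[OF h]) (metis add_0)
  moreover have "integral {0..2*pi} (\<lambda>x. \<i> * of_int k * (of_real (A (t, x)) * ei k x) + of_real (dx2 A (t, x)) * ei k x)
      = \<i> * of_int k * mode (\<lambda>x. of_real (A (t, x))) k + mode (\<lambda>x. of_real (dx2 A (t, x))) k" for k
    unfolding mode_eq_integral[OF c(1)] mode_eq_integral[OF c(2)]
    by (subst integral_add) (auto intro!: integrable_continuous_interval continuous_intros)
  ultimately have "mode (\<lambda>x. of_real (dx2 A (t, x))) k = - \<i> * of_int k * mode (\<lambda>x. of_real (A (t, x))) k" for k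
    by (simp add: add_eq_0_iff)
  then show ?thesis by (simp add: \<alpha>_def fcoef_eq_mode)
qed

text \<open>The adjoint of \<open>A \<partial>\<^sub>x + A\<^sub>x / 2\<close> applied to \<open>e\<^sup>i\<^sup>k\<^sup>x\<close>.\<close>

definition h :: "real \<Rightarrow> int \<Rightarrow> real \<Rightarrow> complex" where
  "h t k x = - of_real (A (t, x)) * (\<i> * of_int k * ei k x) - of_real (dx2 A (t, x)) / 2 * ei k x"

text \<open>The coefficient of \<open>ei j\<close> in \<open>h t k\<close>: with l = j - k, the
  first term contributes the factor - i k and the second - i l / 2, together - i (k + j) / 2. In
  this symmetric form the matrix is visibly skew-Hermitian, \<open>A\<close> being real.\<close>

definition B :: "real \<Rightarrow> int \<Rightarrow> int \<Rightarrow> complex" where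
  "B t k j = - \<i> * of_real ((of_int k + of_int j) / 2) * \<alpha> t (j - k)"

lemma cnj_B: "cnj (B t j k) = - B t k j"
  unfolding B_def complex_cnj_mult cnj_\<alpha> complex_cnj_complex_of_real by (simp add: add.commute)

lemma B_bound:
  obtains C where "C \<ge> 0" "\<And>t k j. t \<in> {0..T} \<Longrightarrow> cmod (B t k j) \<le> C * (sqrt (japan k) * sqrt (japan j))"
proof -
  obtain C where C: "C \<ge> 0" "\<And>t l. t \<in> {0..T} \<Longrightarrow> japan l ^ 1 * cmod (\<alpha> t l) \<le> C"
    using \<alpha>_decay[where T=T and N=1] by blast
  have "cmod (B t k j) \<le> (2 * C) * (sqrt (japan k) * sqrt (japan j))" if "t \<in> {0..T}" for t k j
  proof -
    have "cmod (B t k j) = \<bar>real_of_int k + real_of_int j\<bar> / 2 * cmod (\<alpha> t (j - k))"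
      by (simp add: B_def norm_mult norm_divide flip: of_real_add of_int_add)
    also have "\<dots> \<le> (2 * sqrt (japan k) * sqrt (japan j) * japan (j - k)) * cmod (\<alpha> t (j - k))"
      by (intro mult_right_mono half_sum_le_japan) auto
    also have "\<dots> = 2 * sqrt (japan k) * sqrt (japan j) * (japan (j - k) ^ 1 * cmod (\<alpha> t (j - k)))" by simp
    also have "\<dots> \<le> 2 * sqrt (japan k) * sqrt (japan j) * C"
      using C(2)[OF that] by (intro mult_left_mono) (auto simp: less_imp_le)
    finally show ?thesis by (simp add: mult_ac)
  qed
  then show ?thesis using that[of "2 * C"] C(1) by auto
qed

lemma h_expansion:
  "(\<lambda>N. \<Sum>l\<in>{- int N..int N}. B t k (k + l) * ei (k + l) x) \<longlonglongrightarrow> h t k x"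
proof -
  have dA: "smooth2 (dx2 A)" "periodic2 (dx2 A)" using smooth2_dx2 periodic2_dx2 A by auto
  have "(\<lambda>N. \<Sum>l\<in>{- int N..int N}. \<alpha> t l * ei l x) \<longlonglongrightarrow> of_real (A (t, x))"
    unfolding \<alpha>_def
    by (rule fourier_inversion[OF _ _ has_vector_derivative_of_real[OF smooth2_DERIV_snd[OF A(1)]]])
      (use A(2) in \<open>auto simp: periodic2_def intro!: continuous_intros\<close>)
  moreover have "(\<lambda>N. \<Sum>l\<in>{- int N..int N}. (\<i> * of_int l * \<alpha> t l) * ei l x) \<longlonglongrightarrow> of_real (dx2 A (t, x))"
    unfolding fcoef_dx2[symmetric]
    by (rule fourier_inversion[OF _ _ has_vector_derivative_of_real[OF smooth2_DERIV_snd[OF dA(1)]]])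
      (use dA(2) in \<open>auto simp: periodic2_def intro!: continuous_intros\<close>)
  ultimately have "(\<lambda>N. - (\<Sum>l\<in>{- int N..int N}. \<alpha> t l * ei l x) * (\<i> * of_int k * ei k x)
     - (\<Sum>l\<in>{- int N..int N}. (\<i> * of_int l * \<alpha> t l) * ei l x) / 2 * ei k x) \<longlonglongrightarrow> h t k x"
    unfolding h_def by (intro tendsto_intros) auto
  moreover have "- (\<Sum>l\<in>S. \<alpha> t l * ei l x) * (\<i> * of_int k * ei k x)
     - (\<Sum>l\<in>S. (\<i> * of_int l * \<alpha> t l) * ei l x) / 2 * ei k x = (\<Sum>l\<in>S. B t k (k + l) * ei (k + l) x)" for S
    unfolding sum_distrib_right sum_divide_distrib sum_negf[symmetric] sum_subtractf[symmetric]
    by (rule sum.cong) (auto simp: B_def ei_add field_simps)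
  ultimately show ?thesis by simp
qed

text \<open>Absolute convergence of a row bounds the partial sums of the series for
  \<open>h t k\<close> uniformly in x. Decay of order 3 pays one power for the growth of the symbol
  and two for summability.\<close>

lemma B_row_bound:
  assumes "t \<ge> 0"
  obtains K where "\<And>S. finite S \<Longrightarrow> (\<Sum>l\<in>S. cmod (B t k (k + l))) \<le> K"
proof -
  obtain C where C: "C \<ge> 0" "\<And>l. japan l ^ 3 * cmod (\<alpha> t l) \<le> C"
    using \<alpha>_decay[where T=t and N=3] assms by (metis atLeastAtMost_iff order_refl)
  have le: "cmod (B t k (k + l)) \<le> (\<bar>real_of_int k\<bar> + 1) * C * japan l powr (- 2)" for l
  proof -
    have "cmod (B t k (k + l)) = \<bar>real_of_int k + real_of_int (k + l)\<bar> / 2 * cmod (\<alpha> t l)"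
      by (simp add: B_def norm_mult norm_divide flip: of_real_add of_int_add)
    also have "\<dots> \<le> ((\<bar>real_of_int k\<bar> + 1) * japan l) * cmod (\<alpha> t l)"
    proof (rule mult_right_mono)
      have "\<bar>real_of_int k\<bar> * 1 \<le> \<bar>real_of_int k\<bar> * japan l"
        using japan_ge_1[of l] by (intro mult_left_mono) auto
      then show "\<bar>real_of_int k + real_of_int (k + l)\<bar> / 2 \<le> (\<bar>real_of_int k\<bar> + 1) * japan l"
        using japan_ge_abs[of l] by (simp add: algebra_simps)
    qed auto
    also have "\<dots> = (\<bar>real_of_int k\<bar> + 1) * (japan l ^ 3 * cmod (\<alpha> t l)) * japan l powr (- 2)"
      by (simp add: powr_minus_divide power3_eq_cube powr_numeral power2_eq_square)
    also have "\<dots> \<le> (\<bar>real_of_int k\<bar> + 1) * C * japan l powr (- 2)"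
      using C(2)[of l] by (intro mult_right_mono mult_left_mono) auto
    finally show ?thesis .
  qed
  have "(\<Sum>l\<in>S. cmod (B t k (k + l))) \<le> infsum (\<lambda>l. (\<bar>real_of_int k\<bar> + 1) * C * japan l powr (- 2)) UNIV" if "finite S" for S
  proof -
    have "(\<Sum>l\<in>S. cmod (B t k (k + l))) \<le> (\<Sum>l\<in>S. (\<bar>real_of_int k\<bar> + 1) * C * japan l powr (- 2))"
      by (intro sum_mono le)
    also have "\<dots> \<le> infsum (\<lambda>l. (\<bar>real_of_int k\<bar> + 1) * C * japan l powr (- 2)) UNIV"
      using that C(1) by (intro finite_sum_le_infsum summable_on_cmult_right summable_on_japan) auto
    finally show ?thesis .
  qed
  then show ?thesis using that by blast
qed

text \<open>Since \<open>w\<close> is merely integrable, the argument rests on the smooth test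
  function: its series converges boundedly, and dominated convergence lets it be paired term by
  term.\<close>

lemma pairing_expansion:
  assumes w: "set_integrable lborel {0..2*pi} w" and t: "t \<ge> 0"
  shows "(\<lambda>N. \<Sum>l\<in>{- int N..int N}. B t k (k + l) * mode w (k + l)) \<longlonglongrightarrow> (LINT x:{0..2*pi}|lborel. w x * h t k x)"
proof -
  obtain K where K: "\<And>S. finite S \<Longrightarrow> (\<Sum>l\<in>S. cmod (B t k (k + l))) \<le> K" using B_row_bound[OF t] by blast
  define W where "W x = indicator {0..2*pi} x *\<^sub>R w x" for x
  have W: "integrable lborel W" using w by (simp add: W_def[abs_def] set_integrable_def)
  have eim: "ei j \<in> borel_measurable lborel" for j
  proof -
    have "continuous_on UNIV (ei j)" by (intro continuous_intros)
    then show ?thesis using borel_measurable_continuous_onI by simp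
  qed
  have hm: "h t k \<in> borel_measurable lborel"
  proof -
    have "continuous_on UNIV (h t k)" unfolding h_def[abs_def] by (intro continuous_intros) auto
    then show ?thesis using borel_measurable_continuous_onI by simp
  qed
  have Wei: "integrable lborel (\<lambda>x. W x * ei j x)" for j
    by (rule Bochner_Integration.integrable_bound[OF W]) (use W eim[of j] in \<open>auto simp: norm_mult\<close>)
  have mode: "mode w j = (LINT x|lborel. W x * ei j x)" for j
    unfolding mode_def set_lebesgue_integral_def W_def by simp
  have "(\<lambda>N. LINT x|lborel. W x * (\<Sum>l\<in>{- int N..int N}. B t k (k + l) * ei (k + l) x)) \<longlonglongrightarrow> (LINT x|lborel. W x * h t k x)"
  proof (rule integral_dominated_convergence)
    show "(\<lambda>x. W x * h t k x) \<in> borel_measurable lborel" using W hm by measurable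
    show "(\<lambda>x. W x * (\<Sum>l\<in>{- int N..int N}. B t k (k + l) * ei (k + l) x)) \<in> borel_measurable lborel" for N
      using W eim by measurable
    show "integrable lborel (\<lambda>x. norm (W x) * K)" using W by auto
    show "AE x in lborel. (\<lambda>N. W x * (\<Sum>l\<in>{- int N..int N}. B t k (k + l) * ei (k + l) x)) \<longlonglongrightarrow> W x * h t k x"
      by (intro AE_I2 tendsto_intros h_expansion)
    show "AE x in lborel. norm (W x * (\<Sum>l\<in>{- int N..int N}. B t k (k + l) * ei (k + l) x)) \<le> norm (W x) * K" for N
    proof (intro AE_I2)
      fix x
      have "norm (\<Sum>l\<in>{- int N..int N}. B t k (k + l) * ei (k + l) x) \<le> (\<Sum>l\<in>{- int N..int N}. cmod (B t k (k + l)))"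
        by (rule order_trans[OF norm_sum]) (simp add: norm_mult)
      also have "\<dots> \<le> K" by (intro K) simp
      finally show "norm (W x * (\<Sum>l\<in>{- int N..int N}. B t k (k + l) * ei (k + l) x)) \<le> norm (W x) * K"
        unfolding norm_mult by (intro mult_left_mono) auto
    qed
  qed
  moreover have "(LINT x|lborel. W x * (\<Sum>l\<in>{- int N..int N}. B t k (k + l) * ei (k + l) x)) = (\<Sum>l\<in>{- int N..int N}. B t k (k + l) * mode w (k + l))" for N
  proof -
    have "(LINT x|lborel. W x * (\<Sum>l\<in>{- int N..int N}. B t k (k + l) * ei (k + l) x)) = (LINT x|lborel. (\<Sum>l\<in>{- int N..int N}. B t k (k + l) * (W x * ei (k + l) x)))"
      by (simp add: sum_distrib_left mult_ac)
    also have "\<dots> = (\<Sum>l\<in>{- int N..int N}. LINT x|lborel. B t k (k + l) * (W x * ei (k + l) x))"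
      using Wei by (intro Bochner_Integration.integral_sum) auto
    finally show ?thesis unfolding mode by simp
  qed
  moreover have "(LINT x|lborel. W x * h t k x) = (LINT x:{0..2*pi}|lborel. w x * h t k x)"
    unfolding set_lebesgue_integral_def W_def by simp
  ultimately show ?thesis by simp
qed

text \<open>The matrix \<open>B\<close> is skew-Hermitian, so only interactions between frequencies inside and
  outside of the truncation window contribute to the truncated energy.\<close>

lemma truncated_energy_bound:
  assumes lim: "\<And>k. (\<lambda>N. \<Sum>l\<in>{- int N..int N}. B t k (k + l) * U (k + l)) \<longlonglongrightarrow> D k"
    and C: "\<And>k j. cmod (B t k j) \<le> C * (sqrt (japan k) * sqrt (japan j))" "C \<ge> 0"
    and P: "\<And>S. finite S \<Longrightarrow> (\<Sum>k\<in>S. sqrt (japan k) * cmod (U k)) \<le> P"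
    and \<tau>: "\<And>S. finite S \<Longrightarrow> S \<inter> {- int n..int n} = {} \<Longrightarrow> (\<Sum>k\<in>S. sqrt (japan k) * cmod (U k)) \<le> \<tau>" "\<tau> \<ge> 0"
  shows "\<bar>\<Sum>k\<in>{- int n..int n}. Re (cnj (U k) * D k)\<bar> \<le> C * P * \<tau>"
proof -
  define I where "I = {- int n..int n}"
  define q where "q k j = cnj (U k) * B t k j * U j" for k j
  have skew: "(\<Sum>k\<in>I. \<Sum>j\<in>I. Re (q k j)) = 0"
  proof -
    have sk: "Re (q k j) = - Re (q j k)" for j k
    proof -
      have "cnj (q j k) = - q k j" by (simp add: q_def cnj_B)
      then have "Re (cnj (q j k)) = Re (- q k j)" by (rule arg_cong)
      then show ?thesis by simp
    qed
    have "(\<Sum>k\<in>I. \<Sum>j\<in>I. Re (q k j)) = - (\<Sum>k\<in>I. \<Sum>j\<in>I. Re (q j k))"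
      unfolding sum_negf[symmetric] by (intro sum.cong refl sk)
    also have "(\<Sum>k\<in>I. \<Sum>j\<in>I. Re (q j k)) = (\<Sum>k\<in>I. \<Sum>j\<in>I. Re (q k j))" by (rule sum.swap)
    finally show ?thesis by linarith
  qed
  \<comment> \<open>From N = 2 n on, the window of radius N around any frequency of \<open>I\<close>
    contains \<open>I\<close>. The windows are centred at k because the row is summed over l = j -
    k.\<close>
  have ev: "\<bar>\<Sum>k\<in>I. Re (cnj (U k) * (\<Sum>l\<in>{- int N..int N}. B t k (k + l) * U (k + l)))\<bar> \<le> C * P * \<tau>" if N: "N \<ge> 2 * n" for N
  proof -
    define J where "J k = {k - int N..k + int N}" for k
    have J: "I \<subseteq> J k" "finite (J k)" if "k \<in> I" for k using that N by (auto simp: I_def J_def)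
    have row: "(\<Sum>l\<in>{- int N..int N}. B t k (k + l) * U (k + l)) = (\<Sum>j\<in>J k. B t k j * U j)" for k
      unfolding J_def by (rule sum.reindex_bij_witness[of _ "\<lambda>j. j - k" "\<lambda>l. k + l"]) auto
    have "(\<Sum>k\<in>I. Re (cnj (U k) * (\<Sum>j\<in>J k. B t k j * U j))) = (\<Sum>k\<in>I. \<Sum>j\<in>J k. Re (q k j))"
      by (simp add: sum_distrib_left q_def mult.assoc)
    also have "\<dots> = (\<Sum>k\<in>I. (\<Sum>j\<in>J k - I. Re (q k j)) + (\<Sum>j\<in>I. Re (q k j)))"
      using J by (intro sum.cong refl sum.subset_diff) auto
    also have "\<dots> = (\<Sum>k\<in>I. \<Sum>j\<in>J k - I. Re (q k j))" by (simp add: sum.distrib skew)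
    also have "\<bar>\<dots>\<bar> \<le> (\<Sum>k\<in>I. C * (sqrt (japan k) * cmod (U k)) * \<tau>)"
    proof (rule order_trans[OF sum_abs], rule sum_mono)
      fix k assume "k \<in> I"
      have "\<bar>\<Sum>j\<in>J k - I. Re (q k j)\<bar> \<le> (\<Sum>j\<in>J k - I. C * (sqrt (japan k) * cmod (U k)) * (sqrt (japan j) * cmod (U j)))"
      proof (rule order_trans[OF sum_abs], rule sum_mono)
        fix j
        have "\<bar>Re (q k j)\<bar> \<le> cmod (U k) * cmod (B t k j) * cmod (U j)"
          using abs_Re_le_cmod[of "q k j"] by (simp add: q_def norm_mult)
        also have "\<dots> \<le> cmod (U k) * (C * (sqrt (japan k) * sqrt (japan j))) * cmod (U j)"
          by (intro mult_right_mono mult_left_mono C) auto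
        finally show "\<bar>Re (q k j)\<bar> \<le> C * (sqrt (japan k) * cmod (U k)) * (sqrt (japan j) * cmod (U j))"
          by (simp add: mult_ac)
      qed
      also have "\<dots> = C * (sqrt (japan k) * cmod (U k)) * (\<Sum>j\<in>J k - I. sqrt (japan j) * cmod (U j))"
        by (simp add: sum_distrib_left)
      also have "\<dots> \<le> C * (sqrt (japan k) * cmod (U k)) * \<tau>"
        using \<open>k \<in> I\<close> J C(2) by (intro mult_left_mono \<tau>(1)) (auto simp: I_def less_imp_le)
      finally show "\<bar>\<Sum>j\<in>J k - I. Re (q k j)\<bar> \<le> C * (sqrt (japan k) * cmod (U k)) * \<tau>" .
    qed
    also have "\<dots> = C * (\<Sum>k\<in>I. sqrt (japan k) * cmod (U k)) * \<tau>"
      by (simp add: sum_distrib_left sum_distrib_right)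
    also have "\<dots> \<le> C * P * \<tau>"
      using C(2) \<tau>(2) by (intro mult_right_mono mult_left_mono P) (auto simp: I_def)
    finally show ?thesis by (simp add: row)
  qed
  have "(\<lambda>N. \<bar>\<Sum>k\<in>I. Re (cnj (U k) * (\<Sum>l\<in>{- int N..int N}. B t k (k + l) * U (k + l)))\<bar>) \<longlonglongrightarrow> \<bar>\<Sum>k\<in>I. Re (cnj (U k) * D k)\<bar>"
    by (intro tendsto_intros lim)
  then show ?thesis
    unfolding I_def by (rule LIMSEQ_le_const2) (use ev in \<open>auto simp: I_def\<close>)
qed

end

section \<open>Uniqueness of weak solutions\<close>

lemma in_Hs_set_integrable:
  assumes "in_Hs s u"
  shows "set_integrable lborel {0..2*pi} u"
proof -
  have u: "u \<in> borel_measurable lborel" "set_integrable lborel {0..2*pi} (\<lambda>x. (cmod (u x))\<^sup>2)"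
    using assms by (auto simp: in_Hs_def)
  have "set_integrable lborel {0..2*pi} (\<lambda>x. 1 + (cmod (u x))\<^sup>2)"
    by (rule set_integral_add(1)[OF _ u(2)]) (rule borel_integrable_atLeastAtMost', intro continuous_intros)
  then show ?thesis
    unfolding set_integrable_def
  proof (rule Bochner_Integration.integrable_bound)
    show "(\<lambda>x. indicat_real {0..2 * pi} x *\<^sub>R u x) \<in> borel_measurable lborel" using u(1) by measurable
    show "AE x in lborel. norm (indicat_real {0..2 * pi} x *\<^sub>R u x) \<le> norm (indicat_real {0..2 * pi} x *\<^sub>R (1 + (cmod (u x))\<^sup>2))"
    proof (intro AE_I2)
      fix x
      have "2 * cmod (u x) * 1 \<le> (cmod (u x))\<^sup>2 + 1\<^sup>2" by (rule sum_squares_bound)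
      then have "cmod (u x) \<le> 1 + (cmod (u x))\<^sup>2" using norm_ge_zero[of "u x"] by (simp del: norm_ge_zero)
      then show "norm (indicat_real {0..2 * pi} x *\<^sub>R u x) \<le> norm (indicat_real {0..2 * pi} x *\<^sub>R (1 + (cmod (u x))\<^sup>2))"
        by (simp add: indicator_def)
    qed
  qed
qed

lemma locally_bounded_imp_bounded:
  fixes f :: "'a::topological_space \<Rightarrow> real"
  assumes "compact S" and loc: "\<And>x. x \<in> S \<Longrightarrow> \<exists>M. \<forall>\<^sub>F y in at x within S. f y \<le> M"
  shows "\<exists>M. \<forall>x\<in>S. f x \<le> M"
proof -
  have "\<exists>M U. open U \<and> x \<in> U \<and> (\<forall>y\<in>U \<inter> S. f y \<le> M)" if x: "x \<in> S" for x
  proof -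
    obtain M U where "open U" "x \<in> U" "\<forall>y\<in>U. y \<noteq> x \<longrightarrow> y \<in> S \<longrightarrow> f y \<le> M"
      using loc[OF x] unfolding eventually_at_topological by auto
    \<comment> \<open>The filter ignores the point x itself, hence the maximum with
      \<open>f x\<close>.\<close>
    then show ?thesis by (intro exI[of _ "max M (f x)"] exI[of _ U]) fastforce
  qed
  then obtain M U where MU: "\<And>x. x \<in> S \<Longrightarrow> open (U x) \<and> x \<in> U x \<and> (\<forall>y\<in>U x \<inter> S. f y \<le> M x)"
    by metis
  obtain D where D: "D \<subseteq> S" "finite D" "S \<subseteq> (\<Union>x\<in>D. U x)"
    using compactE_image[OF \<open>compact S\<close>, of S U] MU by (metis UN_I subsetI)
  have "f x \<le> Max (M ` D)" if x: "x \<in> S" for x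
  proof -
    obtain d where d: "d \<in> D" "x \<in> U d" using D(3) x by auto
    then have "f x \<le> M d" using MU[of d] D(1) x by auto
    also have "\<dots> \<le> Max (M ` D)" using d D(2) by simp
    finally show ?thesis .
  qed
  then show ?thesis by blast
qed

section \<open>Sobolev bounds and the energy argument\<close>

lemma mode_eq_fcoef: "mode u k = 2 * pi * fcoef u (- k)"
  by (simp add: fcoef_eq_mode)

lemma cmod_sum_square_le:
  "(cmod (a + b))\<^sup>2 \<le> 2 * (cmod a)\<^sup>2 + 2 * (cmod b)\<^sup>2"
proof -
  have "(cmod (a + b))\<^sup>2 \<le> (cmod a + cmod b)\<^sup>2" by (intro power_mono norm_triangle_ineq) simp
  also have "\<dots> \<le> 2 * (cmod a)\<^sup>2 + 2 * (cmod b)\<^sup>2"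
    using sum_squares_bound[of "cmod a" "cmod b"] by (simp add: power2_sum)
  finally show ?thesis .
qed

lemma sob_sum_le:
  assumes "in_Hs s u" "finite F"
  shows "(\<Sum>k\<in>F. japan k powr (2 * s) * (cmod (fcoef u k))\<^sup>2) \<le> (sob_norm s u)\<^sup>2"
proof -
  have "(\<Sum>k\<in>F. japan k powr (2 * s) * (cmod (fcoef u k))\<^sup>2) \<le> (\<Sum>\<^sub>\<infinity>k. japan k powr (2 * s) * (cmod (fcoef u k))\<^sup>2)"
    using assms by (intro finite_sum_le_infsum) (auto simp: in_Hs_def)
  then show ?thesis unfolding sob_norm_def
    by (subst real_sqrt_pow2) (auto intro: infsum_nonneg)
qed

lemma fcoef_diff:
  assumes "in_Hs s u" "in_Hs s v"
  shows "fcoef (\<lambda>x. u x - v x) k = fcoef u k - fcoef v k"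
  unfolding fcoef_eq_mode mode_diff[OF assms[THEN in_Hs_set_integrable]] by (simp add: diff_divide_distrib)

text \<open>A coefficientwise inequality with factor 2 stands in for the triangle inequality;
  boundedness tolerates the factor.\<close>

lemma sob_square_le:
  assumes "in_Hs s u" "in_Hs s v"
  shows "(sob_norm s u)\<^sup>2 \<le> 2 * (sob_norm s (\<lambda>x. u x - v x))\<^sup>2 + 2 * (sob_norm s v)\<^sup>2"
proof -
  define a where "a w k = japan k powr (2 * s) * (cmod (fcoef w k))\<^sup>2" for w k
  have nn: "a w k \<ge> 0" for w k by (simp add: a_def)
  have sq: "(sob_norm s w)\<^sup>2 = infsum (a w) UNIV" for w
    unfolding sob_norm_def a_def[symmetric] by (intro real_sqrt_pow2 infsum_nonneg nn)
  have sm: "a u summable_on UNIV" "a v summable_on UNIV" using assms by (auto simp: in_Hs_def a_def[abs_def])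
  \<comment> \<open>\<open>infsum\<close> is 0 on families that are not summable, so the series of
    the difference has to be shown summable before it can bound anything.\<close>
  have "a (\<lambda>x. u x - v x) k \<le> 2 * a u k + 2 * a v k" for k
    using mult_left_mono[OF cmod_sum_square_le[of "fcoef u k" "- fcoef v k"], of "japan k powr (2 * s)"]
    unfolding a_def fcoef_diff[OF assms] by (simp add: distrib_left mult.left_commute)
  then have sd: "a (\<lambda>x. u x - v x) summable_on UNIV"
    by (rule summable_on_comparison_test[OF summable_on_add[OF sm[THEN summable_on_cmult_right]]]) (auto simp: nn)
  have "infsum (a u) UNIV \<le> infsum (\<lambda>k. 2 * a (\<lambda>x. u x - v x) k + 2 * a v k) UNIV"
  proof (intro infsum_mono sm summable_on_add summable_on_cmult_right sd)
    show "a u k \<le> 2 * a (\<lambda>x. u x - v x) k + 2 * a v k" for k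
      using mult_left_mono[OF cmod_sum_square_le[of "fcoef u k - fcoef v k" "fcoef v k"], of "japan k powr (2 * s)"]
      unfolding a_def fcoef_diff[OF assms] by (simp add: distrib_left mult.left_commute)
  qed
  also have "\<dots> = 2 * infsum (a (\<lambda>x. u x - v x)) UNIV + 2 * infsum (a v) UNIV"
    by (subst infsum_add) (auto intro!: summable_on_cmult_right sd sm simp: infsum_cmult_right')
  finally show ?thesis by (simp add: sq)
qed

text \<open>Continuity into H^s bounds the norm near each time; compactness of [0, T] makes the
  bound uniform.\<close>

lemma solution_bounded:
  assumes u: "is_solution m \<epsilon> V s u0 u"
  obtains K where "\<And>t. t \<in> {0..T} \<Longrightarrow> (sob_norm s (u t))\<^sup>2 \<le> K"
proof -
  have Hs: "in_Hs s (u t)" if "t \<ge> 0" for t using u that by (auto simp: is_solution_def)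
  have "\<exists>K. \<forall>t\<in>{0..T}. (sob_norm s (u t))\<^sup>2 \<le> K"
  proof (rule locally_bounded_imp_bounded)
    fix t0 assume t0: "t0 \<in> {0..T}"
    have "((\<lambda>t. sob_norm s (\<lambda>x. u t x - u t0 x)) \<longlongrightarrow> 0) (at t0 within {0..T})"
      using u t0 by (auto simp: is_solution_def intro: tendsto_within_subset)
    from tendstoD[OF this, of 1] have "\<forall>\<^sub>F t in at t0 within {0..T}. \<bar>sob_norm s (\<lambda>x. u t x - u t0 x)\<bar> < 1 \<and> t \<in> {0..T}"
      by (auto simp: eventually_at_filter elim: eventually_mono)
    then have "\<forall>\<^sub>F t in at t0 within {0..T}. (sob_norm s (u t))\<^sup>2 \<le> 2 + 2 * (sob_norm s (u t0))\<^sup>2"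
    proof eventually_elim
      case (elim t)
      then have "(sob_norm s (\<lambda>x. u t x - u t0 x))\<^sup>2 \<le> 1"
        by (metis abs_square_le_1 less_imp_le)
      then show ?case using sob_square_le[OF Hs[of t] Hs[of t0]] elim t0 by auto
    qed
    then show "\<exists>M. \<forall>\<^sub>F t in at t0 within {0..T}. (sob_norm s (u t))\<^sup>2 \<le> M" by blast
  qed auto
  then show ?thesis using that by blast
qed

text \<open>Cauchy-Schwarz after splitting the weight into the powers 1/2 - s and s of
  \<open>japan k\<close>. The series with exponent 1 - 2 s converges precisely for s > 1, and this
  is where that condition enters uniqueness.\<close>

lemma weighted_sum_le:
  assumes K: "\<And>S. finite S \<Longrightarrow> (\<Sum>k\<in>S. japan k powr (2 * s) * (cmod (U k))\<^sup>2) \<le> K" and S: "finite S"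
  shows "(\<Sum>k\<in>S. sqrt (japan k) * cmod (U k)) \<le> sqrt ((\<Sum>k\<in>S. japan k powr (1 - 2 * s)) * K)"
proof -
  have "sqrt (japan k) * cmod (U k) = japan k powr (1/2 - s) * (japan k powr s * cmod (U k))" for k
    by (simp add: powr_half_sqrt mult.assoc[symmetric] flip: powr_add)
  then have "(\<Sum>k\<in>S. sqrt (japan k) * cmod (U k))\<^sup>2 = (\<Sum>k\<in>S. japan k powr (1/2 - s) * (japan k powr s * cmod (U k)))\<^sup>2"
    by (simp only:)
  also have "\<dots> \<le> (\<Sum>k\<in>S. (japan k powr (1/2 - s))\<^sup>2) * (\<Sum>k\<in>S. (japan k powr s * cmod (U k))\<^sup>2)"
    by (rule Cauchy_Schwarz_ineq_sum)
  also have "\<dots> = (\<Sum>k\<in>S. japan k powr (1 - 2 * s)) * (\<Sum>k\<in>S. japan k powr (2 * s) * (cmod (U k))\<^sup>2)"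
  proof -
    have "(japan k powr r)\<^sup>2 = japan k powr (2 * r)" for k r by (simp add: power2_eq_square flip: powr_add)
    then show ?thesis by (simp add: power_mult_distrib algebra_simps)
  qed
  also have "\<dots> \<le> (\<Sum>k\<in>S. japan k powr (1 - 2 * s)) * K"
    by (intro mult_left_mono K S sum_nonneg) auto
  finally show ?thesis by (rule real_le_rsqrt)
qed

theorem solution_unique:
  assumes V: "smooth2 V" "periodic2 V" and s: "s > 1"
    and u: "is_solution m \<epsilon> V s u0 u" and v: "is_solution m \<epsilon> V s u0 v" and "T \<ge> 0"
  shows "mode (u T) k0 = mode (v T) k0"
proof -
  define A where "A p = real m + \<epsilon> * V p" for p
  have A: "smooth2 A" "periodic2 A"
    unfolding A_def[abs_def] using V(2) by (intro smooth2_intros V, simp add: periodic2_def)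
  interpret real_symbol A by unfold_locales (fact A)+
  have dA: "dx2 A = (\<lambda>p. \<epsilon> * dx2 V p)"
    by (rule dx2_eqI[OF A(1)]) (auto simp: A_def intro!: derivative_eq_intros smooth2_DERIV_snd[OF V(1)])
  have deriv: "deriv (\<lambda>y. V (t, y)) x = dx2 V (t, x)" for t x
    by (rule DERIV_imp_deriv) (rule smooth2_DERIV_snd[OF V(1)])
  have mode_deriv: "((\<lambda>t. mode (u t) k) has_vector_derivative (LINT x:{0..2*pi}|lborel. u t x * h t k x)) (at t within {0..})"
    if "is_solution m \<epsilon> V s u0 u" "t \<ge> 0" for u k t
  proof -
    have "h t k x = - complex_of_real (real m + \<epsilon> * V (t, x)) * (\<i> * of_int k * exp (\<i> * of_int k * of_real x))
                - complex_of_real (\<epsilon> * deriv (\<lambda>y. V (t, y)) x) * exp (\<i> * of_int k * of_real x)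
                + complex_of_real (\<epsilon> / 2 * deriv (\<lambda>y. V (t, y)) x) * exp (\<i> * of_int k * of_real x)" for x
      by (simp add: h_def A_def dA deriv ei_def field_simps)
    then show ?thesis
      using that unfolding is_solution_def mode_def ei_def by presburger
  qed
  define W where "W t k = mode (u t) k - mode (v t) k" for t k
  define D where "D t k = (LINT x:{0..2*pi}|lborel. u t x * h t k x) - (LINT x:{0..2*pi}|lborel. v t x * h t k x)" for t k
  have Hs: "in_Hs s (u t)" "in_Hs s (v t)" if "t \<ge> 0" for t using u v that by (auto simp: is_solution_def)
  have W0: "W 0 k = 0" for k using u v by (simp add: W_def is_solution_def)
  have Wd: "((\<lambda>t. W t k) has_vector_derivative D t k) (at t within {0..})" if "t \<ge> 0" for t k
    unfolding W_def D_def by (intro has_vector_derivative_diff mode_deriv u v that)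
  have lim: "(\<lambda>N. \<Sum>l\<in>{- int N..int N}. B t k (k + l) * W t (k + l)) \<longlonglongrightarrow> D t k" if "t \<ge> 0" for t k
    using tendsto_diff[OF pairing_expansion[OF in_Hs_set_integrable[OF Hs(1)[OF that]] that, of k]
        pairing_expansion[OF in_Hs_set_integrable[OF Hs(2)[OF that]] that, of k]]
    by (simp add: D_def W_def right_diff_distrib sum_subtractf)
  obtain Ku where Ku: "\<And>t. t \<in> {0..T} \<Longrightarrow> (sob_norm s (u t))\<^sup>2 \<le> Ku" using solution_bounded[OF u] by blast
  obtain Kv where Kv: "\<And>t. t \<in> {0..T} \<Longrightarrow> (sob_norm s (v t))\<^sup>2 \<le> Kv" using solution_bounded[OF v] by blast
  \<comment> \<open>8 pi^2 = 2 (2 pi)^2: the 2 comes from squaring a difference, the (2 pi)^2 from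
    passing from \<open>mode\<close> to \<open>fcoef\<close>.\<close>
  define K where "K = 8 * pi\<^sup>2 * (Ku + Kv)"
  have K: "(\<Sum>k\<in>S. japan k powr (2 * s) * (cmod (W t k))\<^sup>2) \<le> K" if t: "t \<in> {0..T}" and "finite S" for t S
  proof -
    define a where "a w k = japan k powr (2 * s) * (cmod (fcoef w k))\<^sup>2" for w k
    have "japan k powr (2 * s) * (cmod (W t k))\<^sup>2 \<le> 8 * pi\<^sup>2 * a (u t) (- k) + 8 * pi\<^sup>2 * a (v t) (- k)" for k
    proof -
      have "(cmod (W t k))\<^sup>2 \<le> 2 * (cmod (mode (u t) k))\<^sup>2 + 2 * (cmod (mode (v t) k))\<^sup>2"
        using cmod_sum_square_le[of "mode (u t) k" "- mode (v t) k"] by (simp add: W_def)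
      also have "\<dots> = 8 * pi\<^sup>2 * (cmod (fcoef (u t) (- k)))\<^sup>2 + 8 * pi\<^sup>2 * (cmod (fcoef (v t) (- k)))\<^sup>2"
        by (simp add: mode_eq_fcoef norm_mult power_mult_distrib)
      finally show ?thesis using mult_left_mono[of "(cmod (W t k))\<^sup>2" _ "japan k powr (2 * s)"]
        by (fastforce simp: a_def algebra_simps)
    qed
    then have "(\<Sum>k\<in>S. japan k powr (2 * s) * (cmod (W t k))\<^sup>2) \<le> (\<Sum>k\<in>S. 8 * pi\<^sup>2 * a (u t) (- k) + 8 * pi\<^sup>2 * a (v t) (- k))"
      by (rule sum_mono)
    also have "\<dots> = 8 * pi\<^sup>2 * (\<Sum>k\<in>S. a (u t) (- k)) + 8 * pi\<^sup>2 * (\<Sum>k\<in>S. a (v t) (- k))"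
      by (simp add: sum.distrib sum_distrib_left)
    also have "\<dots> = 8 * pi\<^sup>2 * ((\<Sum>k\<in>uminus ` S. a (u t) k) + (\<Sum>k\<in>uminus ` S. a (v t) k))"
      by (simp add: sum.reindex distrib_left)
    also have "\<dots> \<le> 8 * pi\<^sup>2 * (Ku + Kv)"
      using sob_sum_le[OF Hs(1), of t "uminus ` S"] sob_sum_le[OF Hs(2), of t "uminus ` S"] Ku[OF t] Kv[OF t] that
      by (intro mult_left_mono) (auto simp: a_def)
    finally show ?thesis by (simp add: K_def)
  qed
  have "K \<ge> 0" using K[of T "{}"] \<open>T \<ge> 0\<close> by simp
  obtain C where C: "C \<ge> 0" "\<And>t k j. t \<in> {0..T} \<Longrightarrow> cmod (B t k j) \<le> C * (sqrt (japan k) * sqrt (japan j))"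
    using B_bound[where T=T] by blast
  have sg: "(\<lambda>k. japan k powr (1 - 2 * s)) summable_on UNIV" using summable_on_japan[of "2 * s - 1"] s by simp
  define G where "G = (\<Sum>\<^sub>\<infinity>k. japan k powr (1 - 2 * s))"
  define P where "P = sqrt (G * K)"
  have P: "(\<Sum>k\<in>S. sqrt (japan k) * cmod (W t k)) \<le> P" if "t \<in> {0..T}" "finite S" for t S
  proof -
    have "(\<Sum>k\<in>S. japan k powr (1 - 2 * s)) \<le> G"
      unfolding G_def using that by (intro finite_sum_le_infsum sg) auto
    then have "sqrt ((\<Sum>k\<in>S. japan k powr (1 - 2 * s)) * K) \<le> P"
      unfolding P_def using \<open>K \<ge> 0\<close> by (intro real_sqrt_le_mono mult_right_mono) auto
    then show ?thesis using weighted_sum_le[of s "W t" K S] K that by force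
  qed
  have "P \<ge> 0" unfolding P_def G_def using \<open>K \<ge> 0\<close> by (intro real_sqrt_ge_zero mult_nonneg_nonneg infsum_nonneg) auto
  have energy: "(cmod (W T k0))\<^sup>2 \<le> 2 * (C * P * sqrt (e * K)) * T" if "e > 0" for e
  proof -
    obtain F where F: "finite F" "(\<Sum>\<^sub>\<infinity>k\<in>- F. japan k powr (1 - 2 * s)) < e" using summable_on_tail[OF sg \<open>e > 0\<close>] by blast
    \<comment> \<open>The window has to contain \<open>k0\<close>, whose coefficient is being
      bounded, and \<open>F\<close>, outside which the weights sum to less than e.\<close>
    define n where "n = Max (insert (nat \<bar>k0\<bar>) ((\<lambda>k. nat \<bar>k\<bar>) ` F))"
    have n: "nat \<bar>k\<bar> \<le> n" if "k \<in> insert k0 F" for k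
      unfolding n_def using F(1) that by (intro Max_ge) auto
    define I where "I = {- int n..int n}"
    have I: "k0 \<in> I" "F \<subseteq> I" using n by (force simp: I_def)+
    define \<tau> where "\<tau> = sqrt (e * K)"
    have "\<tau> \<ge> 0" using \<open>K \<ge> 0\<close> \<open>e > 0\<close> by (simp add: \<tau>_def)
    have \<tau>: "(\<Sum>k\<in>S. sqrt (japan k) * cmod (W t k)) \<le> \<tau>" if "t \<in> {0..T}" "finite S" "S \<inter> {- int n..int n} = {}" for t S
    proof -
      have "(\<Sum>k\<in>S. japan k powr (1 - 2 * s)) \<le> (\<Sum>\<^sub>\<infinity>k\<in>- F. japan k powr (1 - 2 * s))"
        using that I(2) by (intro finite_sum_le_infsum summable_on_subset_banach[OF sg]) (auto simp: I_def)
      then have "sqrt ((\<Sum>k\<in>S. japan k powr (1 - 2 * s)) * K) \<le> \<tau>"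
        unfolding \<tau>_def using \<open>K \<ge> 0\<close> F(2) by (intro real_sqrt_le_mono mult_right_mono) auto
      then show ?thesis using weighted_sum_le[of s "W t" K S] K that by force
    qed
    define En where "En t = (\<Sum>k\<in>I. (cmod (W t k))\<^sup>2)" for t
    define En' where "En' t = (\<Sum>k\<in>I. 2 * Re (cnj (W t k) * D t k))" for t
    have d: "(En has_real_derivative En' t) (at t within {0..T})" if "t \<in> {0..T}" for t
    proof -
      have "((\<lambda>t. (cmod (W t k))\<^sup>2) has_real_derivative 2 * Re (cnj (W t k) * D t k)) (at t within {0..T})" for k
      proof -
        have "((\<lambda>t. W t k) has_vector_derivative D t k) (at t within {0..T})"
          using Wd[of t k] that by (auto intro: has_vector_derivative_within_subset)
        from bounded_bilinear.has_vector_derivative[OF bounded_bilinear_inner this this]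
        show ?thesis
          unfolding has_real_derivative_iff_has_vector_derivative power2_norm_eq_inner
          by (rule has_vector_derivative_eq_rhs) (simp add: inner_complex_def algebra_simps)
      qed
      then show ?thesis unfolding En_def En'_def by (intro DERIV_sum)
    qed
    have b: "\<bar>En' t\<bar> \<le> 2 * (C * P * \<tau>)" if t: "t \<in> {0..T}" for t
    proof -
      have "\<bar>\<Sum>k\<in>{- int n..int n}. Re (cnj (W t k) * D t k)\<bar> \<le> C * P * \<tau>"
        using t by (intro truncated_energy_bound[where t=t] lim C P \<tau> \<open>\<tau> \<ge> 0\<close>) auto
      then show ?thesis unfolding En'_def I_def sum_distrib_left[symmetric] abs_mult by simp
    qed
    have "norm (En T - En 0) \<le> 2 * (C * P * \<tau>) * norm (T - 0)"
      using d b \<open>T \<ge> 0\<close> by (intro field_differentiable_bound[of "{0..T}"]) auto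
    moreover have "En 0 = 0" by (simp add: En_def W0)
    moreover have "(cmod (W T k0))\<^sup>2 \<le> En T"
      unfolding En_def using I(1) by (intro member_le_sum) (auto simp: I_def)
    ultimately show ?thesis using \<open>T \<ge> 0\<close> by (simp add: \<tau>_def)
  qed
  \<comment> \<open>C, P and K do not depend on the window, which enters the bound only through e;
    so e can tend to 0 with T and \<open>k0\<close> fixed.\<close>
  have "((\<lambda>e. 2 * (C * P * sqrt (e * K)) * T) \<longlongrightarrow> 2 * (C * P * sqrt (0 * K)) * T) (at_right 0)"
    by (intro tendsto_intros)
  then have "(cmod (W T k0))\<^sup>2 \<le> 2 * (C * P * sqrt (0 * K)) * T"
    by (rule tendsto_lowerbound) (auto simp: eventually_at_filter energy)
  then show ?thesis by (simp add: W_def)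
qed

corollary solution_sob_norm_unique:
  assumes "smooth2 V" "periodic2 V" "s > 1" "is_solution m \<epsilon> V s u0 u" "is_solution m \<epsilon> V s u0 v" "t \<ge> 0"
  shows "sob_norm s (u t) = sob_norm s (v t)"
  unfolding sob_norm_def fcoef_eq_mode solution_unique[OF assms] ..

section \<open>Averaging\<close>

text \<open>At the first time the level c is reached the derivative is negative, so slightly earlier
  values would exceed c, contradicting the choice of that time.\<close>

lemma below_barrier:
  fixes f :: "real \<Rightarrow> real"
  assumes f: "\<And>t. (f has_real_derivative f' t) (at t)" and 0: "f 0 < c"
    and barrier: "\<And>t. t \<ge> 0 \<Longrightarrow> f t = c \<Longrightarrow> f' t < 0" and "t \<ge> 0"
  shows "f t < c"
proof (rule ccontr)
  assume "\<not> f t < c"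
  define S where "S = {\<tau>\<in>{0..t}. c \<le> f \<tau>}"
  have fc: "continuous_on X f" for X
    using f by (meson DERIV_isCont continuous_at_imp_continuous_on)
  have "compact S"
  proof -
    have "S = {0..t} \<inter> {\<tau>. c \<le> f \<tau>}" by (auto simp: S_def)
    moreover have "closed ({0..t} \<inter> {\<tau>. c \<le> f \<tau>})"
      by (intro closed_Int closed_Collect_le fc continuous_intros)
    moreover have "bounded S" unfolding S_def by (rule bounded_subset[of "{0..t}"]) auto
    ultimately show ?thesis by (simp add: compact_eq_bounded_closed)
  qed
  moreover have "S \<noteq> {}" using \<open>\<not> f t < c\<close> \<open>t \<ge> 0\<close> by (auto simp: S_def)
  ultimately obtain r where r: "r \<in> S" "\<And>\<tau>. \<tau> \<in> S \<Longrightarrow> r \<le> \<tau>" using compact_attains_inf by metis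
  have "r > 0" using r(1) 0 by (cases "r = 0") (auto simp: S_def)
  have less: "f \<tau> < c" if "0 \<le> \<tau>" "\<tau> < r" for \<tau>
    using r(2)[of \<tau>] r(1) that by (force simp: S_def)
  have "f r \<le> c"
  proof (rule ccontr)
    assume "\<not> f r \<le> c"
    then obtain \<tau> where "0 \<le> \<tau>" "\<tau> \<le> r" "f \<tau> = c"
      using IVT'[of f 0 c r] 0 \<open>r > 0\<close> fc by auto
    then show False using less[of \<tau>] \<open>\<not> f r \<le> c\<close> by (cases "\<tau> = r") auto
  qed
  then have "f r = c" using r(1) by (auto simp: S_def)
  then have "f' r < 0" using barrier \<open>r > 0\<close> by simp
  from DERIV_neg_dec_left[OF f this] obtain d where d: "d > 0" "\<And>h. 0 < h \<Longrightarrow> h < d \<Longrightarrow> f r < f (r - h)" by blast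
  define h where "h = min (d / 2) r"
  have "f r < f (r - h)" using d \<open>r > 0\<close> by (intro d(2)) (auto simp: h_def)
  moreover have "f (r - h) < c" using d(1) \<open>r > 0\<close> by (intro less) (auto simp: h_def)
  ultimately show False using \<open>f r = c\<close> by simp
qed

text \<open>If the given zero is crossed downwards, so is its translate by a period. Then g is
  positive just before the translate, and the last zero before that point must be crossed
  upwards.\<close>

lemma zero_with_positive_derivative:
  fixes g :: "real \<Rightarrow> real"
  assumes g: "\<And>x. (g has_real_derivative g' x) (at x)" and per: "\<And>x. g (x + 2 * pi) = g x"
    and nd: "\<And>x. g x = 0 \<Longrightarrow> g' x \<noteq> 0" and z: "g a = 0"
  obtains y where "g y = 0" "g' y > 0"
proof (cases "g' a > 0")
  case True
  then show ?thesis using that z by blast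
next
  case False
  have gc: "continuous_on X g" for X
    using g by (meson DERIV_isCont continuous_at_imp_continuous_on)
  have "g' a < 0" using False nd[OF z] by simp
  then have "g' (a + 2 * pi) < 0" using periodic_deriv[OF g per] by simp
  from DERIV_neg_dec_left[OF g this] obtain d where d: "d > 0" "\<And>h. 0 < h \<Longrightarrow> h < d \<Longrightarrow> g (a + 2 * pi) < g (a + 2 * pi - h)" by blast
  define b where "b = a + 2 * pi - min (d / 2) pi"
  have b: "g b > 0" "a < b"
    using d(2)[of "min (d / 2) pi"] d(1) z per[of a] pi_gt_zero by (auto simp: b_def min_def split: if_splits)
  define S where "S = {x\<in>{a..b}. g x \<le> 0}"
  have "compact S"
  proof -
    have "S = {a..b} \<inter> {x. g x \<le> 0}" by (auto simp: S_def)
    moreover have "closed ({a..b} \<inter> {x. g x \<le> 0})"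
      by (intro closed_Int closed_Collect_le gc continuous_intros)
    moreover have "bounded S" unfolding S_def by (rule bounded_subset[of "{a..b}"]) auto
    ultimately show ?thesis by (simp add: compact_eq_bounded_closed)
  qed
  moreover have "a \<in> S" using z b by (auto simp: S_def)
  ultimately obtain y where y: "y \<in> S" "\<And>x. x \<in> S \<Longrightarrow> x \<le> y" using compact_attains_sup by (metis empty_iff)
  have yb: "y < b" using y(1) b by (cases "y = b") (auto simp: S_def)
  have pos: "g x > 0" if "y < x" "x \<le> b" for x
    using y(2)[of x] y(1) that by (force simp: S_def)
  have "g y \<ge> 0"
  proof (rule ccontr)
    assume "\<not> 0 \<le> g y"
    then obtain x where "y \<le> x" "x \<le> b" "g x = 0"
      using IVT'[of g y 0 b] b yb gc by auto
    then show False using pos[of x] \<open>\<not> 0 \<le> g y\<close> by (cases "x = y") auto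
  qed
  then have y0: "g y = 0" using y(1) by (auto simp: S_def)
  have "g' y > 0"
  proof (rule ccontr)
    assume "\<not> g' y > 0"
    then have "g' y < 0" using nd[OF y0] by simp
    from DERIV_neg_dec_right[OF g this] obtain d where d: "d > 0" "\<And>h. 0 < h \<Longrightarrow> h < d \<Longrightarrow> g (y + h) < g y" by blast
    define h where "h = min (d / 2) (b - y)"
    have "g (y + h) < g y" using d yb by (intro d(2)) (auto simp: h_def)
    moreover have "g (y + h) > 0" using d(1) yb by (intro pos) (auto simp: h_def)
    ultimately show False using y0 by simp
  qed
  then show ?thesis using that y0 by blast
qed

section \<open>The averaged potential and the corrector\<close>

lemma prim_eq_integral:
  assumes "continuous_on UNIV b" "T \<ge> 0"
  shows "prim b (T, x) = integral {0..T} (\<lambda>t. b (t, x))"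
proof -
  have "((\<lambda>t. b (t, x)) has_integral prim b (T, x) - prim b (0, x)) {0..T}"
    using prim_DERIV_fst[OF assms(1)] assms(2)
    by (intro fundamental_theorem_of_calculus)
      (auto simp: has_real_derivative_iff_has_vector_derivative intro: has_vector_derivative_at_within)
  then show ?thesis by (simp add: integral_unique)
qed

locale resonance =
  fixes m :: nat and V :: "real \<times> real \<Rightarrow> real"
  assumes V: "smooth2 V" "periodic2 V"
begin

definition W :: "real \<times> real \<Rightarrow> real" where
  "W p = V (fst p, snd p - real m * fst p)"

text \<open>The average of \<open>W\<close> over one period of t. It is constant in its first
  argument and kept on pairs to stay within the calculus of \<open>smooth2\<close>.\<close>

definition g :: "real \<times> real \<Rightarrow> real" where
  "g p = 1 / (2 * pi) * prim W (2 * pi, snd p)"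

lemma W_smooth: "smooth2 W"
  unfolding W_def[abs_def]
  by (intro smooth2_compose[OF V(1)] smooth2_diff smooth2_mult smooth2_intros)

lemma W_periodic: "periodic2 W"
  unfolding periodic2_def
proof (intro allI conjI)
  fix t x
  have "W (t + 2 * pi, x) = V (t + 2 * pi, x - real m * t + 2 * pi * of_int (- int m))"
    by (simp add: W_def algebra_simps)
  also have "\<dots> = V (t + 2 * pi, x - real m * t)"
    using V(2) by (intro periodic_int_shift[of "\<lambda>x. V (_, x)"]) (simp add: periodic2_def)
  also have "\<dots> = W (t, x)" using V(2) by (simp add: periodic2_def W_def)
  finally show "W (t + 2 * pi, x) = W (t, x)" .
  have "W (t, x + 2 * pi) = V (t, x - real m * t + 2 * pi)" by (simp add: W_def algebra_simps)
  then show "W (t, x + 2 * pi) = W (t, x)" using V(2) by (simp add: periodic2_def W_def)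
qed

lemma dx2_W: "dx2 W (t, y) = dx2 V (t, y - real m * t)"
proof -
  have "((\<lambda>y. V (t, y - real m * t)) has_real_derivative dx2 V (t, y - real m * t) * 1) (at y)"
    by (rule DERIV_chain2[OF smooth2_DERIV_snd[OF V(1)]]) (auto intro!: derivative_eq_intros)
  then have "((\<lambda>y. W (t, y)) has_real_derivative dx2 V (t, y - real m * t)) (at y)" by (simp add: W_def)
  then show ?thesis using smooth2_DERIV_snd[OF W_smooth] DERIV_unique by blast
qed

lemma g_smooth: "smooth2 g"
  unfolding g_def[abs_def]
  by (intro smooth2_mult smooth2_const smooth2_compose[OF smooth2_prim[OF W_smooth]] smooth2_snd)

lemma g_periodic: "periodic2 g"
  using W_periodic by (simp add: periodic2_def g_def prim_def)

lemma g_fst: "g (t, x) = g (0, x)" and dx2_g_fst: "dx2 g (t, x) = dx2 g (0, x)"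
proof -
  show *: "g (t, x) = g (0, x)" for t x by (simp add: g_def)
  have "((\<lambda>x. g (0, x)) has_real_derivative dx2 g (t, x)) (at x)"
    using smooth2_DERIV_snd[OF g_smooth, of t x UNIV] by (simp only: *[of t])
  then show "dx2 g (t, x) = dx2 g (0, x)" using smooth2_DERIV_snd[OF g_smooth] DERIV_unique by blast
qed

text \<open>The shear x = y - m t turns exp (- i (k x + m k t)) into exp (- i k y): resonant modes
  are exactly those that no longer oscillate in t in the moving frame. At fixed t the shear is a
  rotation in x and does not affect the integral over a period.\<close>

lemma vcoef_eq: "vcoef V k (int m * k) = fcoef (\<lambda>x. of_real (g (0, x))) k"
proof -
  define f where "f p = complex_of_real (V p) * exp (- \<i> * (of_int k * of_real (snd p) + of_int (int m * k) * of_real (fst p)))" for p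
  define F where "F t y = complex_of_real (W (t, y)) * ei (- k) y" for t y
  note [continuous_intros] = continuous_on_UNIV_compose[OF smooth2_continuous[OF V(1)]]
    continuous_on_UNIV_compose[OF smooth2_continuous[OF W_smooth]]
    continuous_on_UNIV_compose[OF smooth2_continuous[OF g_smooth]]
  have fF: "f (t, x) = F t (x + real m * t)" for t x
    by (simp add: f_def F_def W_def ei_def algebra_simps)
  have fc: "continuous_on X f" for X unfolding f_def[abs_def] by (intro continuous_intros)
  have box: "{0..2*pi} \<times> {0..2*pi} = cbox (0::real, 0::real) (2*pi, 2*pi)" by (simp add: cbox_Pair_eq)
  have "(LINT p:{0..2*pi} \<times> {0..2*pi}|lborel. f p) = integral (cbox (0, 0) (2*pi, 2*pi)) f"
    unfolding box
    by (intro set_borel_integral_eq_integral) (auto simp: set_integrable_def intro!: borel_integrable_compact fc)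
  also have "\<dots> = integral {0..2*pi} (\<lambda>t. integral {0..2*pi} (\<lambda>x. f (t, x)))"
    using integral_prod_continuous[OF fc, of 0 0 "2*pi" "2*pi"] by simp
  also have "\<dots> = integral {0..2*pi} (\<lambda>t. integral {0..2*pi} (F t))"
  proof -
    have "integral {0..2*pi} (\<lambda>x. f (t, x)) = integral {0..2*pi} (F t)" for t
      unfolding fF using W_periodic
      by (intro period_shift) (auto simp: F_def periodic2_def intro!: continuous_intros)
    then show ?thesis by simp
  qed
  also have "\<dots> = integral {0..2*pi} (\<lambda>y. integral {0..2*pi} (\<lambda>t. F t y))"
    using integral_swap_continuous[of 0 0 "2*pi" "2*pi" F]
    by (simp add: F_def split_beta continuous_intros)
  also have "\<dots> = integral {0..2*pi} (\<lambda>y. 2 * pi * (of_real (g (0, y)) * ei (- k) y))"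
  proof -
    have "integral {0..2*pi} (\<lambda>t. F t y) = of_real (2 * pi * g (0, y)) * ei (- k) y" for y
    proof -
      have "((\<lambda>t. W (t, y)) has_integral 2 * pi * g (0, y)) {0..2*pi}"
      proof -
        have "(\<lambda>t. W (t, y)) integrable_on {0..2*pi}"
          by (intro integrable_continuous_interval continuous_intros)
        from integrable_integral[OF this] show ?thesis
          using prim_eq_integral[OF smooth2_continuous[OF W_smooth], of "2*pi" y] by (simp add: g_def)
      qed
      from has_integral_mult_left[OF has_integral_of_real[OF this]] show ?thesis
        unfolding F_def by (rule integral_unique)
    qed
    then show ?thesis by (simp add: mult.assoc)
  qed
  also have "\<dots> = 2 * pi * mode (\<lambda>x. of_real (g (0, x))) (- k)"
    by (subst mode_eq_integral) (auto intro!: continuous_intros)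
  finally show ?thesis
    unfolding vcoef_def fcoef_eq_mode f_def[symmetric] by (simp add: power2_eq_square)
qed

text \<open>The unordered sum in \<open>res_avg\<close> has to be matched with symmetric partial
  sums: decay of order 2 gives absolute summability, so the limit may be taken along growing
  windows, where Fourier inversion identifies it.\<close>

lemma res_avg_eq: "res_avg m V x = of_real (g (0, x))"
proof -
  interpret sym: real_symbol g by unfold_locales (fact g_smooth g_periodic)+
  define c where "c k = fcoef (\<lambda>x. complex_of_real (g (0, x))) k * ei k x" for k
  obtain C where C: "C \<ge> 0" "\<And>k. japan k ^ 2 * cmod (sym.\<alpha> 0 k) \<le> C"
    using sym.\<alpha>_decay[where T=0 and N=2] by (metis atLeastAtMost_iff order_refl)
  have cb: "norm (c k) \<le> C * japan k powr (- 2)" for k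
    using C(2)[of k] by (simp add: c_def norm_mult sym.\<alpha>_def powr_minus_divide field_simps)
  have "(\<lambda>k. norm (c k)) summable_on UNIV"
    by (rule summable_on_comparison_test[OF summable_on_cmult_right[OF summable_on_japan[of 2]]]) (use cb in auto)
  then have "c summable_on UNIV" by (rule abs_summable_summable)
  then have "(sum c \<longlongrightarrow> infsum c UNIV) (finite_subsets_at_top UNIV)"
    using has_sum_def has_sum_infsum by blast
  moreover have "filterlim (\<lambda>N. {- int N..int N}) (finite_subsets_at_top UNIV) sequentially"
    unfolding filterlim_finite_subsets_at_top
  proof safe
    fix X :: "int set" assume "finite X"
    have "X \<subseteq> {- int N..int N}" if "N \<ge> Max (insert 0 ((\<lambda>k. nat \<bar>k\<bar>) ` X))" for N
    proof
      fix k assume "k \<in> X"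
      then have "nat \<bar>k\<bar> \<le> Max (insert 0 ((\<lambda>k. nat \<bar>k\<bar>) ` X))" using \<open>finite X\<close> by (intro Max_ge) auto
      then show "k \<in> {- int N..int N}" using that by auto
    qed
    then show "\<forall>\<^sub>F N in sequentially. finite {- int N..int N} \<and> X \<subseteq> {- int N..int N} \<and> {- int N..int N} \<subseteq> UNIV"
      using eventually_sequentially by auto
  qed
  ultimately have "(\<lambda>N. \<Sum>k\<in>{- int N..int N}. c k) \<longlonglongrightarrow> infsum c UNIV" by (rule filterlim_compose)
  moreover have "(\<lambda>N. \<Sum>k\<in>{- int N..int N}. c k) \<longlonglongrightarrow> of_real (g (0, x))"
    unfolding c_def
    by (rule fourier_inversion[OF _ _ has_vector_derivative_of_real[OF smooth2_DERIV_snd[OF g_smooth]]])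
      (use g_periodic in \<open>auto simp: periodic2_def intro!: continuous_intros continuous_on_UNIV_compose[OF smooth2_continuous[OF g_smooth]]\<close>)
  ultimately have "infsum c UNIV = of_real (g (0, x))" by (rule LIMSEQ_unique)
  then show ?thesis by (simp add: res_avg_def vcoef_eq c_def[abs_def] ei_def)
qed

lemma unstable_zero:
  assumes "resonantly_unstable m V"
  obtains y where "g (0, y) = 0" "dx2 g (0, y) > 0"
proof -
  have d: "((\<lambda>x. g (0, x)) has_real_derivative dx2 g (0, x)) (at x)" for x
    by (rule smooth2_DERIV_snd[OF g_smooth])
  have r: "res_avg m V = (\<lambda>x. of_real (g (0, x)))" by (simp add: fun_eq_iff res_avg_eq)
  have v: "vector_derivative (res_avg m V) (at x) = of_real (dx2 g (0, x))" for x
    unfolding r by (rule vector_derivative_at) (rule has_vector_derivative_of_real[OF d])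
  obtain a where a: "g (0, a) = 0" using assms by (auto simp: resonantly_unstable_def res_avg_eq)
  have nd: "dx2 g (0, x) \<noteq> 0" if "g (0, x) = 0" for x
  proof -
    have "vector_derivative (res_avg m V) (at x) \<noteq> 0"
      using assms that unfolding resonantly_unstable_def res_avg_eq by auto
    then show ?thesis by (simp add: v)
  qed
  show ?thesis
    by (rule zero_with_positive_derivative[OF d _ nd a]) (use g_periodic that in \<open>auto simp: periodic2_def\<close>)
qed

text \<open>The corrector of first-order averaging: its t-derivative is the oscillating part of
  \<open>W\<close>, so adding \<epsilon> H to the orbit cancels that part to first order in
  \<epsilon>.\<close>

definition H :: "real \<times> real \<Rightarrow> real" where
  "H = prim (\<lambda>p. W p - g p)"

lemma H_smooth: "smooth2 H"
  unfolding H_def by (intro smooth2_prim smooth2_diff W_smooth g_smooth)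

lemma H_t: "((\<lambda>t. H (t, y)) has_real_derivative W (t, y) - g (t, y)) (at t)"
  unfolding H_def by (rule prim_DERIV_fst) (intro smooth2_continuous smooth2_diff W_smooth g_smooth)

lemma dx2_H: "dx2 H = prim (\<lambda>p. dx2 W p - dx2 g p)"
proof -
  have "has_partials H (\<lambda>p. W p - g p) (prim (\<lambda>p. dx2 W p - dx2 g p))"
    unfolding H_def
  proof (intro has_partialsI prim_DERIV_fst prim_DERIV_snd continuous_on_prim)
    show "((\<lambda>x. W (t, x) - g (t, x)) has_real_derivative dx2 W (t, x) - dx2 g (t, x)) (at x)" for t x
      by (intro derivative_intros smooth2_DERIV_snd W_smooth g_smooth)
  qed (intro smooth2_continuous smooth2_diff smooth2_dx2 W_smooth g_smooth)+
  then show ?thesis using has_partials_eq_dx2 by metis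
qed

lemma H_0: "H (0, y) = 0" "dx2 H (0, y) = 0"
  unfolding dx2_H by (simp_all add: H_def)

text \<open>W - g has mean zero over a period in t, so its primitive returns to 0 and is periodic in
  t as well. This makes H and its x-derivatives bounded for all times, on which the long-time
  estimate rests.\<close>

lemma H_periodic: "periodic2 H"
  unfolding periodic2_def
proof (intro allI conjI)
  fix t y
  show "H (t, y + 2 * pi) = H (t, y)"
    using W_periodic g_periodic by (simp add: H_def prim_def periodic2_def)
  have "((\<lambda>t. H (t + 2 * pi, y) - H (t, y)) has_real_derivative 0) (at t)" for t
  proof -
    have "((\<lambda>t. H (t + 2 * pi, y)) has_real_derivative W (t + 2 * pi, y) - g (t + 2 * pi, y)) (at t)"
      using H_t[of y "t + 2 * pi"] DERIV_shift[of "\<lambda>t. H (t, y)" _ t "2 * pi"] by simp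
    from DERIV_diff[OF this H_t[of y t]] show ?thesis
      using W_periodic g_periodic by (simp add: periodic2_def)
  qed
  then have "H (t + 2 * pi, y) - H (t, y) = H (0 + 2 * pi, y) - H (0, y)"
    by (meson DERIV_isconst_all)
  also have "H (0 + 2 * pi, y) = integral {0..2*pi} (\<lambda>t. W (t, y) - g (0, y))"
  proof -
    have "continuous_on UNIV (\<lambda>p. W p - g p)" by (intro smooth2_continuous smooth2_diff W_smooth g_smooth)
    from prim_eq_integral[OF this, of "2*pi" y] show ?thesis
      by (simp add: H_def) (metis g_fst)
  qed
  also have "\<dots> = integral {0..2*pi} (\<lambda>t. W (t, y)) - 2 * pi * g (0, y)"
    by (subst integral_diff)
      (auto intro!: integrable_continuous_interval continuous_on_UNIV_compose[OF smooth2_continuous[OF W_smooth]] continuous_intros)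
  also have "integral {0..2*pi} (\<lambda>t. W (t, y)) = 2 * pi * g (0, y)"
    using prim_eq_integral[OF smooth2_continuous[OF W_smooth], of "2*pi" y] by (simp add: g_def)
  finally show "H (t + 2 * pi, y) = H (t, y)" by (simp add: H_0)
qed

text \<open>In the moving frame \<open>y = \<Phi> + m t\<close> the characteristics solve \<open>y' = - \<epsilon> W (t, y)\<close>. The corrected
  variable \<open>y + \<epsilon> H (t, y)\<close> obeys the averaged equation up to \<open>O(\<epsilon>\<^sup>2)\<close> and hence
  stays close to the attracting zero \<open>y0\<close> of the averaged field \<open>- \<epsilon> g\<close>.\<close>

lemma stretching_along_trapped_orbit:
  assumes y0: "g (0, y0) = 0" "dx2 g (0, y0) = \<rho>" "\<rho> > 0"
  obtains \<epsilon>0 M where "\<epsilon>0 > 0" "M \<ge> 0"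
    "\<And>\<epsilon> \<Phi> E t. 0 < \<epsilon> \<Longrightarrow> \<epsilon> < \<epsilon>0 \<Longrightarrow> characteristics m \<epsilon> V \<Phi> E \<Longrightarrow> t \<ge> 0 \<Longrightarrow> E (t, y0) \<ge> \<epsilon> * (\<rho> / 4) * t - M"
proof -
  have sm: "smooth2 (dx2 H)" "smooth2 (dx2 (dx2 H))" "smooth2 (dx2 g)" by (intro smooth2_dx2 H_smooth g_smooth)+
  have pr: "periodic2 (dx2 H)" "periodic2 (dx2 (dx2 H))" by (intro periodic2_dx2 smooth2_dx2 H_smooth H_periodic)+
  obtain M1 where M1: "M1 > 0" "\<And>p. \<bar>W p\<bar> \<le> M1" using periodic2_bounded[OF W_periodic smooth2_continuous[OF W_smooth]] by blast
  obtain M2 where M2: "M2 > 0" "\<And>p. \<bar>H p\<bar> \<le> M2" using periodic2_bounded[OF H_periodic smooth2_continuous[OF H_smooth]] by blast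
  obtain M3 where M3: "M3 > 0" "\<And>p. \<bar>dx2 H p\<bar> \<le> M3" using periodic2_bounded[OF pr(1) smooth2_continuous[OF sm(1)]] by blast
  obtain M4 where M4: "M4 > 0" "\<And>p. \<bar>dx2 (dx2 H) p\<bar> \<le> M4" using periodic2_bounded[OF pr(2) smooth2_continuous[OF sm(2)]] by blast
  define M where "M = M1 + M2 + M3 + M4"
  have M: "M > 0" "\<bar>W p\<bar> \<le> M" "\<bar>H p\<bar> \<le> M" "\<bar>dx2 H p\<bar> \<le> M" "\<bar>dx2 (dx2 H) p\<bar> \<le> M" for p
    using M1(1) M1(2)[of p] M2(1) M2(2)[of p] M3(1) M3(2)[of p] M4(1) M4(2)[of p] by (auto simp: M_def)
  have prod: "\<bar>dx2 H p * W q\<bar> \<le> M\<^sup>2" "\<bar>dx2 (dx2 H) p * W q\<bar> \<le> M\<^sup>2" for p q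
    unfolding power2_eq_square abs_mult by (intro mult_mono M less_imp_le[OF M(1)] abs_ge_zero)+
  have "isCont (\<lambda>y. dx2 g (0, y)) y0"
    using continuous_on_UNIV_compose[OF smooth2_continuous[OF sm(3)], of UNIV "\<lambda>y. (0, y)"]
    by (auto simp: continuous_on_eq_continuous_at intro!: continuous_intros)
  then obtain r where r: "r > 0" "\<And>y. dist y y0 < r \<Longrightarrow> dist (dx2 g (0, y)) (dx2 g (0, y0)) < \<rho> / 2"
    using \<open>\<rho> > 0\<close> unfolding continuous_at_eps_delta by (metis half_gt_zero)
  define \<eta> where "\<eta> = r / 4"
  have "\<eta> > 0" using r by (simp add: \<eta>_def)
  have g': "dx2 g (0, y) \<ge> \<rho> / 2" if "\<bar>y - y0\<bar> \<le> 2 * \<eta>" for y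
    using r(2)[of y] that r(1) y0(2) by (auto simp: dist_real_def \<eta>_def abs_if split: if_splits)
  have gd: "((\<lambda>x. g (0, x)) has_real_derivative dx2 g (0, x)) (at x)" for x by (rule smooth2_DERIV_snd[OF g_smooth])
  have g_right: "g (0, y) \<ge> \<rho> / 2 * (y - y0)" if y: "y0 < y" "y \<le> y0 + 2 * \<eta>" for y
  proof -
    obtain z where z: "y0 < z" "z < y" "g (0, y) - g (0, y0) = (y - y0) * dx2 g (0, z)"
      using MVT2[OF y(1) gd] by blast
    have "(y - y0) * (\<rho> / 2) \<le> (y - y0) * dx2 g (0, z)" using z y by (intro mult_left_mono g') auto
    then show ?thesis using z y0(1) by (simp add: mult.commute)
  qed
  have g_left: "g (0, y) \<le> \<rho> / 2 * (y - y0)" if y: "y < y0" "y0 - 2 * \<eta> \<le> y" for y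
  proof -
    obtain z where z: "y < z" "z < y0" "g (0, y0) - g (0, y) = (y0 - y) * dx2 g (0, z)"
      using MVT2[OF y(1) gd] by blast
    have "(y0 - y) * (\<rho> / 2) \<le> (y0 - y) * dx2 g (0, z)" using z y by (intro mult_left_mono g') auto
    then show ?thesis using z y0(1) by (simp add: field_simps)
  qed
  \<comment> \<open>In this order: the corrector of E stays below M; the displacement \<epsilon> H
    stays below \<eta> / 2; the second-order error stays below half the restoring drift \<rho>
    \<eta> / 4 at the barrier; and it costs at most half of the slope \<rho> / 2 in the growth of
    E.\<close>
  define \<epsilon>0 where "\<epsilon>0 = Min {1, \<eta> / (2 * M), \<rho> * \<eta> / (8 * M\<^sup>2), \<rho> / (4 * M\<^sup>2)}"
  have "\<epsilon>0 > 0" using \<open>\<eta> > 0\<close> \<open>\<rho> > 0\<close> M(1) by (simp add: \<epsilon>0_def)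
  moreover have "E (t, y0) \<ge> \<epsilon> * (\<rho> / 4) * t - M" if \<epsilon>: "0 < \<epsilon>" "\<epsilon> < \<epsilon>0" and ch: "characteristics m \<epsilon> V \<Phi> E" and "t \<ge> 0" for \<epsilon> \<Phi> E t
  proof -
    interpret characteristics m \<epsilon> V \<Phi> E by (fact ch)
    have "\<epsilon> < 1" "\<epsilon> < \<eta> / (2 * M)" "\<epsilon> < \<rho> * \<eta> / (8 * M\<^sup>2)" "\<epsilon> < \<rho> / (4 * M\<^sup>2)"
      using \<epsilon>(2) by (auto simp: \<epsilon>0_def)
    then have e: "\<epsilon> < 1" "\<epsilon> * M < \<eta> / 2" "\<epsilon> * M\<^sup>2 < \<rho> * \<eta> / 8" "\<epsilon> * M\<^sup>2 < \<rho> / 4"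
      using M(1) by (auto simp: field_simps)
    define y where "y t = \<Phi> (t, y0) + real m * t" for t
    have V_W: "V (t, \<Phi> (t, y0)) = W (t, y t)" "dx2 V (t, \<Phi> (t, y0)) = dx2 W (t, y t)" for t
      by (simp_all add: dx2_W) (simp_all add: W_def y_def)
    have y': "(y has_real_derivative - \<epsilon> * W (t, y t)) (at t)" for t
    proof -
      have "((\<lambda>t. \<Phi> (t, y0) + real m * t) has_real_derivative - (m + \<epsilon> * V (t, \<Phi> (t, y0))) + real m) (at t)"
        by (intro DERIV_add \<Phi>t) (auto intro!: derivative_eq_intros)
      then show ?thesis by (simp add: V_W flip: y_def)
    qed
    define z where "z t = y t + \<epsilon> * H (t, y t)" for t
    define z' where "z' t = - \<epsilon> * g (0, y t) - \<epsilon>\<^sup>2 * (dx2 H (t, y t) * W (t, y t))" for t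
    have Hp: "has_partials H (\<lambda>p. W p - g p) (dx2 H)"
    proof -
      have "dt2 H (t, x) = W (t, x) - g (t, x)" for t x
        using H_t smooth2_DERIV_fst[OF H_smooth] DERIV_unique by blast
      then have "dt2 H = (\<lambda>p. W p - g p)" by auto
      then show ?thesis using smooth2_has_partials[OF H_smooth] by simp
    qed
    have Hxp: "has_partials (dx2 H) (\<lambda>p. dx2 W p - dx2 g p) (dx2 (dx2 H))"
    proof -
      have "((\<lambda>t. dx2 H (t, x)) has_real_derivative dx2 W (t, x) - dx2 g (t, x)) (at t)" for t x
        unfolding dx2_H by (rule prim_DERIV_fst) (intro smooth2_continuous smooth2_diff smooth2_dx2 W_smooth g_smooth)
      then have "dt2 (dx2 H) (t, x) = dx2 W (t, x) - dx2 g (t, x)" for t x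
        using smooth2_DERIV_fst[OF sm(1)] DERIV_unique by blast
      then have "dt2 (dx2 H) = (\<lambda>p. dx2 W p - dx2 g p)" by auto
      then show ?thesis using smooth2_has_partials[OF sm(1)] by simp
    qed
    have zd: "(z has_real_derivative z' t) (at t)" for t
      unfolding z_def[abs_def] z'_def
      by (rule derivative_eq_intros y' has_partials_curve[OF Hp] refl)+
        (simp add: g_fst[of t "y t"] power2_eq_square algebra_simps)
    have z0: "z 0 = y0" by (simp add: z_def y_def \<Phi>(2) H_0)
    have yz: "\<bar>y t - z t\<bar> < \<eta> / 2" for t
    proof -
      have "\<bar>y t - z t\<bar> = \<epsilon> * \<bar>H (t, y t)\<bar>" using \<epsilon>(1) by (simp add: z_def abs_mult)
      also have "\<dots> \<le> \<epsilon> * M" using M \<epsilon>(1) by (intro mult_left_mono) auto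
      finally show ?thesis using e by simp
    qed
    have small: "\<bar>\<epsilon>\<^sup>2 * (dx2 H (t, y t) * W (t, y t))\<bar> < \<epsilon> * (\<rho> * \<eta> / 8)" for t
    proof -
      have "\<bar>\<epsilon>\<^sup>2 * (dx2 H (t, y t) * W (t, y t))\<bar> \<le> \<epsilon>\<^sup>2 * M\<^sup>2"
        unfolding abs_mult[of "\<epsilon>\<^sup>2"] using prod by (intro mult_mono) auto
      also have "\<dots> = \<epsilon> * (\<epsilon> * M\<^sup>2)" by (simp add: power2_eq_square)
      also have "\<dots> < \<epsilon> * (\<rho> * \<eta> / 8)" using e \<epsilon>(1) by (intro mult_strict_left_mono) auto
      finally show ?thesis .
    qed
    have pos: "\<epsilon> * (\<rho> * \<eta> / 4) > \<epsilon> * (\<rho> * \<eta> / 8)" using \<epsilon>(1) \<open>\<rho> > 0\<close> \<open>\<eta> > 0\<close> by simp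
    \<comment> \<open>When z is at distance \<eta> from y0, the orbit y is on the same side at
      distance between \<eta> / 2 and 2 \<eta>. There |g| is at least \<rho> \<eta> / 4, which
      outweighs the error, so z moves back inwards.\<close>
    have up: "z t < y0 + \<eta>" if "t \<ge> 0" for t
    proof (rule below_barrier[OF zd _ _ that])
      fix t assume "z t = y0 + \<eta>"
      then have yt: "y0 + \<eta> / 2 \<le> y t" "y t \<le> y0 + 2 * \<eta>" using yz[of t] \<open>\<eta> > 0\<close> by linarith+
      have "\<rho> / 2 * (\<eta> / 2) \<le> \<rho> / 2 * (y t - y0)" using yt \<open>\<rho> > 0\<close> by (intro mult_left_mono) auto
      also have "\<dots> \<le> g (0, y t)" using yt \<open>\<eta> > 0\<close> by (intro g_right) auto
      finally have "\<epsilon> * (\<rho> * \<eta> / 4) \<le> \<epsilon> * g (0, y t)" using \<epsilon>(1) by (intro mult_left_mono) auto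
      then show "z' t < 0" using small[of t] pos unfolding z'_def by linarith
    qed (use z0 \<open>\<eta> > 0\<close> in auto)
    have down: "- z t < - y0 + \<eta>" if "t \<ge> 0" for t
    proof (rule below_barrier[OF DERIV_minus[OF zd] _ _ that])
      fix t assume "- z t = - y0 + \<eta>"
      then have yt: "y t \<le> y0 - \<eta> / 2" "y0 - 2 * \<eta> \<le> y t" using yz[of t] \<open>\<eta> > 0\<close> by linarith+
      have "g (0, y t) \<le> \<rho> / 2 * (y t - y0)" using yt \<open>\<eta> > 0\<close> by (intro g_left) auto
      also have "\<dots> \<le> \<rho> / 2 * (- \<eta> / 2)" using yt \<open>\<rho> > 0\<close> by (intro mult_left_mono) auto
      finally have "\<epsilon> * g (0, y t) \<le> \<epsilon> * (- (\<rho> * \<eta> / 4))" using \<epsilon>(1) by (intro mult_left_mono) auto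
      then show "- z' t < 0" using small[of t] pos unfolding z'_def by linarith
    qed (use z0 \<open>\<eta> > 0\<close> in auto)
    have near: "\<bar>y t - y0\<bar> \<le> 2 * \<eta>" if "t \<ge> 0" for t
      using up[OF that] down[OF that] yz[of t] \<open>\<eta> > 0\<close> by linarith
    \<comment> \<open>The same averaging for the exponent: subtracting \<epsilon> H_x trades W_x for
      the slope of g up to O(\<epsilon>). The last term removes the claimed growth, so it remains to
      see that k does not decrease.\<close>
    define k where "k t = E (t, y0) - \<epsilon> * dx2 H (t, y t) - \<epsilon> * (\<rho> / 4) * t" for t
    have kd: "(k has_real_derivative \<epsilon> * (dx2 g (0, y t) + \<epsilon> * (dx2 (dx2 H) (t, y t) * W (t, y t)) - \<rho> / 4)) (at t)" for t
      unfolding k_def[abs_def]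
      by (rule derivative_eq_intros Et has_partials_curve[OF Hxp y'] refl)+
        (simp add: V_W dx2_g_fst[of t "y t"] algebra_simps)
    have "k 0 \<le> k t"
    proof (rule DERIV_nonneg_imp_nondecreasing[OF \<open>t \<ge> 0\<close>], intro exI conjI)
      fix \<tau> assume \<tau>: "0 \<le> \<tau>" "\<tau> \<le> t"
      show "(k has_real_derivative \<epsilon> * (dx2 g (0, y \<tau>) + \<epsilon> * (dx2 (dx2 H) (\<tau>, y \<tau>) * W (\<tau>, y \<tau>)) - \<rho> / 4)) (at \<tau>)"
        by (rule kd)
      have "\<bar>\<epsilon> * (dx2 (dx2 H) (\<tau>, y \<tau>) * W (\<tau>, y \<tau>))\<bar> \<le> \<epsilon> * M\<^sup>2"
        unfolding abs_mult[of \<epsilon>] using prod \<epsilon>(1) by (intro mult_mono) auto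
      then have "dx2 g (0, y \<tau>) + \<epsilon> * (dx2 (dx2 H) (\<tau>, y \<tau>) * W (\<tau>, y \<tau>)) - \<rho> / 4 \<ge> 0"
        using g'[OF near[OF \<tau>(1)]] e(4) by linarith
      then show "0 \<le> \<epsilon> * (dx2 g (0, y \<tau>) + \<epsilon> * (dx2 (dx2 H) (\<tau>, y \<tau>) * W (\<tau>, y \<tau>)) - \<rho> / 4)"
        using \<epsilon>(1) by simp
    qed
    moreover have "k 0 = 0" by (simp add: k_def E(2) H_0)
    moreover have "\<epsilon> * dx2 H (t, y t) \<ge> - M"
    proof -
      have "\<bar>\<epsilon> * dx2 H (t, y t)\<bar> \<le> 1 * M" unfolding abs_mult using M e(1) \<epsilon>(1) by (intro mult_mono) auto
      then show ?thesis by linarith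
    qed
    ultimately show ?thesis by (simp add: k_def)
  qed
  ultimately show ?thesis using that M(1) less_imp_le by blast
qed

end

section \<open>Sobolev embedding and conclusion\<close>

lemma sup_le_sob_norm:
  assumes f: "in_Hs s f" "continuous_on UNIV f" "(f has_vector_derivative D) (at a)" and s: "s > 1"
  shows "cmod (f a) \<le> sqrt (\<Sum>\<^sub>\<infinity>k. japan k powr (- 2)) * sob_norm s f"
proof -
  define S where "S = (\<Sum>\<^sub>\<infinity>k. japan k powr (- 2))"
  have part: "cmod (\<Sum>k\<in>F. fcoef f k * ei k a) \<le> sqrt S * sob_norm s f" if F: "finite F" for F
  proof -
    have "cmod (\<Sum>k\<in>F. fcoef f k * ei k a) \<le> (\<Sum>k\<in>F. japan k powr (- s) * (japan k powr s * cmod (fcoef f k)))"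
      by (rule order_trans[OF norm_sum]) (simp add: norm_mult mult.assoc[symmetric] flip: powr_add)
    moreover have "(\<Sum>k\<in>F. japan k powr (- s) * (japan k powr s * cmod (fcoef f k)))\<^sup>2 \<le> S * (sob_norm s f)\<^sup>2"
    proof -
      have sq: "(japan k powr r)\<^sup>2 = japan k powr (2 * r)" for k r by (simp add: power2_eq_square flip: powr_add)
      \<comment> \<open>For s > 1 the weight is dominated by the one at s = 1. This frees the
        embedding constant of s, as required since \<open>\<delta>1\<close> is chosen before
        s.\<close>
      have "(\<Sum>k\<in>F. (japan k powr (- s))\<^sup>2) \<le> (\<Sum>k\<in>F. japan k powr (- 2))"
        using s japan_ge_1 by (intro sum_mono) (auto simp: sq intro!: powr_mono)
      also have "\<dots> \<le> S" unfolding S_def using F by (intro finite_sum_le_infsum summable_on_japan) auto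
      finally have "(\<Sum>k\<in>F. (japan k powr (- s))\<^sup>2) \<le> S" .
      moreover have "(\<Sum>k\<in>F. (japan k powr s * cmod (fcoef f k))\<^sup>2) \<le> (sob_norm s f)\<^sup>2"
        using sob_sum_le[OF f(1) F] by (simp add: power_mult_distrib sq)
      ultimately have "(\<Sum>k\<in>F. (japan k powr (- s))\<^sup>2) * (\<Sum>k\<in>F. (japan k powr s * cmod (fcoef f k))\<^sup>2) \<le> S * (sob_norm s f)\<^sup>2"
        by (intro mult_mono) (auto simp: S_def intro!: sum_nonneg infsum_nonneg)
      then show ?thesis by (rule order_trans[OF Cauchy_Schwarz_ineq_sum])
    qed
    then have "(\<Sum>k\<in>F. japan k powr (- s) * (japan k powr s * cmod (fcoef f k))) \<le> sqrt (S * (sob_norm s f)\<^sup>2)"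
      by (rule real_le_rsqrt)
    moreover have "sqrt (S * (sob_norm s f)\<^sup>2) = sqrt S * sob_norm s f"
      by (simp add: real_sqrt_mult sob_norm_def infsum_nonneg)
    ultimately show ?thesis by linarith
  qed
  have "(\<lambda>N. cmod (\<Sum>k\<in>{- int N..int N}. fcoef f k * ei k a)) \<longlonglongrightarrow> cmod (f a)"
    using f(1) by (intro tendsto_norm fourier_inversion[OF f(2) _ f(3)]) (simp add: in_Hs_def)
  then show ?thesis unfolding S_def[symmetric] by (rule LIMSEQ_le_const2) (auto intro: part)
qed

lemma sob_norm_one: "sob_norm s (\<lambda>x. 1) = 1"
proof -
  have "fcoef (\<lambda>x. 1) k = (if k = 0 then 1 else 0)" for k
  proof -
    have "mode (\<lambda>x. 1) (- k) = integral {0..2*pi} (ei (- k))" by (subst mode_eq_integral) auto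
    then show ?thesis by (simp add: fcoef_eq_mode integral_ei)
  qed
  then have "(\<Sum>\<^sub>\<infinity>k. japan k powr (2 * s) * (cmod (fcoef (\<lambda>x. 1) k))\<^sup>2) = (\<Sum>\<^sub>\<infinity>k\<in>{0}. japan k powr (2 * s) * (cmod (fcoef (\<lambda>x. 1) k))\<^sup>2)"
    by (intro infsum_cong_neutral) auto
  also have "\<dots> = 1" using \<open>\<And>k. fcoef (\<lambda>x. 1) k = (if k = 0 then 1 else 0)\<close> by (simp add: japan_def)
  finally show ?thesis by (simp add: sob_norm_def)
qed

theorem theorem1:
  fixes m :: nat and V :: "real \<times> real \<Rightarrow> real"
  assumes "m > 0" and "smooth2 V" and "periodic2 V" and "resonantly_unstable m V"
  shows "\<exists>\<epsilon>0>0. \<exists>\<delta>1>0. \<exists>\<delta>2>0. \<forall>\<epsilon>. 0 < \<epsilon> \<and> \<epsilon> < \<epsilon>0 \<longrightarrow>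
           (\<forall>s>1. \<exists>u0. in_Hs s u0 \<and> sob_norm s u0 \<noteq> 0 \<and>
              (\<exists>u. is_solution m \<epsilon> V s u0 u) \<and>
              (\<forall>u. is_solution m \<epsilon> V s u0 u \<longrightarrow>
                 (\<forall>t>0. sob_norm s (u t) \<ge> \<delta>1 * exp (\<epsilon> * \<delta>2 * t) * sob_norm s u0)))"
proof -
  interpret resonance m V by unfold_locales (fact assms)+
  obtain y0 where y0: "g (0, y0) = 0" "dx2 g (0, y0) > 0" using unstable_zero[OF assms(4)] .
  define \<rho> where "\<rho> = dx2 g (0, y0)"
  obtain \<epsilon>0 M where \<epsilon>0: "\<epsilon>0 > 0"
    and growth: "\<And>\<epsilon> \<Phi> E t. 0 < \<epsilon> \<Longrightarrow> \<epsilon> < \<epsilon>0 \<Longrightarrow> characteristics m \<epsilon> V \<Phi> E \<Longrightarrow> t \<ge> 0 \<Longrightarrow> E (t, y0) \<ge> \<epsilon> * (\<rho> / 4) * t - M"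
    using stretching_along_trapped_orbit[OF y0(1) refl y0(2)] unfolding \<rho>_def by metis
  define S where "S = (\<Sum>\<^sub>\<infinity>k. japan k powr (- 2))"
  have S: "S > 0"
  proof -
    have "(\<Sum>k\<in>{0}. japan k powr (- 2)) \<le> S"
      unfolding S_def by (intro finite_sum_le_infsum summable_on_japan) auto
    then show ?thesis by (simp add: japan_def)
  qed
  \<comment> \<open>The solution is exp (E / 2), which halves both the loss M and the rate \<rho> /
    4; the factor sqrt S converts the sup norm into the Sobolev norm.\<close>
  define \<delta>1 where "\<delta>1 = exp (- M / 2) / sqrt S"
  define \<delta>2 where "\<delta>2 = \<rho> / 8"
  have pos: "\<delta>1 > 0" "\<delta>2 > 0" using S y0 by (auto simp: \<delta>1_def \<delta>2_def \<rho>_def)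
  have "\<exists>u0. in_Hs s u0 \<and> sob_norm s u0 \<noteq> 0 \<and> (\<exists>u. is_solution m \<epsilon> V s u0 u) \<and>
          (\<forall>u. is_solution m \<epsilon> V s u0 u \<longrightarrow> (\<forall>t>0. sob_norm s (u t) \<ge> \<delta>1 * exp (\<epsilon> * \<delta>2 * t) * sob_norm s u0))"
    if \<epsilon>: "0 < \<epsilon>" "\<epsilon> < \<epsilon>0" and s: "s > 1" for \<epsilon> s
  proof -
    obtain \<Phi> E where ch: "characteristics m \<epsilon> V \<Phi> E" using characteristics_exist[OF assms(2,3)] .
    interpret ch: characteristics m \<epsilon> V \<Phi> E by (fact ch)
    have "\<delta>1 * exp (\<epsilon> * \<delta>2 * t) \<le> sob_norm s (w t)" if w: "is_solution m \<epsilon> V s (\<lambda>x. 1) w" and "t > 0" for w t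
    proof -
      obtain D where D: "(ch.u t has_vector_derivative D) (at (\<Phi> (t, y0)))" using ch.u_differentiable by blast
      have "exp (\<epsilon> * \<delta>2 * t) * exp (- M / 2) = exp ((\<epsilon> * (\<rho> / 4) * t - M) / 2)"
        by (simp add: \<delta>2_def diff_divide_distrib mult_ac flip: exp_add)
      also have "\<dots> \<le> exp (E (t, y0) / 2)" using growth[OF \<epsilon> ch, of t] \<open>t > 0\<close> by simp
      also have "\<dots> = cmod (ch.u t (\<Phi> (t, y0)))" by (simp add: ch.u_\<Phi>)
      also have "\<dots> \<le> sqrt S * sob_norm s (ch.u t)"
        unfolding S_def using \<open>t > 0\<close> by (intro sup_le_sob_norm[OF ch.u_in_Hs ch.continuous_on_u D s]) simp
      \<comment> \<open>Agreement of the Fourier coefficients suffices here, since the norm sees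
        nothing else of a solution.\<close>
      also have "sob_norm s (ch.u t) = sob_norm s (w t)"
        using \<open>t > 0\<close> by (intro solution_sob_norm_unique[OF assms(2,3) s ch.u_is_solution w]) simp
      finally show ?thesis using S by (simp add: \<delta>1_def field_simps)
    qed
    moreover have "in_Hs s (\<lambda>x. 1)" using ch.u_in_Hs[of 0 s] by (simp add: ch.u_0)
    ultimately show ?thesis
      using ch.u_is_solution by (intro exI[of _ "\<lambda>x. 1"]) (auto simp: sob_norm_one)
  qed
  then show ?thesis using \<epsilon>0 pos by blast
qed

end
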